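(* Let $K$ be a field, and let $a$ and $b$ be integers with $1\leq a<b$. Then there exists a tree $G$ such that its edge ideal $I_G$ satisfies $\operatorname{dstab}(I_G)=a$ and $\ell(I_G)=b$.
   Context: For a finite simple graph $G$ on the vertex set $[n]=\{1,\ldots,n\}$ with edge set $E(G)$, let $S=K[x_1,\ldots,x_n]$ be the polynomial ring over the field $K$ with graded maximal ideal $\mathfrak m=(x_1,\ldots,x_n)$; the edge ideal of $G$ is the ideal $I_G\subset S$ generated by the monomials $x_ix_j$ with $\{i,j\}\in E(G)$. For a graded ideal $I\subset S$, $\operatorname{depth} S/I^k$ is constant for all $k\gg 0$ (Brodmann), and one defines $$\operatorname{dstab}(I)=\min\{k\geq 1 : \operatorname{depth} S/I^k=\operatorname{depth} S/I^l \text{ for all } l\geq k\}.$$ Here depth is taken with respect to $\mathfrak m$. The analytic spread $\ell(I)$ of $I$ is the Krull dimension of $\mathcal R(I)/\mathfrak m\mathcal R(I)$, where $\mathcal R(I)=\bigoplus_{k\geq 0}I^kt^k\subset S[t]$ is the Rees ring of $I$. *)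

theory Defs
  imports
    "HOL-Algebra.UnivPoly"
    "HOL-Algebra.QuotRing"
    "HOL-Algebra.Ideal_Product"
    "HOL-Algebra.Algebraic_Closure_Type"
    "HOL-Library.Poly_Mapping"
    "HOL-Library.Extended_Nat"
    "Graph_Theory.Graph_Theory"
begin

section \<open>Ideal powers, regular sequences and depth\<close>

abbreviation ideal_pow :: "('a, 'm) ring_scheme \<Rightarrow> 'a set \<Rightarrow> nat \<Rightarrow> 'a set" where
  "ideal_pow R I k \<equiv> I [^]\<^bsub>ideals_set R\<^esub> k"

text \<open>The residue class ring \<open>R/J\<close> regarded as an \<open>R\<close>-module.\<close>

definition quot_module :: "('a, 'm) ring_scheme \<Rightarrow> 'a set \<Rightarrow> ('a, 'a set) module" where
  "quot_module R J = ring.extend (R Quot J)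
     (module.fields (\<lambda>r c. (J +>\<^bsub>R\<^esub> r) \<otimes>\<^bsub>R Quot J\<^esub> c))"

text \<open>The submodule \<open>(f\<^sub>0, \<dots>, f\<^sub>i\<^sub>-\<^sub>1) M\<close> generated by the first \<open>i\<close> entries of the list \<open>fs\<close>.\<close>

definition seq_submodule ::
  "('a, 'b, 'm) module_scheme \<Rightarrow> 'a list \<Rightarrow> nat \<Rightarrow> 'b set" where
  "seq_submodule M fs i =
     (\<lambda>x. \<Oplus>\<^bsub>M\<^esub>j\<in>{..<i}. (fs ! j) \<odot>\<^bsub>M\<^esub> x j) ` ({..<i} \<rightarrow> carrier M)"

text \<open>
  The second conjunct says that \<open>f\<^sub>i\<close> is a nonzerodivisor on \<open>M / (f\<^sub>0, \<dots>, f\<^sub>i\<^sub>-\<^sub>1) M\<close>,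
  the third one that \<open>M / (f\<^sub>0, \<dots>, f\<^sub>r\<^sub>-\<^sub>1) M\<close> is nonzero.
\<close>

definition regular_sequence ::
  "('a, 'm) ring_scheme \<Rightarrow> ('a, 'b, 'n) module_scheme \<Rightarrow> 'a list \<Rightarrow> bool" where
  "regular_sequence R M fs \<longleftrightarrow>
     set fs \<subseteq> carrier R \<and>
     (\<forall>i<length fs. \<forall>x\<in>carrier M.
        (fs ! i) \<odot>\<^bsub>M\<^esub> x \<in> seq_submodule M fs i \<longrightarrow> x \<in> seq_submodule M fs i) \<and>
     seq_submodule M fs (length fs) \<noteq> carrier M"

definition depth ::
  "('a, 'm) ring_scheme \<Rightarrow> 'a set \<Rightarrow> ('a, 'b, 'n) module_scheme \<Rightarrow> enat" where
  "depth R \<mm> M = Sup {enat (length fs) | fs. set fs \<subseteq> \<mm> \<and> regular_sequence R M fs}"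

definition dstab :: "('a, 'm) ring_scheme \<Rightarrow> 'a set \<Rightarrow> 'a set \<Rightarrow> nat" where
  "dstab R \<mm> I = (LEAST k. 1 \<le> k \<and>
     (\<forall>l\<ge>k. depth R \<mm> (quot_module R (ideal_pow R I k)) =
            depth R \<mm> (quot_module R (ideal_pow R I l))))"


section \<open>Krull dimension, Rees ring and analytic spread\<close>

text \<open>The zero ring gets dimension \<open>0\<close> here, as supremum of the empty set.\<close>

definition krull_dim :: "('a, 'm) ring_scheme \<Rightarrow> enat" where
  "krull_dim R = Sup {enat r | r. \<exists>P :: nat \<Rightarrow> 'a set.
     (\<forall>i\<le>r. primeideal (P i) R) \<and> (\<forall>i<r. P i \<subset> P (Suc i))}"

definition rees_ring :: "('a, 'm) ring_scheme \<Rightarrow> 'a set \<Rightarrow> ('a, nat \<Rightarrow> 'a) up_ring" where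
  "rees_ring R I = (UP R)
     \<lparr>carrier := {p \<in> carrier (UP R). \<forall>k. up_ring.coeff (UP R) p k \<in> ideal_pow R I k}\<rparr>"

text \<open>The ideal \<open>\<mm> \<R>(I)\<close>, where \<open>R\<close> sits in \<open>\<R>(I)\<close> in degree zero.\<close>

definition rees_extension :: "('a, 'm) ring_scheme \<Rightarrow> 'a set \<Rightarrow> 'a set \<Rightarrow> (nat \<Rightarrow> 'a) set" where
  "rees_extension R \<mm> I = Idl\<^bsub>rees_ring R I\<^esub> ((\<lambda>r. up_ring.monom (UP R) r 0) ` \<mm>)"

definition analytic_spread :: "('a, 'm) ring_scheme \<Rightarrow> 'a set \<Rightarrow> 'a set \<Rightarrow> enat" where
  "analytic_spread R \<mm> I = krull_dim (rees_ring R I Quot rees_extension R \<mm> I)"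


section \<open>Polynomial rings\<close>

text \<open>
  A polynomial maps finitely many exponent vectors to nonzero coefficients; the product on this
  type is convolution. The variables are indexed by all natural numbers, and \<open>K[x\<^sub>i | i \<in> V]\<close> is
  the subring of the polynomials in which no other variable occurs.
\<close>

type_synonym 'k mpoly = "(nat \<Rightarrow>\<^sub>0 nat) \<Rightarrow>\<^sub>0 'k"

definition mpoly_ring :: "nat set \<Rightarrow> ('k::field) mpoly ring" where
  "mpoly_ring V = ring_of_type_algebra
     \<lparr>carrier := {p. \<forall>m\<in>Poly_Mapping.keys p. Poly_Mapping.keys m \<subseteq> V}\<rparr>"

definition Var :: "nat \<Rightarrow> ('k::field) mpoly" where
  "Var i = Poly_Mapping.single (Poly_Mapping.single i 1) 1"

definition graded_max_ideal :: "nat set \<Rightarrow> ('k::field) mpoly set" where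
  "graded_max_ideal V = Idl\<^bsub>mpoly_ring V\<^esub> (Var ` V)"


section \<open>Graphs and edge ideals\<close>

text \<open>
  Finite simple graphs are the symmetric loop-free digraphs of \<^locale>\<open>pair_graph\<close>, an edge
  \<open>{i, j}\<close> being represented by the two arcs \<open>(i, j)\<close> and \<open>(j, i)\<close>. The library's
  \<open>Digraph_Component.tree\<close> cannot be used: it counts the closed walk along \<open>(i, j)\<close> and \<open>(j, i)\<close>
  as a cycle. Hence only cycles with at least three arcs are considered.
\<close>

definition is_tree :: "'v pair_pre_digraph \<Rightarrow> bool" where
  "is_tree G \<longleftrightarrow> pair_graph G \<and> Digraph_Component.connected (with_proj G) \<and>
     \<not> (\<exists>p. pre_digraph.cycle (with_proj G) p \<and> 3 \<le> length p)"

definition edge_ideal :: "nat pair_pre_digraph \<Rightarrow> ('k::field) mpoly set" where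
  "edge_ideal G = Idl\<^bsub>mpoly_ring (pverts G)\<^esub> {Var i * Var j | i j. (i, j) \<in> parcs G}"

end

theory Submission
  imports Defs
begin

text \<open>
  The tree is a broom: a path \<open>h, h + 1, \<dots>, b + 1\<close> with \<open>h = b - a + 1\<close>, together with \<open>h - 1\<close> further
  leaves \<open>1, \<dots>, h - 1\<close> attached to \<open>h\<close>. It has \<open>b\<close> edges and exactly \<open>a\<close> vertices that are not leaves,
  namely \<open>h, \<dots>, b\<close>. Let \<open>I\<close> be its edge ideal. The exponents of the monomials in \<open>I\<^sup>k\<close> are those that
  dominate a sum of \<open>k\<close> edges (\<open>pow_exps\<close>, \<open>ideal_pow_monomials\<close>).

  Depth. For every \<open>k\<close> the binomial \<open>x\<^sub>1 - x\<^sub>h\<close> is regular on \<open>S/I\<^sup>k\<close> (\<open>first_regular\<close>), so the depth is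
  at least 1. It is at most 1 for \<open>k \<ge> a\<close>: let \<open>u\<close> be the product of the \<open>a - 1\<close> edges between inner
  vertices, times the edge monomial \<open>x\<^sub>b x\<^sub>b\<^sub>+\<^sub>1\<close> to the power \<open>k - a\<close>. Then \<open>u x\<^sub>i x\<^sub>j \<in> I\<^sup>k\<close> whenever
  \<open>i\<close> and \<open>j\<close> have different colours (\<open>socle_join\<close>), while \<open>u\<close> has degree only \<open>k - 1\<close> in the variables of either colour. In terms
  of local cohomology, the degree complex of \<open>S/I\<^sup>k\<close> at the exponent of \<open>u\<close> is disconnected and produces
  a nonzero class in \<open>H\<^sup>1\<close>; \<open>no_regular_pair\<close> is the elementary form of this argument.

  For \<open>k < a\<close> the binomials \<open>x\<^sub>1 - x\<^sub>h\<close> and \<open>x\<^sub>b - x\<^sub>b\<^sub>+\<^sub>1\<close> form a regular sequence. Reducing modulo the first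
  one means to identify the vertices \<open>1\<close> and \<open>h\<close>, which turns the edge between them into a loop
  (\<open>binomial_regular_after_merge\<close>). The second one stays regular because of the following property of
  the number \<open>\<nu>\<close> of edges that can be packed into a monomial. As a function of the exponent at the end
  vertex of a path that starts in an arbitrary graph, \<open>\<nu>\<close> is concave as long as its value is smaller
  than the length of the path: by greedy packing along the last edge, a failure of concavity at one
  end of this edge comes from a failure at the other end with one edge less (\<open>concave_path\<close>). Here
  the path from \<open>h\<close> to \<open>b\<close> has length \<open>a - 1\<close>. Hence the depth is at least 2 for \<open>k = a - 1\<close>, and
  \<open>dstab I = a\<close>.

  Analytic spread. All monomials in \<open>I\<^sup>k\<close> have degree at least \<open>2k\<close>. Taking the component of degree \<open>2k\<close>
  in every Rees degree \<open>k\<close> is a ring homomorphism from the Rees ring onto the subalgebra generated by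
  the edge monomials, and its kernel is \<open>\<mm> \<R>(I)\<close> (\<open>initial_hom\<close>, \<open>kernel_initial\<close>). So the fibre ring
  is isomorphic to this subalgebra. Its dimension is at most \<open>b\<close>: by counting monomials, any \<open>b + 1\<close> of its elements are algebraically dependent, and
  the lexicographically smallest term of a relation is incompatible with a chain of primes that is
  too long (\<open>no_relation_along_chain\<close>). It is at least \<open>b\<close> because each vertex \<open>i \<le> b\<close> has exactly one
  larger neighbour, so setting \<open>x\<^sub>1, x\<^sub>2, \<dots>\<close> to zero one after another kills one more edge monomial
  at each of the \<open>b\<close> steps (\<open>krull_dim_edge_ring\<close>).
\<close>

section \<open>Monomials in the powers of an edge ideal\<close>

abbreviation lookup :: "('a \<Rightarrow>\<^sub>0 'b::zero) \<Rightarrow> 'a \<Rightarrow> 'b" where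
  "lookup \<equiv> Poly_Mapping.lookup"

abbreviation keys :: "('a \<Rightarrow>\<^sub>0 'b::zero) \<Rightarrow> 'a set" where
  "keys \<equiv> Poly_Mapping.keys"

abbreviation single :: "'a \<Rightarrow> 'b \<Rightarrow> ('a \<Rightarrow>\<^sub>0 'b::zero)" where
  "single \<equiv> Poly_Mapping.single"

abbreviation xv :: "'v \<Rightarrow> 'v \<Rightarrow>\<^sub>0 nat" where
  "xv v \<equiv> single v 1"

text \<open>The exponents of the monomials in the \<open>k\<close>-th power of the ideal generated by the monomials with
  exponents in \<open>E\<close>. Starting from \<^const>\<open>UNIV\<close> accounts for the cofactors.\<close>

primrec pow_exps :: "('v \<Rightarrow>\<^sub>0 nat) set \<Rightarrow> nat \<Rightarrow> ('v \<Rightarrow>\<^sub>0 nat) set" where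
  "pow_exps E 0 = UNIV"
| "pow_exps E (Suc k) = {e + m |e m. e \<in> E \<and> m \<in> pow_exps E k}"

lemma exp_split:
  assumes "0 < lookup m v"
  obtains n where "m = n + xv v"
proof
  show "m = (m - xv v) + xv v"
    using assms by (intro poly_mapping_eqI) (auto simp: lookup_add lookup_minus lookup_single when_def)
qed

lemma pow_exps_SucI: "e \<in> E \<Longrightarrow> m \<in> pow_exps E k \<Longrightarrow> e + m \<in> pow_exps E (Suc k)"
  by auto

lemma pow_exps_add: "m \<in> pow_exps E k \<Longrightarrow> m + p \<in> pow_exps E k"
proof (induction k arbitrary: m)
  case (Suc k)
  then obtain e n where "m = e + n" "e \<in> E" "n \<in> pow_exps E k" by auto
  with Suc.IH[of n] show ?case by (metis add.assoc pow_exps_SucI)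
qed simp

lemma pow_exps_plus: "m \<in> pow_exps F k \<Longrightarrow> n \<in> pow_exps F l \<Longrightarrow> m + n \<in> pow_exps F (k + l)"
proof (induction k arbitrary: m)
  case 0
  then show ?case using pow_exps_add[of n F l m] by (simp add: add.commute)
next
  case (Suc k)
  then obtain e r where m: "m = e + r" "e \<in> F" "r \<in> pow_exps F k" by auto
  have "e + (r + n) \<in> pow_exps F (Suc (k + l))" by (intro pow_exps_SucI m Suc)
  then show ?case by (simp add: m add.assoc del: pow_exps.simps)
qed

lemma pow_exps_mono: "E \<subseteq> F \<Longrightarrow> m \<in> pow_exps E k \<Longrightarrow> m \<in> pow_exps F k"
  by (induction k arbitrary: m) auto

text \<open>Removing one factor \<open>x\<^sub>v\<close> spoils at most one of the generators packed into a monomial.\<close>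

lemma pow_exps_drop_Suc:
  "m + xv v \<in> pow_exps E (Suc k) \<Longrightarrow> m \<in> pow_exps E k"
proof (induction k arbitrary: m)
  case (Suc k)
  then obtain e n where en: "m + xv v = e + n" "e \<in> E" "n \<in> pow_exps E (Suc k)"
    by (auto simp del: pow_exps.simps simp: pow_exps.simps(2)[of E "Suc k"])
  show ?case
  proof (cases "0 < lookup e v")
    case True
    then obtain e' where "e = e' + xv v" by (rule exp_split)
    with en(1) have "m = n + e'" by (metis add.assoc add.commute add_right_cancel)
    with en(3) show ?thesis using pow_exps_add by blast
  next
    case False
    have "lookup (m + xv v) v > 0" by (simp add: lookup_add)
    with False en(1) have "0 < lookup n v" by (simp add: lookup_add)
    then obtain n' where n': "n = n' + xv v" by (rule exp_split)
    with en(1) have m: "m = e + n'" by (metis add.assoc add_right_cancel)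
    have "n' \<in> pow_exps E k" using Suc.IH en(3) n' by blast
    with m en(2) show ?thesis by (simp add: pow_exps_SucI del: pow_exps.simps)
  qed
qed simp

lemma pow_exps_drop:
  assumes "\<forall>e\<in>E. lookup e w = 0"
  shows "m + xv w \<in> pow_exps E k \<longleftrightarrow> m \<in> pow_exps E k"
proof
  show "m + xv w \<in> pow_exps E k \<Longrightarrow> m \<in> pow_exps E k"
  proof (induction k arbitrary: m)
    case (Suc k)
    then obtain e n where en: "m + xv w = e + n" "e \<in> E" "n \<in> pow_exps E k"
      by auto
    have "lookup (m + xv w) w > 0" by (simp add: lookup_add)
    with assms en have "0 < lookup n w" by (simp add: lookup_add)
    then obtain n' where n': "n = n' + xv w" by (rule exp_split)
    with en(1) have m: "m = e + n'" by (metis add.assoc add_right_cancel)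
    have "n' \<in> pow_exps E k" using Suc.IH en(3) n' by blast
    with m en(2) show ?case by (simp add: pow_exps_SucI del: pow_exps.simps)
  qed simp
qed (rule pow_exps_add)

text \<open>A packing can be reordered so that the generator \<open>d\<close> comes first if it is used at all.\<close>

lemma pow_exps_insert_cases:
  assumes "m \<in> pow_exps (insert d E) k"
  shows "m \<in> pow_exps E k \<or> (\<exists>j n. k = Suc j \<and> m = d + n \<and> n \<in> pow_exps (insert d E) j)"
  using assms
proof (induction k arbitrary: m)
  case (Suc k)
  then obtain e n where en: "m = e + n" "e \<in> insert d E" "n \<in> pow_exps (insert d E) k" by auto
  show ?case
  proof (cases "e = d")
    case False
    then have e: "e \<in> E" using en by auto
    from Suc.IH[OF en(3)] show ?thesis
    proof (elim disjE exE conjE)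
      assume "n \<in> pow_exps E k"
      then show ?thesis using e en(1) by auto
    next
      fix j n' assume j: "k = Suc j" "n = d + n'" "n' \<in> pow_exps (insert d E) j"
      have "m = d + (e + n')" using j en(1) by (simp add: add_ac)
      moreover have "e + n' \<in> pow_exps (insert d E) k"
        unfolding j(1) by (rule pow_exps_SucI) (use e j in auto)
      ultimately show ?thesis by blast
    qed
  qed (use en in blast)
qed simp

text \<open>A pendant edge from \<open>v\<close> to a new leaf \<open>w\<close> is added to a graph. The set \<open>E\<close> is arbitrary apart from not
  involving \<open>w\<close>, so that it may in particular contain loops \<open>2 v\<close>; they arise from identifying vertices.\<close>

locale pendant =
  fixes E :: "('v \<Rightarrow>\<^sub>0 nat) set" and v w :: 'v
  assumes new: "\<forall>e\<in>E. lookup e w = 0" and neq: "v \<noteq> w"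
begin

abbreviation "E' \<equiv> insert (xv v + xv w) E"

lemma without_leaf:
  assumes "lookup m v = 0 \<or> lookup m w = 0"
  shows "m \<in> pow_exps E' k \<longleftrightarrow> m \<in> pow_exps E k"
proof
  assume "m \<in> pow_exps E' k"
  from pow_exps_insert_cases[OF this] show "m \<in> pow_exps E k"
    using assms by (auto simp: lookup_add)
next
  assume "m \<in> pow_exps E k"
  then show "m \<in> pow_exps E' k" by (rule pow_exps_mono[rotated]) auto
qed

text \<open>Greedy packing: the pendant edge may always be taken first. In a packing without this edge, the
  factor \<open>x\<^sub>w\<close> is idle and the removal of \<open>x\<^sub>v\<close> costs at most one generator, the one that is replaced.\<close>

lemma cancel_leaf: "xv v + xv w + m \<in> pow_exps E' (Suc k) \<longleftrightarrow> m \<in> pow_exps E' k"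
proof
  assume "xv v + xv w + m \<in> pow_exps E' (Suc k)"
  from pow_exps_insert_cases[OF this] show "m \<in> pow_exps E' k"
  proof (elim disjE exE conjE)
    assume "xv v + xv w + m \<in> pow_exps E (Suc k)"
    then have "m + xv v + xv w \<in> pow_exps E (Suc k)" by (simp only: add_ac)
    then have "m + xv v \<in> pow_exps E (Suc k)" by (simp only: pow_exps_drop[OF new])
    then have "m \<in> pow_exps E k" by (rule pow_exps_drop_Suc)
    then show ?thesis by (rule pow_exps_mono[rotated]) auto
  qed auto
qed (simp add: pow_exps_SucI del: pow_exps.simps)

lemma cancel_leaf': "m + (xv v + xv w) \<in> pow_exps E' (Suc k) \<longleftrightarrow> m \<in> pow_exps E' k"
  using cancel_leaf[of m k] by (simp only: add_ac)

lemma edge_mem: "m + (xv v + xv w) \<in> pow_exps E' (Suc 0)"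
  unfolding cancel_leaf' by simp

lemma drop_at_zero:
  assumes "lookup m v = 0" "m + xv w \<in> pow_exps E' k"
  shows "m \<in> pow_exps E k"
proof -
  have "lookup (m + xv w) v = 0"
    using assms(1) neq by (simp add: lookup_add lookup_single)
  with assms(2) have "m + xv w \<in> pow_exps E k" using without_leaf by blast
  then show ?thesis by (simp only: pow_exps_drop[OF new])
qed

end

text \<open>Let \<open>\<nu>(m)\<close> be the largest number of generators that can be packed into \<open>m\<close>. By \<open>pow_exps_drop_Suc\<close> every
  additional factor \<open>x\<^sub>v\<close> raises \<open>\<nu>\<close> by at most 1. The definition says that an increment 0 starting at a value \<open>k < K\<close> is not followed by an increment 1, so that \<open>\<nu>\<close> is concave in
  the direction of \<open>v\<close> below the level \<open>K\<close>.\<close>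

definition pow_concave :: "('v \<Rightarrow>\<^sub>0 nat) set \<Rightarrow> 'v \<Rightarrow> nat \<Rightarrow> bool" where
  "pow_concave E v K \<longleftrightarrow> (\<forall>k<K. \<forall>m. m \<in> pow_exps E k \<longrightarrow> m + xv v + xv v \<in> pow_exps E (Suc k) \<longrightarrow>
     m + xv v \<in> pow_exps E (Suc k))"

context pendant
begin

text \<open>Let \<open>R\<close> be the exponent of \<open>v\<close>. By greedy packing, \<open>\<nu>\<close> as a function of the exponent \<open>j\<close> of \<open>w\<close> is
  \<open>j + \<nu>\<^sub>E(R - j)\<close> for \<open>j \<le> R\<close> and constant from there on. A failure of concavity at \<open>j\<close> requires
  \<open>0 < j < R\<close> and is a failure for \<open>\<nu>\<^sub>E\<close> at \<open>R - j\<close>, where \<open>\<nu>\<^sub>E\<close> is smaller by \<open>j \<ge> 1\<close>. This is why the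
  level rises by one with every edge of a path.\<close>

lemma concave_path:
  assumes P: "pow_concave E v K"
  shows "pow_concave E' w (Suc K)"
  unfolding pow_concave_def
proof (intro allI impI)
  fix k m assume "k < Suc K" "m \<in> pow_exps E' k" "m + xv w + xv w \<in> pow_exps E' (Suc k)"
  then show "m + xv w \<in> pow_exps E' (Suc k)"
  proof (induction k arbitrary: m)
    case 0
    show ?case
    proof (cases "lookup m v = 0")
      case True
      then have "lookup (m + xv w) v = 0" using neq by (simp add: lookup_add lookup_single)
      from drop_at_zero[OF this 0(3)] show ?thesis by (rule pow_exps_mono[rotated]) auto
    next
      case False
      then obtain n where "m = n + xv v" by (auto elim: exp_split)
      then show ?thesis using edge_mem[of n] by (simp only: add_ac)
    qed
  next
    case (Suc k)
    show ?case
    proof (cases "lookup m v = 0")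
      case True
      then have "lookup (m + xv w) v = 0" using neq by (simp add: lookup_add lookup_single)
      from drop_at_zero[OF this Suc.prems(3)] show ?thesis by (rule pow_exps_mono[rotated]) auto
    next
      case False
      then obtain n where n: "m = n + xv v" by (auto elim: exp_split)
      show ?thesis
      proof (cases "lookup n w = 0")
        case nw: False
        then obtain n' where n': "n = n' + xv w" by (auto elim: exp_split)
        have m: "m = n' + (xv v + xv w)" by (simp only: n n' add_ac)
        have "n' \<in> pow_exps E' k" using Suc.prems(2) unfolding m cancel_leaf' .
        moreover have "(n' + xv w + xv w) + (xv v + xv w) \<in> pow_exps E' (Suc (Suc k))"
          using Suc.prems(3) by (simp only: m add_ac)
        then have "n' + xv w + xv w \<in> pow_exps E' (Suc k)" by (simp only: cancel_leaf')
        ultimately have "n' + xv w \<in> pow_exps E' (Suc k)" using Suc.IH Suc.prems(1) by simp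
        then have "(n' + xv w) + (xv v + xv w) \<in> pow_exps E' (Suc (Suc k))" by (simp only: cancel_leaf')
        then show ?thesis by (simp only: m add_ac)
      next
        case nw: True
        have "(n + xv w) + (xv v + xv w) \<in> pow_exps E' (Suc (Suc k))"
          using Suc.prems(3) by (simp only: n add_ac)
        then have 1: "n + xv w \<in> pow_exps E' (Suc k)" by (simp only: cancel_leaf')
        have "n \<in> pow_exps E' (Suc k)"
        proof (cases "lookup n v = 0")
          case True
          from drop_at_zero[OF this 1] show ?thesis by (rule pow_exps_mono[rotated]) auto
        next
          case False
          then obtain r where r: "n = r + xv v" by (auto elim: exp_split)
          have rw: "lookup r w = 0" using nw r by (simp add: lookup_add)
          have "r + (xv v + xv w) \<in> pow_exps E' (Suc k)" using 1 by (simp only: r add_ac)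
          then have "r \<in> pow_exps E' k" by (simp only: cancel_leaf')
          then have "r \<in> pow_exps E k" using without_leaf rw by blast
          moreover have "lookup m w = 0" using n nw neq by (simp add: lookup_add lookup_single)
          then have "m \<in> pow_exps E (Suc k)" using without_leaf Suc.prems(2) by blast
          then have "r + xv v + xv v \<in> pow_exps E (Suc k)" by (simp only: n r)
          ultimately have "r + xv v \<in> pow_exps E (Suc k)"
            using P Suc.prems(1) unfolding pow_concave_def by blast
          then show ?thesis unfolding r by (rule pow_exps_mono[rotated]) auto
        qed
        then have "n + (xv v + xv w) \<in> pow_exps E' (Suc (Suc k))" by (simp only: cancel_leaf')
        then show ?thesis by (simp only: n add_ac)
      qed
    qed
  qed
qed

text \<open>In the direction of \<open>v\<close>, the function \<open>\<nu>\<close> first has increments 1, until the factors \<open>x\<^sub>w\<close> are used up, and then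
  continues like the function of the smaller graph.\<close>

lemma concave_leaf:
  assumes P: "pow_concave E v K"
  shows "pow_concave E' v K"
  unfolding pow_concave_def
proof (intro allI impI)
  fix k m assume "k < K" "m \<in> pow_exps E' k" "m + xv v + xv v \<in> pow_exps E' (Suc k)"
  then show "m + xv v \<in> pow_exps E' (Suc k)"
  proof (induction k arbitrary: m)
    case (0 m)
    then show ?case
    proof (cases "lookup m w = 0")
      case True
      then have "lookup (m + xv v) w = 0" "lookup (m + xv v + xv v) w = 0"
        using neq by (simp_all add: lookup_add lookup_single)
      then show ?thesis using P 0 True without_leaf unfolding pow_concave_def by blast
    next
      case False
      then obtain n where "m = n + xv w" by (auto elim: exp_split)
      then show ?thesis using edge_mem[of n] by (simp only: add_ac)
    qed
  next
    case (Suc k)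
    show ?case
    proof (cases "lookup m w = 0")
      case True
      then have "lookup (m + xv v) w = 0" "lookup (m + xv v + xv v) w = 0"
        using neq by (simp_all add: lookup_add lookup_single)
      then show ?thesis using P Suc.prems True without_leaf unfolding pow_concave_def by blast
    next
      case False
      then obtain n where n: "m = n + xv w" by (auto elim: exp_split)
      have "n \<in> pow_exps E' (Suc k)"
      proof (cases "lookup n v = 0")
        case True
        have "n + xv w \<in> pow_exps E' (Suc k)" using Suc.prems(2) n by simp
        from drop_at_zero[OF True this] show ?thesis by (rule pow_exps_mono[rotated]) auto
      next
        case False
        then obtain n' where n': "n = n' + xv v" by (auto elim: exp_split)
        have m: "m = n' + (xv v + xv w)" by (simp only: n n' add_ac)
        have "n' \<in> pow_exps E' k" using Suc.prems(2) unfolding m cancel_leaf' .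
        moreover have "(n' + xv v + xv v) + (xv v + xv w) \<in> pow_exps E' (Suc (Suc k))"
          using Suc.prems(3) by (simp only: m add_ac)
        then have "n' + xv v + xv v \<in> pow_exps E' (Suc k)" by (simp only: cancel_leaf')
        ultimately show ?thesis using Suc.IH Suc.prems(1) n' by simp
      qed
      then have "n + (xv v + xv w) \<in> pow_exps E' (Suc (Suc k))" by (simp only: cancel_leaf')
      then show ?thesis by (simp only: n add_ac)
    qed
  qed
qed

text \<open>The purpose of concavity. After greedy packing either \<open>v\<close> has exponent 0, and then \<open>x\<^sub>w\<close> is useless, or \<open>w\<close>
  has exponent 0. In the latter case adding \<open>x\<^sub>w\<close> amounts to removing one \<open>x\<^sub>v\<close> at the gain of one edge, and
  this and adding \<open>x\<^sub>v\<close> cannot both raise a concave function.\<close>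

lemma meet_leaf:
  assumes P: "pow_concave E v K" and "k \<le> K"
    and "m + xv v \<in> pow_exps E' k" "m + xv w \<in> pow_exps E' k"
  shows "m \<in> pow_exps E' k"
  using assms(2-)
proof (induction k arbitrary: m)
  case (Suc k)
  show ?case
  proof (cases "lookup m v = 0")
    case True
    from drop_at_zero[OF this Suc.prems(3)] show ?thesis by (rule pow_exps_mono[rotated]) auto
  next
    case False
    then obtain n where n: "m = n + xv v" by (auto elim: exp_split)
    show ?thesis
    proof (cases "lookup n w = 0")
      case nw: False
      then obtain n' where n': "n = n' + xv w" by (auto elim: exp_split)
      have m: "m = n' + (xv v + xv w)" by (simp only: n n' add_ac)
      have "(n' + xv v) + (xv v + xv w) \<in> pow_exps E' (Suc k)"
        "(n' + xv w) + (xv v + xv w) \<in> pow_exps E' (Suc k)"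
        using Suc.prems(2,3) by (simp_all only: m add_ac)
      then have "n' \<in> pow_exps E' k" using Suc.IH Suc.prems(1) by (simp only: cancel_leaf')
      then show ?thesis by (simp only: m cancel_leaf')
    next
      case nw: True
      have "n + (xv v + xv w) \<in> pow_exps E' (Suc k)" using Suc.prems(3) by (simp only: n add_ac)
      then have "n \<in> pow_exps E' k" by (simp only: cancel_leaf')
      then have "n \<in> pow_exps E k" using without_leaf nw by blast
      moreover have "lookup (n + xv v + xv v) w = 0"
        using nw neq by (simp add: lookup_add lookup_single)
      then have "n + xv v + xv v \<in> pow_exps E (Suc k)" using Suc.prems(2) n without_leaf by blast
      ultimately have "m \<in> pow_exps E (Suc k)"
        using P Suc.prems(1) unfolding pow_concave_def n by auto
      then show ?thesis by (rule pow_exps_mono[rotated]) auto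
    qed
  qed
qed simp

end

section \<open>Monomial ideals and regular binomials\<close>

definition exps :: "'v set \<Rightarrow> ('v \<Rightarrow>\<^sub>0 nat) set" where
  "exps V = {m. keys m \<subseteq> V}"

definition supp_in :: "'m set \<Rightarrow> ('m \<Rightarrow>\<^sub>0 'k::zero) set" where
  "supp_in T = {p. keys p \<subseteq> T}"

lemma supp_in_iff: "p \<in> supp_in T \<longleftrightarrow> (\<forall>m. m \<notin> T \<longrightarrow> lookup p m = 0)"
  by (auto simp: supp_in_def in_keys_iff)

lemma keys_add_exp: "keys (m + n :: 'v \<Rightarrow>\<^sub>0 nat) = keys m \<union> keys n"
  by (auto simp: in_keys_iff lookup_add)

lemma exps_add_iff [simp]: "m + n \<in> exps V \<longleftrightarrow> m \<in> exps V \<and> n \<in> exps V"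
  by (auto simp: exps_def keys_add_exp)

lemma exps_zero [simp]: "0 \<in> exps V"
  by (simp add: exps_def)

lemma exps_single [simp]: "single v n \<in> exps V \<longleftrightarrow> n = 0 \<or> v \<in> V"
  by (simp add: exps_def)

lemma supp_in_zero [simp]: "0 \<in> supp_in T"
  by (simp add: supp_in_def)

lemma supp_in_add: "p \<in> supp_in T \<Longrightarrow> q \<in> supp_in T \<Longrightarrow> p + q \<in> supp_in T"
  by (auto simp: supp_in_iff lookup_add)

lemma supp_in_uminus [simp]: "- p \<in> supp_in T \<longleftrightarrow> p \<in> supp_in T"
  for p :: "'m \<Rightarrow>\<^sub>0 'k::ab_group_add"
  by (auto simp: supp_in_iff)

lemma supp_in_diff: "p \<in> supp_in T \<Longrightarrow> q \<in> supp_in T \<Longrightarrow> p - q \<in> supp_in T"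
  for p :: "'m \<Rightarrow>\<^sub>0 'k::ab_group_add"
  by (auto simp: supp_in_iff lookup_minus)

lemma supp_in_sum: "(\<And>i. i \<in> A \<Longrightarrow> f i \<in> supp_in T) \<Longrightarrow> sum f A \<in> supp_in T"
  by (induction A rule: infinite_finite_induct) (auto intro: supp_in_add)

lemma supp_in_single: "m \<in> T \<Longrightarrow> single m c \<in> supp_in T"
  by (auto simp: supp_in_def)

lemma supp_in_mult:
  assumes "p \<in> supp_in T" "q \<in> supp_in U" "\<And>a b. a \<in> T \<Longrightarrow> b \<in> U \<Longrightarrow> a + b \<in> W"
  shows "p * q \<in> supp_in W"
  using keys_mult[of p q] assms unfolding supp_in_def by blast

lemma supp_in_mono: "T \<subseteq> U \<Longrightarrow> p \<in> supp_in T \<Longrightarrow> p \<in> supp_in U"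
  by (auto simp: supp_in_def)

lemma supp_in_disjoint:
  fixes p :: "'m \<Rightarrow>\<^sub>0 'k::zero"
  assumes "p \<in> supp_in A" "p \<in> supp_in (- A)"
  shows "p = 0"
proof (rule poly_mapping_eqI)
  show "lookup p m = lookup 0 m" for m
    using assms unfolding supp_in_iff by (cases "m \<in> A") auto
qed

lemma sum_singles:
  fixes p :: "'m \<Rightarrow>\<^sub>0 'k::comm_monoid_add"
  assumes "finite A" "keys p \<subseteq> A"
  shows "(\<Sum>m\<in>A. single m (lookup p m)) = p"
proof (rule poly_mapping_eqI)
  fix k
  have "(\<Sum>m\<in>A. if k = m then lookup p m else 0) = (if k \<in> A then lookup p k else 0)"
    using assms(1) by simp
  then show "lookup (\<Sum>m\<in>A. single m (lookup p m)) k = lookup p k"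
    using assms(2) by (auto simp: lookup_sum lookup_single when_def in_keys_iff eq_commute[of _ k])
qed

lemma lookup_single_times:
  fixes p :: "'m::cancel_comm_monoid_add \<Rightarrow>\<^sub>0 'k::comm_semiring_1"
  shows "lookup (single a c * p) (a + m) = c * lookup p m"
  by (simp add: lookup_mult lookup_single when_mult)

lemma lookup_single_times_outside:
  fixes p :: "'m::cancel_comm_monoid_add \<Rightarrow>\<^sub>0 'k::comm_semiring_1"
  assumes "\<And>n. m \<noteq> a + n"
  shows "lookup (single a c * p) m = 0"
  using assms by (simp add: lookup_mult lookup_single when_mult)

lemma lookup_Var_times:
  "lookup (Var u * p) m = (if lookup m u = 0 then 0 else lookup p (m - xv u))"
proof (cases "lookup m u = 0")
  case True
  have "m \<noteq> xv u + n" for n using True by (auto simp: lookup_add)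
  then show ?thesis using True lookup_single_times_outside[of m "xv u" 1 p] by (simp add: Var_def)
next
  case False
  then obtain n where n: "m = n + xv u" by (auto elim: exp_split)
  then have "m = xv u + n" by (simp only: add.commute)
  then show ?thesis using False n lookup_single_times[of "xv u" 1 p n] by (simp add: Var_def)
qed

text \<open>The assumptions force \<open>T\<close> to meet each plane \<open>m + \<nat>u + \<nat>v\<close> in a quadrant: at an inner corner of a
  staircase the meet property would fail.\<close>

lemma meet_quadrant:
  assumes up: "\<And>m p. m \<in> T \<Longrightarrow> m + p \<in> T"
    and meet: "\<And>m. m + xv u \<in> T \<Longrightarrow> m + xv v \<in> T \<Longrightarrow> m \<in> T"
    and "m + single u p \<in> T" "m + single v q \<in> T"
  shows "m \<in> T"
proof -
  have 1: "m \<in> T" if "m + single u p \<in> T" "m + xv v \<in> T" for m p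
    using that
  proof (induction p)
    case (Suc p)
    let ?n = "m + single u p"
    have "?n + xv u \<in> T" using Suc.prems(1) by (simp add: add.assoc flip: single_add)
    moreover have "?n + xv v \<in> T" using up[OF Suc.prems(2), of "single u p"] by (simp only: add_ac)
    ultimately have "?n \<in> T" by (rule meet)
    then show ?case using Suc by blast
  qed simp
  show ?thesis using assms(3,4)
  proof (induction q arbitrary: m)
    case (Suc q)
    have "m + xv v + single u p \<in> T" using up[OF Suc.prems(1), of "xv v"] by (simp only: add_ac)
    moreover have "m + xv v + single v q \<in> T"
      using Suc.prems(2) by (simp add: add.assoc flip: single_add)
    ultimately have "m + xv v \<in> T" by (rule Suc.IH)
    then show ?case using 1 Suc.prems(1) by blast
  qed simp
qed

text \<open>If \<open>m \<notin> T\<close>, then by \<open>meet_quadrant\<close> one of the rays \<open>m + \<nat>u\<close> and \<open>m + \<nat>v\<close> avoids \<open>T\<close>, say the first one.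
  Then all the exponents \<open>m + (j + 1) u - j v\<close> avoid \<open>T\<close>, too, and the coefficients of \<open>(x\<^sub>u - x\<^sub>v) p\<close> at them
  vanish. So \<open>p\<close> has the same coefficient at all \<open>m + j u - j v\<close>, and this coefficient is 0 because \<open>j\<close> cannot
  exceed the exponent of \<open>v\<close>.\<close>

lemma binomial_regular:
  fixes p :: "'k::field mpoly"
  assumes up: "\<And>m p. m \<in> T \<Longrightarrow> m + p \<in> T"
    and meet: "\<And>m. m + xv u \<in> T \<Longrightarrow> m + xv v \<in> T \<Longrightarrow> m \<in> T"
    and "u \<noteq> v" and p: "(Var u - Var v) * p \<in> supp_in T"
  shows "p \<in> supp_in T"
proof -
  have A: "lookup p m = 0"
    if uv: "u \<noteq> v" and p: "(Var u - Var v) * p \<in> supp_in T" and m: "\<forall>q. m + single u q \<notin> T"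
    for m u v and p :: "'k::field mpoly"
    using m
  proof (induction "lookup m v" arbitrary: m rule: less_induct)
    case less
    have "m + xv u \<notin> T" using less.prems by blast
    then have "lookup ((Var u - Var v) * p) (m + xv u) = 0" using p by (auto simp: supp_in_iff)
    then have eq: "lookup p m =
        (if lookup m v = 0 then 0 else lookup p (m + xv u - xv v))"
      using uv by (simp add: left_diff_distrib lookup_minus lookup_Var_times lookup_add lookup_single split: if_splits)
    show ?case
    proof (cases "lookup m v = 0")
      case False
      then obtain n where n: "m = n + xv v" by (auto elim: exp_split)
      have "lookup (n + xv u) v < lookup m v" using uv n by (simp add: lookup_add lookup_single)
      moreover have "n + xv u + single u q \<notin> T" for q
      proof
        assume "n + xv u + single u q \<in> T"
        from up[OF this, of "xv v"] have "m + single u (Suc q) \<in> T"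
          by (simp add: n add_ac flip: single_add)
        then show False using less.prems by blast
      qed
      ultimately have "lookup p (n + xv u) = 0" using less.hyps by blast
      moreover have "m + xv u - xv v = n + xv u"
        by (rule poly_mapping_eqI) (simp add: n lookup_add lookup_minus)
      ultimately show ?thesis using eq by simp
    qed (use eq in simp)
  qed
  have "(Var v - Var u) * p \<in> supp_in T" using p by (metis minus_diff_eq minus_mult_left supp_in_uminus)
  show ?thesis unfolding supp_in_iff
  proof (intro allI impI)
    fix m assume "m \<notin> T"
    then have "(\<forall>q. m + single u q \<notin> T) \<or> (\<forall>q. m + single v q \<notin> T)"
      using meet_quadrant[OF up meet] by blast
    then show "lookup p m = 0"
      using A[OF \<open>u \<noteq> v\<close> p] A[OF \<open>u \<noteq> v\<close>[symmetric] \<open>(Var v - Var u) * p \<in> supp_in T\<close>] by blast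
  qed
qed

section \<open>Identifying two variables\<close>

text \<open>The \<open>K\<close>-linear extension of the map of monomials given by \<open>s\<close>.\<close>

definition push :: "('m \<Rightarrow> 'n) \<Rightarrow> ('m \<Rightarrow>\<^sub>0 'k) \<Rightarrow> ('n \<Rightarrow>\<^sub>0 'k::comm_monoid_add)" where
  "push s p = (\<Sum>m\<in>keys p. single (s m) (lookup p m))"

lemma push_superset:
  "finite A \<Longrightarrow> keys p \<subseteq> A \<Longrightarrow>
    push s p = (\<Sum>m\<in>A. single (s m) (lookup p m))"
  unfolding push_def by (rule sum.mono_neutral_left) (auto simp: in_keys_iff)

lemma push_zero [simp]: "push s 0 = 0"
  by (simp add: push_def)

lemma push_add: "push s (p + q) = push s p + push s q"
proof -
  let ?A = "keys p \<union> keys q"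
  have "push s (p + q) = (\<Sum>m\<in>?A. single (s m) (lookup (p + q) m))"
    by (rule push_superset) (auto simp: keys_add)
  also have "\<dots> = push s p + push s q"
    by (simp add: push_superset[of ?A p] push_superset[of ?A q] lookup_add single_add sum.distrib)
  finally show ?thesis .
qed

lemma push_sum: "push s (sum f A) = (\<Sum>i\<in>A. push s (f i))"
  by (induction A rule: infinite_finite_induct) (auto simp: push_add)

lemma push_single [simp]: "push s (single m c) = single (s m) c"
  by (cases "c = 0") (auto simp: push_def)

lemma push_uminus: "push s (- p) = - push s p" for p :: "'m \<Rightarrow>\<^sub>0 'k::ab_group_add"
  using push_add[of s p "- p"] by (simp add: eq_neg_iff_add_eq_0 add.commute)

lemma push_diff: "push s (p - q) = push s p - push s q" for p :: "'m \<Rightarrow>\<^sub>0 'k::ab_group_add"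
  using push_add[of s p "- q"] by (simp add: push_uminus)

lemma push_mult:
  fixes p :: "'m::comm_monoid_add \<Rightarrow>\<^sub>0 'k::comm_semiring_1" and s :: "'m \<Rightarrow> 'n::comm_monoid_add"
  assumes "\<And>m n. s (m + n) = s m + s n"
  shows "push s (p * q) = push s p * push s q"
proof -
  let ?p = "\<lambda>m. single m (lookup p m)"
  let ?q = "\<lambda>m. single m (lookup q m)"
  have "p * q = sum ?p (keys p) * sum ?q (keys q)"
    by (simp add: sum_singles)
  also have "\<dots> = (\<Sum>m\<in>keys p. \<Sum>n\<in>keys q. ?p m * ?q n)"
    by (simp add: sum_product)
  finally have "push s (p * q) = (\<Sum>m\<in>keys p. \<Sum>n\<in>keys q. push s (?p m * ?q n))"
    by (simp add: push_sum)
  also have "\<dots> = push s p * push s q"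
    by (simp only: mult_single push_single assms) (simp add: push_def sum_product mult_single)
  finally show ?thesis .
qed

lemma keys_push: "keys (push s p) \<subseteq> s ` keys p"
proof -
  have "push s p \<in> supp_in (s ` keys p)"
    unfolding push_def by (intro supp_in_sum supp_in_single) auto
  then show ?thesis by (simp add: supp_in_def)
qed

text \<open>The effect of the substitution \<open>x\<^sub>u \<mapsto> x\<^sub>v\<close> on exponents.\<close>

definition merge :: "'v \<Rightarrow> 'v \<Rightarrow> ('v \<Rightarrow>\<^sub>0 nat) \<Rightarrow> ('v \<Rightarrow>\<^sub>0 nat)" where
  "merge u v m = Poly_Mapping.update u 0 m + single v (lookup m u)"

lemma lookup_merge:
  "lookup (merge u v m) i =
    (if i = u then 0 else lookup m i) + (if i = v then lookup m u else 0)"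
  by (simp add: merge_def lookup_add lookup_update lookup_single when_def)

lemma merge_add: "merge u v (m + n) = merge u v m + merge u v n"
  by (rule poly_mapping_eqI) (simp add: lookup_merge lookup_add)

lemma merge_id: "lookup m u = 0 \<Longrightarrow> merge u v m = m"
  by (rule poly_mapping_eqI) (simp add: lookup_merge)

lemma merge_xv: "merge u v (single u n) = single v n"
  by (rule poly_mapping_eqI) (simp add: lookup_merge lookup_single when_def)

lemma pow_exps_merge: "m \<in> pow_exps E k \<Longrightarrow> merge u v m \<in> pow_exps (merge u v ` E) k"
proof (induction k arbitrary: m)
  case (Suc k)
  then obtain e n where "m = e + n" "e \<in> E" "n \<in> pow_exps E k" by auto
  then show ?case using Suc.IH[of n] pow_exps_SucI[of "merge u v e" "merge u v ` E" "merge u v n" k]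
    by (simp add: merge_add del: pow_exps.simps)
qed simp

lemma pow_exps_merge_preimage:
  assumes "u \<noteq> v" "E \<subseteq> exps V" "m \<in> pow_exps (merge u v ` E) k" "lookup m u = 0" "m \<in> exps V"
  shows "\<exists>n\<in>pow_exps E k \<inter> exps V. merge u v n = m"
  using assms(3-)
proof (induction k arbitrary: m)
  case 0
  then show ?case by (intro bexI[of _ m]) (auto simp: merge_id)
next
  case (Suc k)
  then obtain e m' where e: "m = merge u v e + m'" "e \<in> E" "m' \<in> pow_exps (merge u v ` E) k" by auto
  have "lookup m' u = 0" "m' \<in> exps V" using Suc.prems e(1) by (auto simp: lookup_add)
  from Suc.IH[OF e(3) this] obtain n where "n \<in> pow_exps E k" "n \<in> exps V" "merge u v n = m'" by auto
  then show ?case using e assms(2) by (intro bexI[of _ "e + n"]) (auto simp: merge_add)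
qed

text \<open>Replacing the factors \<open>x\<^sub>u\<close> of a monomial by \<open>x\<^sub>v\<close> one at a time changes it by a multiple of \<open>x\<^sub>u - x\<^sub>v\<close>.\<close>

lemma push_merge_congruent:
  fixes p :: "'k::field mpoly"
  assumes "u \<in> V" "v \<in> V" "u \<noteq> v" "p \<in> supp_in (exps V)"
  shows "\<exists>q\<in>supp_in (exps V). p = push (merge u v) p + (Var u - Var v) * q"
proof -
  have 1: "\<exists>q\<in>supp_in (exps V). single m c = single (merge u v m) c + (Var u - Var v) * q"
    if "m \<in> exps V" for m and c :: 'k using that
  proof (induction "lookup m u" arbitrary: m)
    case 0
    then show ?case by (intro bexI[of _ 0]) (auto simp: merge_id)
  next
    case (Suc j)
    then obtain n where n: "m = n + xv u" by (metis exp_split zero_less_Suc)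
    have "j = lookup (n + xv v) u" "n + xv v \<in> exps V"
      using Suc assms by (auto simp: n lookup_add lookup_single)
    from Suc.hyps(1)[OF this] obtain q where q: "q \<in> supp_in (exps V)"
       "single (n + xv v) c = single (merge u v (n + xv v)) c + (Var u - Var v) * q" by blast
    have "merge u v (n + xv v) = merge u v m" using assms by (simp add: n merge_add merge_xv merge_id lookup_single)
    moreover have eq: "single m c = single (n + xv v) c + (Var u - Var v) * single n c"
      by (simp add: n Var_def left_diff_distrib mult_single add.commute)
    ultimately have "single m c = single (merge u v m) c + (Var u - Var v) * (q + single n c)"
      by (subst eq, subst q(2)) (simp add: distrib_left add.assoc)
    moreover have "q + single n c \<in> supp_in (exps V)"
      using q(1) Suc.prems n by (intro supp_in_add supp_in_single) auto
    ultimately show ?case by blast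
  qed
  have "\<forall>m\<in>keys p. \<exists>q\<in>supp_in (exps V). single m (lookup p m)
      = single (merge u v m) (lookup p m) + (Var u - Var v) * q"
    using 1 assms(4) unfolding supp_in_def by blast
  then obtain q where q: "\<forall>m\<in>keys p. q m \<in> supp_in (exps V) \<and> single m (lookup p m)
      = single (merge u v m) (lookup p m) + (Var u - Var v) * q m"
    by metis
  have "p = (\<Sum>m\<in>keys p. single m (lookup p m))" by (simp add: sum_singles)
  also have "\<dots> = (\<Sum>m\<in>keys p. single (merge u v m) (lookup p m) + (Var u - Var v) * q m)"
    using q by (intro sum.cong) auto
  also have "\<dots> = push (merge u v) p + (Var u - Var v) * (\<Sum>m\<in>keys p. q m)"
    by (simp add: sum.distrib push_def sum_distrib_left)
  finally show ?thesis using q by (intro bexI[of _ "\<Sum>m\<in>keys p. q m"]) (auto intro: supp_in_sum)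
qed

text \<open>The substitution \<open>x\<^sub>u \<mapsto> x\<^sub>v\<close> identifies \<open>S/(x\<^sub>u - x\<^sub>v)\<close> with the polynomial ring in the variables other than
  \<open>x\<^sub>u\<close>, and it carries powers of a monomial ideal to powers of the ideal with merged generators. So
  whether \<open>g\<close> is regular modulo \<open>I\<^sup>k\<close> and \<open>x\<^sub>u - x\<^sub>v\<close> can be read off from the merged ideal.\<close>

lemma binomial_regular_after_merge:
  fixes g p q :: "'k::field mpoly" and u v :: nat
  defines "f \<equiv> Var u - Var v"
  assumes uv: "u \<in> V" "v \<in> V" "u \<noteq> v" and E: "E \<subseteq> exps V"
    and g: "push (merge u v) g = g"
    and reg: "\<And>p. g * p \<in> supp_in (pow_exps (merge u v ` E) k) \<Longrightarrow> p \<in> supp_in (pow_exps (merge u v ` E) k)"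
    and pq: "p \<in> supp_in (exps V)" "g * p - f * q \<in> supp_in (exps V \<inter> pow_exps E k)"
  shows "\<exists>z\<in>supp_in (exps V). p - f * z \<in> supp_in (exps V \<inter> pow_exps E k)"
proof -
  let ?s = "push (merge u v) :: 'k mpoly \<Rightarrow> 'k mpoly" and ?T = "pow_exps (merge u v ` E) k"
  have mult: "?s (a * b) = ?s a * ?s b" for a b by (rule push_mult) (rule merge_add)
  have f0: "?s f = 0" using uv(3) by (simp add: f_def push_diff Var_def merge_xv merge_id lookup_single)
  have "?s (g * p - f * q) \<in> supp_in ?T"
    using pq(2) keys_push[of "merge u v" "g * p - f * q"] pow_exps_merge unfolding supp_in_def by fastforce
  then have "g * ?s p \<in> supp_in ?T" by (simp add: push_diff mult f0 g)
  then have T: "?s p \<in> supp_in ?T" by (rule reg)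
  have "\<exists>n\<in>pow_exps E k \<inter> exps V. merge u v n = m" if m: "m \<in> keys (?s p)" for m
  proof (rule pow_exps_merge_preimage[OF uv(3) E])
    show "m \<in> ?T" using T m by (auto simp: supp_in_def)
    obtain n where n: "n \<in> keys p" "m = merge u v n" using m keys_push[of "merge u v" p] by blast
    show "lookup m u = 0" using uv(3) n by (simp add: lookup_merge)
    have "n \<in> exps V" using n pq(1) by (auto simp: supp_in_def)
    then show "m \<in> exps V" using uv unfolding n(2) exps_def
      by (auto simp: in_keys_iff lookup_merge subset_iff split: if_splits)
  qed
  then obtain t where t: "\<And>m. m \<in> keys (?s p) \<Longrightarrow> t m \<in> pow_exps E k \<inter> exps V \<and> merge u v (t m) = m"
    by metis
  define i where "i = (\<Sum>m\<in>keys (?s p). single (t m) (lookup (?s p) m))"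
  have i: "i \<in> supp_in (exps V \<inter> pow_exps E k)" unfolding i_def
    by (intro supp_in_sum supp_in_single) (use t in auto)
  then have iV: "i \<in> supp_in (exps V)" by (rule supp_in_mono[rotated]) auto
  have "?s i = (\<Sum>m\<in>keys (?s p). single m (lookup (?s p) m))"
    unfolding i_def push_sum by (intro sum.cong) (use t in auto)
  then have si: "?s i = ?s p" by (simp add: sum_singles)
  obtain q1 where q1: "q1 \<in> supp_in (exps V)" "p = ?s p + f * q1"
    using push_merge_congruent[OF uv pq(1)] unfolding f_def by blast
  obtain q2 where q2: "q2 \<in> supp_in (exps V)" "i = ?s i + f * q2"
    using push_merge_congruent[OF uv iV] unfolding f_def by blast
  have "p - f * (q1 - q2) = i" using q1(2) q2(2) si by (simp add: algebra_simps)
  then show ?thesis using i q1(1) q2(1) supp_in_diff by metis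
qed

section \<open>Depth of a residue class ring in terms of representatives\<close>

lemma (in ideal) a_rcos_eq_iff:
  assumes "a \<in> carrier R" "b \<in> carrier R"
  shows "I +> a = I +> b \<longleftrightarrow> a \<ominus> b \<in> I"
proof
  assume "I +> a = I +> b"
  then have "a \<in> I +> b" using a_rcos_self[OF assms(1)] by simp
  then show "a \<ominus> b \<in> I" using a_rcos_module_minus[OF ring_axioms assms(2,1)] by simp
next
  assume "a \<ominus> b \<in> I"
  then have "a \<in> I +> b" using a_rcos_module_minus[OF ring_axioms assms(2,1)] by simp
  then show "I +> a = I +> b" using a_repr_independence'[of a b] assms by simp
qed

lemma quot_module_simps:
  "carrier (quot_module R J) = carrier (R Quot J)"
  "add (quot_module R J) = add (R Quot J)"
  "zero (quot_module R J) = zero (R Quot J)"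
  "r \<odot>\<^bsub>quot_module R J\<^esub> c = (J +>\<^bsub>R\<^esub> r) \<otimes>\<^bsub>R Quot J\<^esub> c"
  by (simp_all add: quot_module_def ring.extend_def module.fields_def)

text \<open>The \<open>R\<close>-module \<open>R/J\<close> and the ring \<open>R/J\<close> are different records, hence so are their additive monoids.
  The sums agree because they depend on carrier, addition and zero only.\<close>

lemma finsum_quot_module: "finsum (quot_module R J) = finsum (R Quot J)"
  by (intro ext) (simp add: finsum_def finprod_def quot_module_simps)

lemma (in ideal) carrier_quot_iff: "c \<in> carrier (R Quot I) \<longleftrightarrow> (\<exists>x\<in>carrier R. c = I +> x)"
  by (auto simp: FactRing_simps)

text \<open>The projection \<open>R \<rightarrow> R/I\<close> commutes with sums and products, so the submodule consists of the cosets of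
  the elements of the ideal \<open>(f\<^sub>0, \<dots>, f\<^sub>i\<^sub>-\<^sub>1)\<close>.\<close>

lemma (in ideal) seq_submodule_quot:
  assumes "cring R" "set fs \<subseteq> carrier R" "i \<le> length fs"
  shows "seq_submodule (quot_module R I) fs i =
    (\<lambda>y. I +> (\<Oplus>j\<in>{..<i}. fs ! j \<otimes> y j)) ` ({..<i} \<rightarrow> carrier R)"
proof -
  interpret h: ring_hom_cring R "R Quot I" "(+>) I" by (rule rcos_ring_hom_cring[OF assms(1)])
  have fs: "fs ! j \<in> carrier R" if "j < i" for j using that assms by (auto simp: subset_iff)
  have eq: "(\<Oplus>\<^bsub>R Quot I\<^esub>j\<in>{..<i}. (I +> fs ! j) \<otimes>\<^bsub>R Quot I\<^esub> x j) = I +> (\<Oplus>j\<in>{..<i}. fs ! j \<otimes> y j)"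
    if y: "y \<in> {..<i} \<rightarrow> carrier R" "\<And>j. j < i \<Longrightarrow> x j = I +> y j" for x y
  proof -
    have "(\<lambda>j. fs ! j \<otimes> y j) \<in> {..<i} \<rightarrow> carrier R" using y fs by (auto simp: Pi_def)
    then have "I +> (\<Oplus>j\<in>{..<i}. fs ! j \<otimes> y j) = (\<Oplus>\<^bsub>R Quot I\<^esub>j\<in>{..<i}. I +> (fs ! j \<otimes> y j))"
      by (simp add: comp_def)
    also have "\<dots> = (\<Oplus>\<^bsub>R Quot I\<^esub>j\<in>{..<i}. (I +> fs ! j) \<otimes>\<^bsub>R Quot I\<^esub> x j)"
      by (rule h.S.finsum_cong') (use y fs in \<open>auto simp: Pi_def\<close>)
    finally show ?thesis by simp
  qed
  show ?thesis unfolding seq_submodule_def finsum_quot_module quot_module_simps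
  proof (intro equalityI subsetI; elim imageE)
    fix c x assume c: "c = (\<Oplus>\<^bsub>R Quot I\<^esub>j\<in>{..<i}. (I +> fs ! j) \<otimes>\<^bsub>R Quot I\<^esub> x j)"
      and x: "x \<in> {..<i} \<rightarrow> carrier (R Quot I)"
    have "\<forall>j\<in>{..<i}. \<exists>y\<in>carrier R. x j = I +> y" using x by (auto simp: carrier_quot_iff)
    then obtain y where "\<forall>j\<in>{..<i}. y j \<in> carrier R \<and> x j = I +> y j" by metis
    then show "c \<in> (\<lambda>y. I +> (\<Oplus>j\<in>{..<i}. fs ! j \<otimes> y j)) ` ({..<i} \<rightarrow> carrier R)"
      unfolding c by (intro image_eqI[of _ _ y] eq) auto
  next
    fix c y assume c: "c = I +> (\<Oplus>j\<in>{..<i}. fs ! j \<otimes> y j)" and y: "y \<in> {..<i} \<rightarrow> carrier R"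
    have "(\<Oplus>\<^bsub>R Quot I\<^esub>j\<in>{..<i}. (I +> fs ! j) \<otimes>\<^bsub>R Quot I\<^esub> (I +> y j)) = c"
      unfolding c by (rule eq[OF y]) simp
    then show "c \<in> (\<lambda>x. \<Oplus>\<^bsub>R Quot I\<^esub>j\<in>{..<i}. (I +> fs ! j) \<otimes>\<^bsub>R Quot I\<^esub> x j) ` ({..<i} \<rightarrow> carrier (R Quot I))"
      using y by (intro image_eqI[of _ _ "\<lambda>j. I +> y j"]) auto
  qed
qed

lemma (in ideal) mem_seq_submodule_0:
  assumes "cring R" "set fs \<subseteq> carrier R" "x \<in> carrier R"
  shows "I +> x \<in> seq_submodule (quot_module R I) fs 0 \<longleftrightarrow> x \<in> I"
  using assms a_rcos_eq_iff[of x \<zero>] by (simp add: seq_submodule_quot minus_eq)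

lemma (in ideal) mem_seq_submodule_1:
  assumes "cring R" "set fs \<subseteq> carrier R" "fs \<noteq> []" "x \<in> carrier R"
  shows "I +> x \<in> seq_submodule (quot_module R I) fs 1 \<longleftrightarrow> (\<exists>z\<in>carrier R. x \<ominus> fs ! 0 \<otimes> z \<in> I)"
proof -
  have f: "fs ! 0 \<in> carrier R" using assms(2,3) by (cases fs) auto
  have "{..<Suc 0} = {0::nat}" by auto
  then have "I +> x \<in> seq_submodule (quot_module R I) fs 1 \<longleftrightarrow>
      (\<exists>y\<in>{0::nat} \<rightarrow> carrier R. I +> x = I +> (fs ! 0 \<otimes> y 0))"
    using assms f by (auto simp: seq_submodule_quot Suc_le_eq image_iff)
  also have "\<dots> \<longleftrightarrow> (\<exists>z\<in>carrier R. I +> x = I +> (fs ! 0 \<otimes> z))"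
    by (auto intro!: bexI[of _ "\<lambda>_. z" for z])
  also have "\<dots> \<longleftrightarrow> (\<exists>z\<in>carrier R. x \<ominus> fs ! 0 \<otimes> z \<in> I)"
    using assms f by (intro bex_cong refl a_rcos_eq_iff) auto
  finally show ?thesis .
qed

text \<open>All elements of \<open>I + (fs)\<close> lie in the proper ideal \<open>M\<close>.\<close>

lemma (in ideal) seq_submodule_proper:
  assumes "cring R" "ideal M R" "I \<subseteq> M" "\<one> \<notin> M" "set fs \<subseteq> M"
  shows "seq_submodule (quot_module R I) fs (length fs) \<noteq> carrier (quot_module R I)"
proof
  interpret M: ideal M R by fact
  assume eq: "seq_submodule (quot_module R I) fs (length fs) = carrier (quot_module R I)"
  have fsR: "set fs \<subseteq> carrier R" using assms(5) M.a_subset by blast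
  have "I +> \<one> \<in> carrier (quot_module R I)" by (auto simp: quot_module_simps carrier_quot_iff)
  then obtain y where y: "y \<in> {..<length fs} \<rightarrow> carrier R" "I +> \<one> = I +> (\<Oplus>j\<in>{..<length fs}. fs ! j \<otimes> y j)"
    unfolding eq[symmetric] seq_submodule_quot[OF assms(1) fsR order_refl] by auto
  have M: "(\<Oplus>j\<in>A. fs ! j \<otimes> y j) \<in> M" if "finite A" "A \<subseteq> {..<length fs}" for A
    using that
  proof (induction A rule: finite_induct)
    case (insert j A)
    have 1: "fs ! j \<otimes> y j \<in> M" if "j \<in> {..<length fs}" for j using assms(5) y(1) that
      by (intro M.I_r_closed) auto
    then have "(\<lambda>j. fs ! j \<otimes> y j) \<in> A \<rightarrow> carrier R" "fs ! j \<otimes> y j \<in> carrier R"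
      using insert M.a_subset by (auto simp: Pi_def subset_iff)
    then have "(\<Oplus>j\<in>insert j A. fs ! j \<otimes> y j) = fs ! j \<otimes> y j \<oplus> (\<Oplus>j\<in>A. fs ! j \<otimes> y j)"
      using insert by (intro finsum_insert) auto
    then show ?case using 1 insert by (auto intro: M.a_closed)
  qed simp
  let ?s = "\<Oplus>j\<in>{..<length fs}. fs ! j \<otimes> y j"
  have s: "?s \<in> M" using M[of "{..<length fs}"] by simp
  then have sR: "?s \<in> carrier R" using M.a_subset by blast
  then have "\<one> \<ominus> ?s \<in> M" using y(2) a_rcos_eq_iff[of \<one> ?s] assms(3) by auto
  then have "(\<one> \<ominus> ?s) \<oplus> ?s \<in> M" using s M.a_closed by blast
  moreover have "(\<one> \<ominus> ?s) \<oplus> ?s = \<one>" using sR by (simp add: minus_eq a_assoc l_neg)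
  ultimately show False using assms(4) by simp
qed

lemma (in ideal) depth_ge_1:
  assumes "cring R" "ideal M R" "I \<subseteq> M" "\<one> \<notin> M"
    and f: "f \<in> M" "\<And>x. x \<in> carrier R \<Longrightarrow> f \<otimes> x \<in> I \<Longrightarrow> x \<in> I"
  shows "1 \<le> depth R M (quot_module R I)"
proof -
  interpret M: ideal M R by fact
  interpret Q: cring "R Quot I" by (rule quotient_is_cring) fact
  have fR: "set [f] \<subseteq> carrier R" using f(1) M.a_subset by auto
  have "regular_sequence R (quot_module R I) [f]"
    unfolding regular_sequence_def
  proof (intro conjI allI ballI impI fR)
    fix i c assume i: "i < length [f]" and c: "c \<in> carrier (quot_module R I)"
      and *: "[f] ! i \<odot>\<^bsub>quot_module R I\<^esub> c \<in> seq_submodule (quot_module R I) [f] i"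
    obtain x where x: "x \<in> carrier R" "c = I +> x" using c by (auto simp: quot_module_simps carrier_quot_iff)
    have "[f] ! i \<odot>\<^bsub>quot_module R I\<^esub> c = I +> (f \<otimes> x)"
      using i x fR by (simp add: quot_module_simps ring_hom_mult[OF rcos_ring_hom])
    then have "f \<otimes> x \<in> I" using * i x fR mem_seq_submodule_0[OF assms(1) fR, of "f \<otimes> x"] by simp
    then have "x \<in> I" using f x by blast
    then show "c \<in> seq_submodule (quot_module R I) [f] i"
      using i x mem_seq_submodule_0[OF assms(1) fR] by simp
  next
    show "seq_submodule (quot_module R I) [f] (length [f]) \<noteq> carrier (quot_module R I)"
      by (rule seq_submodule_proper[OF assms(1-4)]) (use f(1) in auto)
  qed
  then have "enat (length [f]) \<le> depth R M (quot_module R I)"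
    unfolding depth_def using f(1) by (intro Sup_upper CollectI exI[of _ "[f]"]) auto
  then show ?thesis by (simp add: one_enat_def)
qed

text \<open>In terms of representatives, \<open>f\<close> is regular on \<open>R/I\<close> and \<open>g\<close> on \<open>R/(I + (f))\<close>.\<close>

lemma (in ideal) depth_ge_2:
  assumes "cring R" "ideal M R" "I \<subseteq> M" "\<one> \<notin> M"
    and f: "f \<in> M" "\<And>x. x \<in> carrier R \<Longrightarrow> f \<otimes> x \<in> I \<Longrightarrow> x \<in> I"
    and g: "g \<in> M" "\<And>x y. x \<in> carrier R \<Longrightarrow> y \<in> carrier R \<Longrightarrow> g \<otimes> x \<ominus> f \<otimes> y \<in> I \<Longrightarrow>
      \<exists>z\<in>carrier R. x \<ominus> f \<otimes> z \<in> I"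
  shows "2 \<le> depth R M (quot_module R I)"
proof -
  interpret M: ideal M R by fact
  interpret Q: cring "R Quot I" by (rule quotient_is_cring) fact
  have fR: "set [f, g] \<subseteq> carrier R" using f(1) g(1) M.a_subset by auto
  have "regular_sequence R (quot_module R I) [f, g]"
    unfolding regular_sequence_def
  proof (intro conjI allI ballI impI fR)
    fix i c assume i: "i < length [f, g]" and c: "c \<in> carrier (quot_module R I)"
      and *: "[f, g] ! i \<odot>\<^bsub>quot_module R I\<^esub> c \<in> seq_submodule (quot_module R I) [f, g] i"
    obtain x where x: "x \<in> carrier R" "c = I +> x" using c by (auto simp: quot_module_simps carrier_quot_iff)
    have "[f, g] ! i \<in> carrier R" using i fR nth_mem[OF i] by blast
    then have eq: "[f, g] ! i \<odot>\<^bsub>quot_module R I\<^esub> c = I +> ([f, g] ! i \<otimes> x)"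
      using x by (simp add: quot_module_simps ring_hom_mult[OF rcos_ring_hom])
    have "i = 0 \<or> i = 1" using i by auto
    then show "c \<in> seq_submodule (quot_module R I) [f, g] i"
    proof
      assume i: "i = 0"
      then have "f \<otimes> x \<in> I" using * eq x fR mem_seq_submodule_0[OF assms(1) fR, of "f \<otimes> x"] by simp
      then have "x \<in> I" using f x by blast
      then show ?thesis using i x mem_seq_submodule_0[OF assms(1) fR] by simp
    next
      assume i: "i = 1"
      then have "I +> (g \<otimes> x) \<in> seq_submodule (quot_module R I) [f, g] 1" using * eq by simp
      then have "\<exists>z\<in>carrier R. g \<otimes> x \<ominus> f \<otimes> z \<in> I"
        using x fR mem_seq_submodule_1[OF assms(1) fR, of "g \<otimes> x"] by simp
      then have "\<exists>z\<in>carrier R. x \<ominus> f \<otimes> z \<in> I" using g(2) x(1) by blast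
      then show ?thesis using i x fR mem_seq_submodule_1[OF assms(1) fR, of x] by simp
    qed
  next
    show "seq_submodule (quot_module R I) [f, g] (length [f, g]) \<noteq> carrier (quot_module R I)"
      by (rule seq_submodule_proper[OF assms(1-4)]) (use f(1) g(1) in auto)
  qed
  then have "enat (length [f, g]) \<le> depth R M (quot_module R I)"
    unfolding depth_def using f(1) g(1) by (intro Sup_upper CollectI exI[of _ "[f, g]"]) auto
  then show ?thesis by (simp add: numeral_eq_enat numeral_2_eq_2)
qed

lemma (in ideal) depth_le_1:
  assumes "cring R" "M \<subseteq> carrier R"
    and no: "\<And>f g. f \<in> M \<Longrightarrow> g \<in> M \<Longrightarrow> (\<And>x. x \<in> carrier R \<Longrightarrow> f \<otimes> x \<in> I \<Longrightarrow> x \<in> I) \<Longrightarrow>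
      (\<And>x y. x \<in> carrier R \<Longrightarrow> y \<in> carrier R \<Longrightarrow> g \<otimes> x \<ominus> f \<otimes> y \<in> I \<Longrightarrow> \<exists>z\<in>carrier R. x \<ominus> f \<otimes> z \<in> I) \<Longrightarrow> False"
  shows "depth R M (quot_module R I) \<le> 1"
  unfolding depth_def
proof (intro Sup_least, elim CollectE exE conjE)
  fix n fs assume n: "n = enat (length fs)" and fs: "set fs \<subseteq> M" and reg: "regular_sequence R (quot_module R I) fs"
  interpret Q: cring "R Quot I" by (rule quotient_is_cring) fact
  have fR: "set fs \<subseteq> carrier R" using fs assms(2) by blast
  have "length fs \<le> 1"
  proof (rule ccontr)
    assume len: "\<not> length fs \<le> 1"
    have ne: "fs \<noteq> []" and len2: "1 < length fs" using len by auto
    have mem: "fs ! 0 \<in> set fs" "fs ! 1 \<in> set fs" using ne nth_mem[OF len2] by (cases fs; simp)+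
    have regular: "I +> x \<in> seq_submodule (quot_module R I) fs i"
      if "i < length fs" "x \<in> carrier R" "I +> (fs ! i \<otimes> x) \<in> seq_submodule (quot_module R I) fs i" for i x
    proof -
      have "fs ! i \<in> carrier R" using that fR nth_mem by blast
      then have "fs ! i \<odot>\<^bsub>quot_module R I\<^esub> (I +> x) = I +> (fs ! i \<otimes> x)"
        using that by (simp add: quot_module_simps ring_hom_mult[OF rcos_ring_hom])
      moreover have "I +> x \<in> carrier (quot_module R I)" using that by (auto simp: quot_module_simps carrier_quot_iff)
      ultimately show ?thesis using reg that unfolding regular_sequence_def by auto
    qed
    show False
    proof (rule no)
      show "fs ! 0 \<in> M" "fs ! 1 \<in> M" using mem fs by auto
      show "x \<in> I" if "x \<in> carrier R" "fs ! 0 \<otimes> x \<in> I" for x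
      proof -
        have "fs ! 0 \<otimes> x \<in> carrier R" using mem fR that by auto
        then have "I +> (fs ! 0 \<otimes> x) \<in> seq_submodule (quot_module R I) fs 0"
          using mem_seq_submodule_0[OF assms(1) fR, of "fs ! 0 \<otimes> x"] that by blast
        then have "I +> x \<in> seq_submodule (quot_module R I) fs 0" using regular[of 0 x] that ne by simp
        then show ?thesis using mem_seq_submodule_0[OF assms(1) fR, of x] that by blast
      qed
      show "\<exists>z\<in>carrier R. x \<ominus> fs ! 0 \<otimes> z \<in> I"
        if "x \<in> carrier R" "y \<in> carrier R" "fs ! 1 \<otimes> x \<ominus> fs ! 0 \<otimes> y \<in> I" for x y
      proof -
        have "fs ! 1 \<otimes> x \<in> carrier R" using mem fR that by auto
        then have "I +> (fs ! 1 \<otimes> x) \<in> seq_submodule (quot_module R I) fs 1"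
          using mem_seq_submodule_1[OF assms(1) fR ne, of "fs ! 1 \<otimes> x"] that by blast
        then have "I +> x \<in> seq_submodule (quot_module R I) fs 1" using regular[of 1 x] that len2 by simp
        then show ?thesis using mem_seq_submodule_1[OF assms(1) fR ne, of x] that by blast
      qed
    qed
  qed
  then show "n \<le> 1" by (simp add: n one_enat_def)
qed

section \<open>Monomial ideals of the polynomial ring\<close>

text \<open>The span of the monomials with exponents in \<open>T\<close>. With \<open>T\<close> a submonoid this covers both the polynomial
  rings and the subalgebras generated by monomials.\<close>

definition mono_ring :: "'m::comm_monoid_add set \<Rightarrow> ('m \<Rightarrow>\<^sub>0 'k::field) ring" where
  "mono_ring T = ring_of_type_algebra\<lparr>carrier := supp_in T\<rparr>"

lemma mpoly_ring_eq: "mpoly_ring V = mono_ring (exps V)"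
  unfolding mpoly_ring_def mono_ring_def supp_in_def exps_def by (auto intro!: arg_cong2[where f = carrier_update])

lemma mono_ring_simps [simp]:
  "carrier (mono_ring T) = supp_in T" "x \<otimes>\<^bsub>mono_ring T\<^esub> y = x * y" "x \<oplus>\<^bsub>mono_ring T\<^esub> y = x + y"
  "\<one>\<^bsub>mono_ring T\<^esub> = 1" "\<zero>\<^bsub>mono_ring T\<^esub> = 0"
  by (simp_all add: mono_ring_def ring_of_type_algebra_def)

locale exp_monoid =
  fixes T :: "'m::comm_monoid_add set"
  assumes zero_mem: "0 \<in> T" and add_mem: "a \<in> T \<Longrightarrow> b \<in> T \<Longrightarrow> a + b \<in> T"
begin

lemma one_mem: "(1 :: 'm \<Rightarrow>\<^sub>0 'k::zero_neq_one) \<in> supp_in T"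
  using zero_mem by (auto simp: supp_in_def)

lemma mult_mem: "p \<in> supp_in T \<Longrightarrow> q \<in> supp_in T \<Longrightarrow> p * q \<in> supp_in T"
  by (rule supp_in_mult[OF _ _ add_mem])

lemma cring_mono_ring: "cring (mono_ring T :: ('m \<Rightarrow>\<^sub>0 'k::field) ring)"
proof (rule cringI)
  show "abelian_group (mono_ring T :: ('m \<Rightarrow>\<^sub>0 'k::field) ring)"
  proof (rule abelian_groupI)
    fix x :: "'m \<Rightarrow>\<^sub>0 'k" assume "x \<in> carrier (mono_ring T)"
    then show "\<exists>y\<in>carrier (mono_ring T). y \<oplus>\<^bsub>mono_ring T\<^esub> x = \<zero>\<^bsub>mono_ring T\<^esub>"
      by (intro bexI[of _ "- x"]) auto
  qed (auto intro: supp_in_add simp: add_ac)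
  show "Group.comm_monoid (mono_ring T :: ('m \<Rightarrow>\<^sub>0 'k::field) ring)"
    by (rule comm_monoidI) (auto intro: mult_mem one_mem simp: mult_ac)
qed (auto simp: algebra_simps)

lemma a_minus_mono_ring:
  fixes x y :: "'m \<Rightarrow>\<^sub>0 'k::field"
  assumes "x \<in> supp_in T" "y \<in> supp_in T"
  shows "x \<ominus>\<^bsub>mono_ring T\<^esub> y = x - y"
proof -
  interpret cring "mono_ring T :: ('m \<Rightarrow>\<^sub>0 'k) ring" by (rule cring_mono_ring)
  have "\<ominus>\<^bsub>mono_ring T\<^esub> y = - y" by (rule minus_equality) (use assms in auto)
  then show ?thesis by (simp add: a_minus_def)
qed

lemma ideal_supp_in:
  assumes "S \<subseteq> T" "\<And>t s. t \<in> T \<Longrightarrow> s \<in> S \<Longrightarrow> t + s \<in> S"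
  shows "ideal (supp_in S) (mono_ring T :: ('m \<Rightarrow>\<^sub>0 'k::field) ring)"
proof -
  interpret cring "mono_ring T :: ('m \<Rightarrow>\<^sub>0 'k) ring" by (rule cring_mono_ring)
  show ?thesis
  proof (rule idealI)
    show "subgroup (supp_in S) (add_monoid (mono_ring T :: ('m \<Rightarrow>\<^sub>0 'k) ring))"
    proof (rule group.subgroupI[OF a_group])
      show "supp_in S \<subseteq> carrier (add_monoid (mono_ring T :: ('m \<Rightarrow>\<^sub>0 'k) ring))"
        using supp_in_mono[OF assms(1)] by auto
      show "supp_in S \<noteq> {}" using supp_in_zero by blast
      fix a :: "'m \<Rightarrow>\<^sub>0 'k" assume a: "a \<in> supp_in S"
      then have aT: "a \<in> supp_in T" by (rule supp_in_mono[OF assms(1)])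
      have "\<ominus>\<^bsub>mono_ring T\<^esub> a = - a" by (rule minus_equality) (use aT in auto)
      then show "inv\<^bsub>add_monoid (mono_ring T)\<^esub> a \<in> supp_in S" using a by (simp add: a_inv_def)
    qed (auto intro: supp_in_add)
    fix a x :: "'m \<Rightarrow>\<^sub>0 'k" assume *: "a \<in> supp_in S" "x \<in> carrier (mono_ring T)"
    have "x * a \<in> supp_in S" by (rule supp_in_mult[of x T a S]) (use * assms(2) in auto)
    then show "x \<otimes>\<^bsub>mono_ring T\<^esub> a \<in> supp_in S" "a \<otimes>\<^bsub>mono_ring T\<^esub> x \<in> supp_in S"
      by (simp_all add: mult.commute)
  qed (rule ring_axioms)
qed

end

lemma finsum_mono_ring:
  fixes f :: "'i \<Rightarrow> ('m::comm_monoid_add \<Rightarrow>\<^sub>0 'k::field)"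
  assumes "exp_monoid T" "f \<in> A \<rightarrow> supp_in T"
  shows "finsum (mono_ring T) f A = sum f A"
proof -
  interpret cring "mono_ring T :: ('m \<Rightarrow>\<^sub>0 'k) ring" by (rule exp_monoid.cring_mono_ring[OF assms(1)])
  show ?thesis using assms(2)
  proof (induction A rule: infinite_finite_induct)
    case (insert a A)
    then show ?case by (simp add: finsum_insert)
  qed simp_all
qed

lemma exp_monoid_exps: "exp_monoid (exps V)"
  by unfold_locales auto

lemma ideal_supp_exps:
  assumes "\<And>m p. m \<in> S \<Longrightarrow> m + p \<in> S"
  shows "ideal (supp_in (exps V \<inter> S)) (mpoly_ring V)"
proof -
  have "p + m \<in> S" if "m \<in> S" for m p using assms[OF that, of p] by (simp add: add.commute)
  then show ?thesis unfolding mpoly_ring_eq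
    by (intro exp_monoid.ideal_supp_in[OF exp_monoid_exps]) auto
qed

lemma mono_idealI:
  assumes "ideal I (mono_ring T)" "\<And>m c. m \<in> S \<Longrightarrow> single m c \<in> I" "p \<in> supp_in S"
  shows "p \<in> I"
proof -
  interpret ideal I "mono_ring T" by fact
  have "(\<Sum>m\<in>A. single m (lookup p m)) \<in> I" if "finite A" "A \<subseteq> S" for A
    using that
  proof (induction A rule: finite_induct)
    case empty
    show ?case using additive_subgroup.zero_closed[OF ideal.axioms(1)[OF assms(1)]] by simp
  next
    case (insert m A)
    then show ?case using additive_subgroup.a_closed[OF ideal.axioms(1)[OF assms(1)], of "single m (lookup p m)"] assms(2) by simp
  qed
  from this[of "keys p"] assms(3) show ?thesis by (simp add: supp_in_def sum_singles)
qed

lemma Idl_monomials: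
  assumes "E \<subseteq> exps V"
  shows "Idl\<^bsub>mpoly_ring V\<^esub> ((\<lambda>e. single e (1::'k::field)) ` E) = supp_in (exps V \<inter> pow_exps E 1)"
proof -
  interpret exp_monoid "exps V" by (rule exp_monoid_exps)
  interpret cring "mpoly_ring V :: 'k mpoly ring" unfolding mpoly_ring_eq by (rule cring_mono_ring)
  let ?G = "(\<lambda>e. single e (1::'k)) ` E"
  have G: "?G \<subseteq> carrier (mpoly_ring V)" using assms by (auto simp: mpoly_ring_eq intro!: supp_in_single)
  have GI: "?G \<subseteq> Idl\<^bsub>mpoly_ring V\<^esub> ?G" by (rule genideal_self[OF G])
  have I: "ideal (Idl\<^bsub>mpoly_ring V\<^esub> ?G) (mpoly_ring V)" by (rule genideal_ideal[OF G])
  show ?thesis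
  proof
    have "?G \<subseteq> supp_in (exps V \<inter> pow_exps E 1)"
    proof (intro image_subsetI supp_in_single IntI)
      fix e assume e: "e \<in> E"
      show "e \<in> exps V" using assms e by auto
      show "e \<in> pow_exps E 1" using pow_exps_SucI[OF e, of 0 0] by simp
    qed
    then show "Idl\<^bsub>mpoly_ring V\<^esub> ?G \<subseteq> supp_in (exps V \<inter> pow_exps E 1)"
      by (intro genideal_minimal ideal_supp_exps pow_exps_add)
    show "supp_in (exps V \<inter> pow_exps E 1) \<subseteq> Idl\<^bsub>mpoly_ring V\<^esub> ?G"
    proof
      fix p :: "'k mpoly" assume "p \<in> supp_in (exps V \<inter> pow_exps E 1)"
      then show "p \<in> Idl\<^bsub>mpoly_ring V\<^esub> ?G"
      proof (rule mono_idealI[OF I[unfolded mpoly_ring_eq], folded mpoly_ring_eq, rotated])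
        fix m and c :: 'k assume "m \<in> exps V \<inter> pow_exps E 1"
        then obtain e n where m: "m = e + n" "e \<in> E" "n \<in> exps V" by auto
        have "single n c * single e 1 \<in> Idl\<^bsub>mpoly_ring V\<^esub> ?G"
          using ideal.I_l_closed[OF I, of "single e 1" "single n c"] m GI
          by (auto simp: mpoly_ring_eq intro: supp_in_single)
        then show "single m c \<in> Idl\<^bsub>mpoly_ring V\<^esub> ?G"
          by (simp add: mult_single m(1) add.commute)
      qed
    qed
  qed
qed

lemma ideal_pow_monomials:
  assumes "E \<subseteq> exps V"
  shows "ideal_pow (mpoly_ring V) (supp_in (exps V \<inter> pow_exps E 1)) k =
    (supp_in (exps V \<inter> pow_exps E k) :: 'k::field mpoly set)"
proof (induction k)
  case 0
  show ?case by (simp add: nat_pow_def ideals_set_def mpoly_ring_eq)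
next
  case (Suc k)
  let ?R = "mpoly_ring V :: 'k mpoly ring"
  let ?J = "\<lambda>k. supp_in (exps V \<inter> pow_exps E k) :: 'k mpoly set"
  have "ideal_pow ?R (?J 1) (Suc k) = ideal_prod ?R (ideal_pow ?R (?J 1) k) (?J 1)"
    by (simp add: nat_pow_def ideals_set_def)
  also have "\<dots> = ideal_prod ?R (?J k) (?J 1)" by (simp only: Suc.IH)
  also have "\<dots> = ?J (Suc k)"
  proof
    have add: "a + b \<in> pow_exps E (Suc k)" if a: "a \<in> pow_exps E k" and b: "b \<in> pow_exps E 1" for a b
    proof -
      obtain e n where e: "b = e + n" "e \<in> E" using b by auto
      have "e + (a + n) \<in> pow_exps E (Suc k)" by (intro pow_exps_SucI e pow_exps_add a)
      then show ?thesis by (simp only: e add_ac)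
    qed
    show "ideal_prod ?R (?J k) (?J 1) \<subseteq> ?J (Suc k)"
    proof
      fix p assume "p \<in> ideal_prod ?R (?J k) (?J 1)"
      then show "p \<in> ?J (Suc k)"
      proof induction
        case (prod i j)
        have "i * j \<in> ?J (Suc k)" by (rule supp_in_mult[OF prod]) (use add in \<open>auto simp del: pow_exps.simps\<close>)
        then show ?case by (simp add: mpoly_ring_eq)
      qed (auto simp: mpoly_ring_eq intro: supp_in_add)
    qed
    show "?J (Suc k) \<subseteq> ideal_prod ?R (?J k) (?J 1)"
    proof
      fix p assume p: "p \<in> ?J (Suc k)"
      have single: "single m c \<in> ideal_prod ?R (?J k) (?J 1)" if mem: "m \<in> exps V \<inter> pow_exps E (Suc k)" for m c
      proof -
        obtain e n where m: "m = e + n" "e \<in> E" "n \<in> pow_exps E k" using mem by auto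
        have "single n c \<in> ?J k" "single e 1 \<in> ?J 1"
          using mem m pow_exps_SucI[OF m(2), of 0 0] by (auto intro!: supp_in_single simp del: pow_exps.simps simp: pow_exps.simps(1))
        then have "single n c \<otimes>\<^bsub>?R\<^esub> single e 1 \<in> ideal_prod ?R (?J k) (?J 1)"
          by (rule ideal_prod.prod)
        then show ?thesis by (simp add: m(1) mpoly_ring_eq mult_single add.commute)
      qed
      have "(\<Sum>m\<in>A. single m (lookup p m)) \<in> ideal_prod ?R (?J k) (?J 1)"
        if "finite A" "A \<subseteq> exps V \<inter> pow_exps E (Suc k)" for A
        using that
      proof (induction A rule: finite_induct)
        case empty
        have "(0 :: 'k mpoly) \<otimes>\<^bsub>?R\<^esub> 0 \<in> ideal_prod ?R (?J k) (?J 1)" by (rule ideal_prod.prod) auto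
        then show ?case by (simp add: mpoly_ring_eq)
      next
        case (insert m A)
        have "single m (lookup p m) \<oplus>\<^bsub>?R\<^esub> (\<Sum>m\<in>A. single m (lookup p m))
          \<in> ideal_prod ?R (?J k) (?J 1)"
          by (rule ideal_prod.sum) (use insert single in \<open>auto simp del: pow_exps.simps\<close>)
        then show ?case using insert by (simp add: mpoly_ring_eq)
      qed
      from this[of "keys p"] p show "p \<in> ideal_prod ?R (?J k) (?J 1)" by (simp add: supp_in_def sum_singles del: pow_exps.simps)
    qed
  qed
  finally show ?case .
qed

lemma graded_max_ideal_eq: "graded_max_ideal V = (supp_in (exps V - {0}) :: 'k::field mpoly set)"
proof -
  have "Var ` V = (\<lambda>e. single e (1::'k)) ` xv ` V" by (auto simp: Var_def)
  then have "graded_max_ideal V = (supp_in (exps V \<inter> pow_exps (xv ` V) 1) :: 'k mpoly set)"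
    unfolding graded_max_ideal_def by (simp only:) (rule Idl_monomials, auto)
  also have "exps V \<inter> pow_exps (xv ` V) 1 = exps V - {0}"
  proof (intro equalityI subsetI)
    fix m assume "m \<in> exps V \<inter> pow_exps (xv ` V) 1"
    then obtain v n where m: "m \<in> exps V" "m = xv v + n" by auto
    then have "lookup m v \<noteq> 0" by (simp add: lookup_add)
    then show "m \<in> exps V - {0}" using m(1) by auto
  next
    fix m assume m: "m \<in> exps V - {0}"
    then obtain v where v: "v \<in> keys m" by (metis DiffE insertI1 keys_eq_empty ex_in_conv)
    then obtain n where "m = n + xv v" by (metis exp_split in_keys_iff neq0_conv)
    then have "m = xv v + n" by (simp only: add.commute)
    then show "m \<in> exps V \<inter> pow_exps (xv ` V) 1" using m v by (auto simp: exps_def)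
  qed
  finally show ?thesis .
qed

definition part :: "'m set \<Rightarrow> ('m \<Rightarrow>\<^sub>0 'k::comm_monoid_add) \<Rightarrow> ('m \<Rightarrow>\<^sub>0 'k)" where
  "part T p = (\<Sum>m\<in>keys p \<inter> T. single m (lookup p m))"

lemma lookup_part: "lookup (part T p) k = (if k \<in> T then lookup p k else 0)"
proof -
  have "lookup (part T p) k = (\<Sum>m\<in>keys p \<inter> T. if k = m then lookup p m else 0)"
    unfolding part_def lookup_sum by (intro sum.cong) (auto simp: lookup_single when_def)
  also have "\<dots> = (if k \<in> keys p \<inter> T then lookup p k else 0)" by simp
  finally show ?thesis by (auto simp: in_keys_iff)
qed

lemma part_supp: "p \<in> supp_in U \<Longrightarrow> part T p \<in> supp_in (T \<inter> U)"
  by (auto simp: supp_in_iff lookup_part)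

lemma part_add: "part T (p + q) = part T p + part T q"
  by (rule poly_mapping_eqI) (simp add: lookup_part lookup_add)

lemma part_sum: "part T (sum f A) = (\<Sum>i\<in>A. part T (f i))"
proof (induction A rule: infinite_finite_induct)
  case (insert a A)
  then show ?case by (simp add: part_add)
qed (simp_all add: part_def)

lemma part_id: "p \<in> supp_in T \<Longrightarrow> part T p = p"
  by (rule poly_mapping_eqI) (auto simp: lookup_part supp_in_iff)

lemma part_disjoint: "p \<in> supp_in U \<Longrightarrow> T \<inter> U = {} \<Longrightarrow> part T p = 0"
  by (rule poly_mapping_eqI) (auto simp: lookup_part supp_in_iff)

lemma part_in: "part T p \<in> supp_in T"
  by (auto simp: supp_in_iff lookup_part)

text \<open>The degree in the variables of \<open>A\<close>, which measures the order along the prime ideal \<open>(x\<^sub>i | i \<in> A)\<close>.\<close>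

definition wdeg :: "'v set \<Rightarrow> ('v \<Rightarrow>\<^sub>0 nat) \<Rightarrow> nat" where
  "wdeg A m = (\<Sum>i\<in>A. lookup m i)"

lemma wdeg_add: "wdeg A (m + n) = wdeg A m + wdeg A n"
  by (simp add: wdeg_def lookup_add sum.distrib)

lemma wdeg_single: "finite A \<Longrightarrow> wdeg A (single v n) = (if v \<in> A then n else 0)"
  by (simp add: wdeg_def lookup_single when_def)

lemma wdeg_zero_outside: "m \<in> exps B \<Longrightarrow> A \<inter> B = {} \<Longrightarrow> wdeg A m = 0"
  by (auto simp: wdeg_def exps_def in_keys_iff subset_iff intro!: sum.neutral)

text \<open>The order along \<open>(x\<^sub>i | i \<in> A)\<close> is a valuation, and \<open>q\<close> has order 0: otherwise the part of \<open>z\<close> of degree at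
  most \<open>d\<close> in \<open>A\<close> would have a nonzero product with \<open>q\<close>, again of degree at most \<open>d\<close>.\<close>

lemma order_cancel:
  fixes z q :: "'k::field mpoly"
  assumes "z * q \<in> supp_in {m. d < wdeg A m}" "q \<noteq> 0" "q \<in> supp_in (exps B)" "A \<inter> B = {}"
  shows "z \<in> supp_in {m. d < wdeg A m}"
proof -
  let ?L = "{m. wdeg A m \<le> d}"
  have z: "z = part ?L z + part (- ?L) z" by (rule poly_mapping_eqI) (simp add: lookup_add lookup_part)
  have supp: "part ?L z \<in> supp_in ?L" "part (- ?L) z \<in> supp_in (- ?L)"
    using part_supp[of z UNIV] by (auto simp: supp_in_def)
  have 1: "part ?L z * q \<in> supp_in ?L"
    by (rule supp_in_mult[OF supp(1) assms(3)]) (use assms(4) in \<open>auto simp: wdeg_add wdeg_zero_outside\<close>)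
  have 2: "part (- ?L) z * q \<in> supp_in (- ?L)"
    by (rule supp_in_mult[OF supp(2) assms(3)]) (auto simp: wdeg_add)
  have "part ?L z * q = z * q - part (- ?L) z * q" using z by (metis add_diff_cancel_right' distrib_right)
  moreover have "z * q \<in> supp_in (- ?L)" using assms(1) by (rule supp_in_mono[rotated]) auto
  ultimately have "part ?L z * q \<in> supp_in (- ?L)" using 2 supp_in_diff by metis
  then have "part ?L z * q = 0" using 1 unfolding supp_in_iff by (intro poly_mapping_eqI) auto
  then have "part ?L z = 0" using assms(2) by simp
  then have "z = part (- ?L) z" using z by simp
  then have "z \<in> supp_in (- ?L)" using supp(2) by simp
  then show ?thesis by (rule supp_in_mono[rotated]) auto
qed

text \<open>Here \<open>J\<close> lies in the \<open>(d + 1)\<close>-st symbolic powers of \<open>P\<^sub>A = (x\<^sub>i | i \<in> A)\<close> and \<open>P\<^sub>B\<close>, and the annihilator of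
  the class of \<open>u = x\<^sup>\<alpha>\<close> contains \<open>P\<^sub>A P\<^sub>B\<close>. Write \<open>f = f\<^sub>A + f\<^sub>B + f\<^sub>M\<close>, where \<open>f\<^sub>A\<close> involves only the variables of \<open>A\<close>, \<open>f\<^sub>B\<close>
  only those of \<open>B\<close>, and \<open>f\<^sub>M\<close> has mixed monomials, and likewise for \<open>g\<close>. Then \<open>g (u f\<^sub>A) \<equiv> u f\<^sub>A g\<^sub>A \<equiv> f (u g\<^sub>A)\<close>
  modulo \<open>J\<close>. If \<open>g\<close> is regular modulo \<open>f\<close>, this gives \<open>u f\<^sub>A \<equiv> f z\<close>, and therefore \<open>u f\<^sub>B \<equiv> f (u - z)\<close>. Multiply
  these by \<open>f\<^sub>B\<close> and \<open>f\<^sub>A\<close> and cancel \<open>f\<close> to get \<open>z f\<^sub>B \<in> J\<close> and \<open>(u - z) f\<^sub>A \<in> J\<close>. So \<open>z\<close> has order greater than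
  \<open>d\<close> along \<open>P\<^sub>A\<close>, and \<open>u - z\<close> along \<open>P\<^sub>B\<close>. But \<open>u\<close> has order \<open>d\<close> along both, so its coefficient in \<open>z\<close> and in
  \<open>u - z\<close> is 0, which is absurd.\<close>

lemma no_regular_pair:
  fixes f g :: "'k::field mpoly" and V A B :: "nat set" and S :: "(nat \<Rightarrow>\<^sub>0 nat) set"
  defines "C \<equiv> supp_in (exps V) :: 'k mpoly set" and "J \<equiv> supp_in (exps V \<inter> S) :: 'k mpoly set"
  assumes V: "finite V" "V = A \<union> B" "A \<inter> B = {}" "A \<noteq> {}" "B \<noteq> {}"
    and up: "\<And>m p. m \<in> S \<Longrightarrow> m + p \<in> S"
    and ordA: "\<And>m. m \<in> S \<Longrightarrow> d < wdeg A m" and ordB: "\<And>m. m \<in> S \<Longrightarrow> d < wdeg B m"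
    and \<alpha>: "\<alpha> \<in> exps V" "wdeg A \<alpha> = d" "wdeg B \<alpha> = d"
    and join: "\<And>i j. i \<in> A \<Longrightarrow> j \<in> B \<Longrightarrow> \<alpha> + xv i + xv j \<in> S"
    and f: "f \<in> supp_in (exps V - {0})" and g: "g \<in> supp_in (exps V - {0})"
    and freg: "\<And>x. x \<in> C \<Longrightarrow> f * x \<in> J \<Longrightarrow> x \<in> J"
    and greg: "\<And>x y. x \<in> C \<Longrightarrow> y \<in> C \<Longrightarrow> g * x - f * y \<in> J \<Longrightarrow> \<exists>z\<in>C. x - f * z \<in> J"
  shows False
proof -
  define U where "U = single \<alpha> (1::'k)"
  define Mx where "Mx = {m \<in> exps V. m \<notin> exps A \<and> m \<notin> exps B}"
  have up': "p + m \<in> S" if "m \<in> S" for m p using up[OF that, of p] by (simp add: add.commute)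
  have Cm: "p * q \<in> C" if "p \<in> C" "q \<in> C" for p q
    using that unfolding C_def by (rule supp_in_mult) auto
  have CJ: "p * q \<in> J" if "p \<in> C" "q \<in> J" for p q
    using that unfolding C_def J_def by (rule supp_in_mult) (use up' in auto)
  have CM: "p * q \<in> supp_in Mx" if "p \<in> supp_in Mx" "q \<in> C" for p q
    using that unfolding C_def by (rule supp_in_mult) (auto simp: Mx_def)
  have MC: "q \<in> C" if "q \<in> supp_in Mx" for q
    using that unfolding C_def by (rule supp_in_mono[rotated]) (auto simp: Mx_def)
  have mix: "\<alpha> + m \<in> exps V \<inter> S" if m: "m \<in> Mx" for m
  proof -
    obtain i j where ij: "i \<in> keys m" "i \<in> A" "j \<in> keys m" "j \<in> B"
      using m V(2) unfolding Mx_def exps_def by blast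
    then obtain n where n: "m = n + xv i" by (metis exp_split in_keys_iff neq0_conv)
    have "i \<noteq> j" using ij V(3) by auto
    then have "0 < lookup n j" using ij(3) by (simp add: n in_keys_iff lookup_add lookup_single)
    then obtain r where r: "n = r + xv j" by (rule exp_split)
    have "\<alpha> + m = \<alpha> + xv i + xv j + r" by (simp only: n r add_ac)
    then have "\<alpha> + m \<in> S" using up[OF join[OF ij(2,4)], of r] by simp
    then show ?thesis using \<alpha>(1) m by (auto simp: Mx_def)
  qed
  have UM: "U * q \<in> J" if "q \<in> supp_in Mx" for q
    unfolding U_def J_def by (rule supp_in_mult[OF supp_in_single[of \<alpha> "{\<alpha>}"] that]) (use mix in auto)
  have UC: "U \<in> C" using \<alpha> by (auto simp: U_def C_def intro: supp_in_single)
  have decomp: "\<exists>pA pB pM. p = pA + pB + pM \<and> pA \<in> supp_in (exps A - {0}) \<and> pB \<in> supp_in (exps B - {0}) \<and> pM \<in> supp_in Mx"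
    if p: "p \<in> supp_in (exps V - {0})" for p :: "'k mpoly"
  proof (intro exI conjI)
    have AB: "m \<in> exps A \<Longrightarrow> m \<in> exps B \<Longrightarrow> m = 0" for m :: "nat \<Rightarrow>\<^sub>0 nat"
      using V(3) unfolding exps_def by (metis (mono_tags) Int_greatest keys_eq_empty mem_Collect_eq subset_empty)
    show "p = part (exps A - {0}) p + part (exps B - {0}) p + part Mx p"
      using p by (intro poly_mapping_eqI) (auto simp: lookup_add lookup_part supp_in_iff Mx_def dest: AB)
    show "part (exps A - {0}) p \<in> supp_in (exps A - {0})" "part (exps B - {0}) p \<in> supp_in (exps B - {0})"
      "part Mx p \<in> supp_in Mx" by (auto simp: supp_in_iff lookup_part)
  qed
  obtain fA fB fM where fd: "f = fA + fB + fM" "fA \<in> supp_in (exps A - {0})" "fB \<in> supp_in (exps B - {0})" "fM \<in> supp_in Mx"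
    using decomp[OF f] by blast
  obtain gA gB gM where gd: "g = gA + gB + gM" "gA \<in> supp_in (exps A - {0})" "gB \<in> supp_in (exps B - {0})" "gM \<in> supp_in Mx"
    using decomp[OF g] by blast
  have subV: "exps A - {0} \<subseteq> exps V" "exps B - {0} \<subseteq> exps V" using V(2) by (auto simp: exps_def)
  have C: "fA \<in> C" "fB \<in> C" "gA \<in> C" "gB \<in> C" "fM \<in> C" "gM \<in> C" "f \<in> C" "g \<in> C"
    using fd gd f g MC supp_in_mono[OF subV(1)] supp_in_mono[OF subV(2)] supp_in_mono[of "exps V - {0}" "exps V"]
    unfolding C_def by auto
  have AB: "p * q \<in> supp_in Mx" if "p \<in> supp_in (exps A - {0})" "q \<in> supp_in (exps B - {0})" for p q :: "'k mpoly"
    using that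
  proof (rule supp_in_mult)
    fix a b :: "nat \<Rightarrow>\<^sub>0 nat" assume a: "a \<in> exps A - {0}" and b: "b \<in> exps B - {0}"
    then obtain i j where ij: "i \<in> keys a" "j \<in> keys b"
      by (metis DiffD2 ex_in_conv insertI1 keys_eq_empty)
    moreover have "keys a \<subseteq> A" "keys b \<subseteq> B" using a b by (auto simp: exps_def)
    ultimately have "i \<notin> B" "j \<notin> A" using V(3) by auto
    then have "a + b \<notin> exps A" "a + b \<notin> exps B" using ij by (auto simp: exps_def keys_add_exp)
    moreover have "a + b \<in> exps V" using a b subV by auto
    ultimately show "a + b \<in> Mx" by (simp add: Mx_def)
  qed
  have Jadd: "p + q \<in> J" if "p \<in> J" "q \<in> J" for p q
    using that unfolding J_def by (rule supp_in_add)
  have Jdiff: "p - q \<in> J" if "p \<in> J" "q \<in> J" for p q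
    using that unfolding J_def by (rule supp_in_diff)
  have "U * (gB * fA + gM * fA - fB * gA - fM * gA) \<in> J"
  proof (rule UM, intro supp_in_diff supp_in_add)
    show "gB * fA \<in> supp_in Mx" "fB * gA \<in> supp_in Mx" using AB fd gd by (metis mult.commute)+
    show "gM * fA \<in> supp_in Mx" "fM * gA \<in> supp_in Mx" using CM C fd gd by blast+
  qed
  moreover have "g * (U * fA) - f * (U * gA) = U * (gB * fA + gM * fA - fB * gA - fM * gA)"
    by (simp add: fd(1) gd(1) algebra_simps)
  ultimately have "\<exists>z\<in>C. U * fA - f * z \<in> J" by (intro greg[of "U * fA" "U * gA"] Cm UC C) simp
  then obtain z where z: "z \<in> C" "U * fA - f * z \<in> J" by blast
  have fAB: "U * (fA * fB) \<in> J" using UM AB fd by blast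
  have "U * (fA * fB) - fB * (U * fA - f * z) \<in> J" by (intro Jdiff fAB CJ z C)
  then have "f * (z * fB) \<in> J" by (simp add: algebra_simps)
  then have zB: "z * fB \<in> J" by (rule freg[rotated]) (intro Cm z C)
  have "U * (fA * fB) + U * (fM * fA) + fA * (U * fA - f * z) \<in> J"
    by (intro Jadd fAB CJ z C UM CM fd)
  moreover have "U * (fA * fB) + U * (fM * fA) + fA * (U * fA - f * z) = f * ((U - z) * fA)"
    by (simp add: fd(1) algebra_simps)
  ultimately have "f * ((U - z) * fA) \<in> J" by simp
  moreover have "U - z \<in> C" using UC z(1) unfolding C_def by (rule supp_in_diff)
  ultimately have zA: "(U - z) * fA \<in> J" by (intro freg[of "(U - z) * fA"] Cm C)
  have finAB: "finite A" "finite B" using V by auto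
  have nJ: "U * Var j \<notin> J" if "wdeg A (\<alpha> + xv j) = d \<or> wdeg B (\<alpha> + xv j) = d" for j
  proof
    assume "U * Var j \<in> J"
    then have "\<alpha> + xv j \<in> S" by (auto simp: U_def Var_def mult_single J_def supp_in_def)
    then show False using ordA ordB that by fastforce
  qed
  have VC: "Var j \<in> supp_in (exps W - {0})" if "j \<in> W" for j :: nat and W
    unfolding Var_def using that by (intro supp_in_single) (auto simp: poly_mapping_eq_iff fun_eq_iff lookup_single when_def)
  \<comment> \<open>If \<open>f\<close> had no part in \<open>B\<close>, it would annihilate the class of \<open>u x\<^sub>j\<close> for \<open>j \<in> B\<close>.\<close>
  have "fB \<noteq> 0"
  proof
    assume "fB = 0"
    obtain j where j: "j \<in> B" using V by auto
    have Vj: "Var j \<in> C" using VC[of j V] j V(2) supp_in_mono[of "exps V - {0}" "exps V"] unfolding C_def by blast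
    have "U * (fA * Var j + fM * Var j) \<in> J" by (intro UM supp_in_add AB fd VC CM Vj j)
    moreover have "U * (fA * Var j + fM * Var j) = f * (U * Var j)" by (simp add: fd(1) \<open>fB = 0\<close> algebra_simps)
    ultimately have "f * (U * Var j) \<in> J" by simp
    then have "U * Var j \<in> J" by (rule freg[rotated]) (intro Cm UC Vj)
    moreover have "wdeg A (\<alpha> + xv j) = d" using j V finAB \<alpha> by (auto simp: wdeg_add wdeg_single)
    ultimately show False using nJ by blast
  qed
  have "fA \<noteq> 0"
  proof
    assume "fA = 0"
    obtain j where j: "j \<in> A" using V by auto
    have Vj: "Var j \<in> C" using VC[of j V] j V(2) supp_in_mono[of "exps V - {0}" "exps V"] unfolding C_def by blast
    have "U * (Var j * fB + fM * Var j) \<in> J" by (intro UM supp_in_add AB fd VC CM Vj j)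
    moreover have "U * (Var j * fB + fM * Var j) = f * (U * Var j)" by (simp add: fd(1) \<open>fA = 0\<close> algebra_simps)
    ultimately have "f * (U * Var j) \<in> J" by simp
    then have "U * Var j \<in> J" by (rule freg[rotated]) (intro Cm UC Vj)
    moreover have "wdeg B (\<alpha> + xv j) = d" using j V finAB \<alpha> by (auto simp: wdeg_add wdeg_single)
    ultimately show False using nJ by blast
  qed
  have JA: "p \<in> supp_in {m. d < wdeg A m}" and JB: "p \<in> supp_in {m. d < wdeg B m}" if "p \<in> J" for p
    using that ordA ordB unfolding J_def by (auto simp: supp_in_def)
  have "z \<in> supp_in {m. d < wdeg A m}"
    by (rule order_cancel[OF JA[OF zB] \<open>fB \<noteq> 0\<close> _ V(3)]) (use fd(3) in \<open>auto simp: supp_in_def\<close>)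
  moreover have "U - z \<in> supp_in {m. d < wdeg B m}"
    by (rule order_cancel[OF JB[OF zA] \<open>fA \<noteq> 0\<close>, of A]) (use fd(2) V(3) in \<open>auto simp: supp_in_def\<close>)
  ultimately have "lookup z \<alpha> = 0" "lookup (U - z) \<alpha> = 0"
    using \<alpha> unfolding supp_in_iff by auto
  then show False by (simp add: lookup_minus U_def)
qed

section \<open>Brooms\<close>

lemma pow_concave_mono: "pow_concave E v L \<Longrightarrow> K \<le> L \<Longrightarrow> pow_concave E v K"
  unfolding pow_concave_def by (meson less_le_trans)

lemma pow_concave_empty: "pow_concave {} v K"
  by (simp add: pow_concave_def)

lemma pow_concave_0: "pow_concave E v 0"
  by (simp add: pow_concave_def)

text \<open>The broom on the vertices \<open>1, \<dots>, b + 1\<close>: the vertices \<open>1, \<dots>, h - 1\<close> are leaves at \<open>h\<close>, and \<open>h, \<dots>, b + 1\<close> is a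
  path. Each vertex \<open>i \<le> b\<close> has exactly one larger neighbour \<open>parent i\<close>, so the edges are indexed by
  \<open>1, \<dots>, b\<close>.\<close>

locale broom =
  fixes h b :: nat
  assumes h: "2 \<le> h" "h \<le> b"
begin

definition parent :: "nat \<Rightarrow> nat" where
  "parent i = max (Suc i) h"

definition ed :: "nat \<Rightarrow> nat \<Rightarrow>\<^sub>0 nat" where
  "ed i = xv i + xv (parent i)"

abbreviation E :: "(nat \<Rightarrow>\<^sub>0 nat) set" where
  "E \<equiv> ed ` {1..b}"

abbreviation V :: "nat set" where
  "V \<equiv> {1..Suc b}"

lemma parent_gt: "i < parent i"
  by (simp add: parent_def)

lemma parent_path: "h \<le> Suc i \<Longrightarrow> parent i = Suc i"
  by (simp add: parent_def)

lemma parent_leaf: "i < h \<Longrightarrow> parent i = h"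
  by (simp add: parent_def)

lemma parent_le: "i \<le> b \<Longrightarrow> parent i \<le> Suc b"
  using h by (simp add: parent_def)

lemma E_exps: "E \<subseteq> exps V"
  using h parent_le parent_gt by (auto simp: ed_def Suc_le_eq) (metis le_eq_less_or_eq less_le_trans parent_gt)+

lemma lookup_ed: "lookup (ed i) j = (if j = i then 1 else 0) + (if j = parent i then 1 else 0)"
  by (simp add: ed_def lookup_add lookup_single when_def)

text \<open>Seen from the end \<open>b + 1\<close>, the path starts in a graph without edges, where concavity holds at every
  level. So it holds at every level all along, including at \<open>h\<close> after the leaves have been attached.\<close>

lemma concave_from_end:
  assumes "h \<le> l" "l \<le> Suc b"
  shows "pow_concave (ed ` {l..b}) l K"
  using assms(2,1)
proof (induction l rule: inc_induct)
  case base
  then show ?case by (simp add: pow_concave_empty)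
next
  case (step l)
  interpret pendant "ed ` {Suc l..b}" "Suc l" l
    by unfold_locales (auto simp: lookup_ed parent_def)
  have "pow_concave E' l (Suc K)" using step by (intro concave_path) auto
  moreover have "E' = ed ` {l..b}"
    using step by (auto simp: ed_def parent_path add.commute atLeastAtMost_insertL[symmetric])
  ultimately show ?case using pow_concave_mono by fastforce
qed

lemma concave_from_end_leaves:
  assumes "l \<le> h"
  shows "pow_concave (ed ` {l..b}) h K"
  using assms
proof (induction l rule: inc_induct)
  case base
  then show ?case using h concave_from_end by simp
next
  case (step l)
  interpret pendant "ed ` {Suc l..b}" h l
    using step by unfold_locales (auto simp: lookup_ed parent_def)
  have "pow_concave E' h K" using step by (intro concave_leaf) auto
  moreover have "E' = ed ` {l..b}"
    using step h by (auto simp: ed_def parent_leaf add.commute atLeastAtMost_insertL[symmetric])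
  ultimately show ?case by simp
qed

lemma meet_leaf_1:
  assumes "m + xv 1 \<in> pow_exps E k" "m + xv h \<in> pow_exps E k"
  shows "m \<in> pow_exps E k"
proof -
  interpret pendant "ed ` {2..b}" h 1
    using h by unfold_locales (auto simp: lookup_ed parent_def)
  have "{1..b} = insert 1 {2..b}" using h by auto
  then have "E' = E" using h by (simp add: ed_def parent_leaf add.commute)
  then show ?thesis using meet_leaf[OF concave_from_end_leaves[of 2 k] order_refl, of m] assms h by simp
qed

lemma ed_split: "h \<le> l \<Longrightarrow> ed l = xv l + xv (Suc l)"
  by (simp add: ed_def parent_path)

text \<open>Here the path starts at the vertex \<open>h\<close> with a loop. Nothing is known there, and the level is the
  number of edges walked so far.\<close>

lemma concave_from_loop:
  assumes "h \<le> l" "l \<le> b"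
  shows "pow_concave (insert (xv h + xv h) (ed ` {2..<l})) l (l - h)"
  using assms
proof (induction l rule: dec_induct)
  case base
  then show ?case by (simp add: pow_concave_0)
next
  case (step l)
  interpret pendant "insert (xv h + xv h) (ed ` {2..<l})" l "Suc l"
    using step h by unfold_locales (auto simp: lookup_ed parent_def lookup_add lookup_single)
  have "pow_concave E' (Suc l) (Suc (l - h))" using step by (intro concave_path) auto
  moreover have "{2..<Suc l} = insert l {2..<l}" using step h by auto
  then have "E' = insert (xv h + xv h) (ed ` {2..<Suc l})"
    using step by (simp add: ed_split insert_commute)
  ultimately show ?case using step by (simp add: Suc_diff_le)
qed

lemma merge_E: "merge 1 h ` E = insert (xv h + xv h) (ed ` {2..b})"
proof -
  have "{1..b} = insert 1 {2..b}" using h by auto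
  moreover have "merge 1 h (ed 1) = xv h + xv h"
    using h by (simp add: ed_def parent_leaf merge_add merge_xv merge_id lookup_single)
  moreover have "merge 1 h ` ed ` {2..b} = ed ` {2..b}" unfolding image_image
  proof (rule image_cong[OF refl])
    show "merge 1 h (ed i) = ed i" if "i \<in> {2..b}" for i
      using that h by (intro merge_id) (auto simp: lookup_ed parent_def)
  qed
  ultimately show ?thesis by simp
qed

text \<open>This is where small powers are distinguished: the path from the loop at \<open>h\<close> to \<open>b\<close> has \<open>b - h\<close> edges.\<close>

lemma meet_leaf_last:
  assumes "k \<le> b - h" and "m + xv b \<in> pow_exps (merge 1 h ` E) k" "m + xv (Suc b) \<in> pow_exps (merge 1 h ` E) k"
  shows "m \<in> pow_exps (merge 1 h ` E) k"
proof -
  interpret pendant "insert (xv h + xv h) (ed ` {2..<b})" b "Suc b"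
    using h by unfold_locales (auto simp: lookup_ed parent_def lookup_add lookup_single)
  have "{2..b} = insert b {2..<b}" using h by auto
  then have "E' = merge 1 h ` E" unfolding merge_E
    using h by (simp add: ed_split insert_commute)
  then show ?thesis using meet_leaf[OF concave_from_loop[of b] assms(1), of m] assms h by simp
qed

section \<open>The two colour classes of a broom\<close>

text \<open>The position along the path. All the leaves at \<open>h\<close> get the position before \<open>h\<close>, so that each edge raises the
  position by one and its parity is a proper colouring.\<close>

definition pos :: "nat \<Rightarrow> nat" where
  "pos i = max i (h - 1)"

definition side :: "bool \<Rightarrow> nat set" where
  "side s = {i \<in> V. even (pos i) = s}"

lemma pos_parent: "pos (parent i) = Suc (pos i)"
  using h by (auto simp: pos_def parent_def max_def)

lemma wdeg_ed: "i \<in> {1..b} \<Longrightarrow> wdeg (side s) (ed i) = 1"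
  using parent_le[of i] parent_gt[of i] pos_parent[of i] unfolding ed_def wdeg_add
  by (auto simp: wdeg_single side_def)

lemma wdeg_pow_exps: "m \<in> pow_exps E k \<Longrightarrow> k \<le> wdeg (side s) m"
proof (induction k arbitrary: m)
  case (Suc k)
  then obtain e n where m: "m = e + n" "e \<in> E" "n \<in> pow_exps E k" by auto
  then have "wdeg (side s) e = 1" using wdeg_ed by blast
  then show ?case using Suc.IH[OF m(3)] by (simp add: m(1) wdeg_add)
qed simp

lemma sum_ed_mem:
  assumes "finite L" "L \<subseteq> {1..b}" "m \<in> pow_exps E k"
  shows "(\<Sum>l\<in>L. ed l) + m \<in> pow_exps E (card L + k)"
  using assms
proof (induction L rule: finite_induct)
  case (insert l L)
  have "ed l + ((\<Sum>l\<in>L. ed l) + m) \<in> pow_exps E (Suc (card L + k))"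
    by (rule pow_exps_SucI) (use insert in auto)
  then show ?case using insert by (simp add: add.assoc del: pow_exps.simps)
qed simp

text \<open>The path from \<open>i\<close> to the vertex \<open>j\<close> at position \<open>pos i + 2 s + 1\<close> has \<open>2 s + 1\<close> edges, and for \<open>s > 0\<close>
  the sum runs over the \<open>2 s - 1\<close> inner ones. Every second inner edge, starting with the first,
  regroups together with \<open>x\<^sub>i\<close> and \<open>x\<^sub>j\<close> into the complementary edges of the path, which are one more. For \<open>s = 0\<close>
  the path is a single edge and there are no inner edges, hence the maximum.\<close>

lemma zigzag:
  assumes i: "i \<in> {1..b}" and "pos i + 2 * s \<le> b"
  shows "xv i + xv (pos i + 2 * s + 1) + (\<Sum>l\<in>{pos i + 1..<pos i + 2 * s}. ed l)
     \<in> pow_exps E (max 1 (2 * s))"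
  using assms(2)
proof (induction s)
  case 0
  have "parent i = pos i + 1" using h by (auto simp: pos_def parent_def max_def)
  then have "xv i + xv (pos i + 2 * 0 + 1) + (\<Sum>l\<in>{pos i + 1..<pos i + 2 * 0}. ed l) = ed i + 0"
    by (simp add: ed_def)
  moreover have "ed i + 0 \<in> pow_exps E (Suc 0)" by (rule pow_exps_SucI) (use i in auto)
  ultimately show ?case by (simp del: pow_exps.simps)
next
  case (Suc s)
  define q where "q = Suc (pos i + 2 * s)"
  let ?S = "\<Sum>l\<in>{pos i + 1..<pos i + 2 * s}. ed l"
  have q: "pos i + 2 * s + 1 = q" "pos i + 2 * Suc s + 1 = Suc (Suc q)" by (simp_all add: q_def)
  have hq: "h \<le> q" by (auto simp: pos_def q_def)
  have IH: "xv i + xv q + ?S \<in> pow_exps E (max 1 (2 * s))" using Suc unfolding q by simp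
  have last: "ed (Suc q) \<in> E" using Suc.prems by (auto simp: q_def)
  have e: "xv (Suc (Suc q)) + ed q = ed (Suc q) + xv q" using hq by (simp add: ed_split add_ac)
  show ?case
  proof (cases "s = 0")
    case True
    have "ed (Suc q) + (xv i + xv q + ?S) \<in> pow_exps E (Suc 1)"
      by (rule pow_exps_SucI[OF last]) (use IH True in simp)
    moreover have "{pos i + 1..<pos i + 2 * Suc s} = {q}" using True by (auto simp: q_def)
    then have "xv i + xv (Suc (Suc q)) + (\<Sum>l\<in>{pos i + 1..<pos i + 2 * Suc s}. ed l) = xv i + (xv (Suc (Suc q)) + ed q)"
      by (simp add: add.assoc)
    then have "xv i + xv (Suc (Suc q)) + (\<Sum>l\<in>{pos i + 1..<pos i + 2 * Suc s}. ed l) = ed (Suc q) + (xv i + xv q + ?S)"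
      unfolding e using True by (simp add: add_ac)
    ultimately show ?thesis using True unfolding q by (simp add: numeral_2_eq_2 del: pow_exps.simps)
  next
    case False
    have range: "{pos i + 1..<pos i + 2 * Suc s} = insert (pos i + 2 * s) (insert q {pos i + 1..<pos i + 2 * s})"
      using False by (auto simp: q_def)
    have "(\<Sum>l\<in>{pos i + 1..<pos i + 2 * Suc s}. ed l) = ed (pos i + 2 * s) + (ed q + ?S)"
      unfolding range by (simp add: q_def)
    then have "xv i + xv (Suc (Suc q)) + (\<Sum>l\<in>{pos i + 1..<pos i + 2 * Suc s}. ed l)
      = xv i + ed (pos i + 2 * s) + ?S + (xv (Suc (Suc q)) + ed q)"
      by (simp only: add_ac)
    also have "\<dots> = ed (Suc q) + (ed (pos i + 2 * s) + (xv i + xv q + ?S))"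
      unfolding e by (simp only: add_ac)
    finally have "xv i + xv (Suc (Suc q)) + (\<Sum>l\<in>{pos i + 1..<pos i + 2 * Suc s}. ed l)
      = ed (Suc q) + (ed (pos i + 2 * s) + (xv i + xv q + ?S))" .
    moreover have "ed (Suc q) + (ed (pos i + 2 * s) + (xv i + xv q + ?S)) \<in> pow_exps E (Suc (Suc (max 1 (2 * s))))"
      by (intro pow_exps_SucI last IH) (use Suc.prems False in auto)
    moreover have "max 1 (2 * Suc s) = Suc (Suc (max 1 (2 * s)))" using False by simp
    ultimately show ?thesis unfolding q by (simp only:)
  qed
qed

lemma join_lt:
  assumes "i \<in> V" "j \<in> V" "pos i < pos j" "even (pos i) \<noteq> even (pos j)"
  shows "(\<Sum>l\<in>{h..<b}. ed l) + xv i + xv j \<in> pow_exps E (b - h + 1)"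
proof -
  have "odd (pos j - pos i)" using assms(3,4) by auto
  then obtain s where "pos j - pos i = 2 * s + 1" by (rule oddE)
  then have s: "pos j = pos i + 2 * s + 1" using assms(3) by simp
  have pj: "pos j = j" using assms(3) by (auto simp: pos_def max_def split: if_splits)
  have jb: "pos i + 2 * s \<le> b" using s pj assms(2) by simp
  have i: "i \<in> {1..b}" using assms(1) jb by (auto simp: pos_def max_def split: if_splits)
  have p: "h \<le> Suc (pos i)" by (auto simp: pos_def)
  define M where "M = {pos i + 1..<pos i + 2 * s}"
  define L where "L = {h..<pos i + 1} \<union> {max (pos i + 1) (pos i + 2 * s)..<b}"
  have M: "xv i + xv j + (\<Sum>l\<in>M. ed l) \<in> pow_exps E (max 1 (2 * s))"
    using zigzag[OF i jb] s pj by (simp add: M_def)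
  show ?thesis
  proof (cases "s = 0")
    case True
    have "(\<Sum>l\<in>{h..<b}. ed l) + (xv i + xv j) \<in> pow_exps E (card {h..<b} + 1)"
      by (rule sum_ed_mem) (use h M True in \<open>auto simp: M_def simp del: pow_exps.simps\<close>)
    then show ?thesis by (simp add: add.assoc del: pow_exps.simps)
  next
    case False
    have disj: "L \<inter> M = {}" "L \<union> M = {h..<b}" using False p jb s pj assms(2) by (auto simp: L_def M_def)
    have fin: "finite L" "finite M" by (auto simp: L_def M_def)
    have "card L + card M = card {h..<b}" using card_Un_disjoint[OF fin disj(1)] disj(2) by simp
    then have "card L + 2 * s = b - h + 1" using False by (auto simp: M_def)
    moreover have "(\<Sum>l\<in>L. ed l) + (xv i + xv j + (\<Sum>l\<in>M. ed l)) \<in> pow_exps E (card L + max 1 (2 * s))"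
    proof (rule sum_ed_mem[OF fin(1) _ M])
      have "L \<subseteq> {h..<b}" using disj(2) by blast
      also have "\<dots> \<subseteq> {1..b}" using h by auto
      finally show "L \<subseteq> {1..b}" .
    qed
    moreover have "(\<Sum>l\<in>{h..<b}. ed l) = (\<Sum>l\<in>L. ed l) + (\<Sum>l\<in>M. ed l)"
      using sum.union_disjoint[OF fin disj(1)] disj(2) by simp
    ultimately show ?thesis using False by (simp add: add_ac max_def del: pow_exps.simps)
  qed
qed

text \<open>The exponent of the monomial \<open>u\<close> for \<open>no_regular_pair\<close>: all edges between inner vertices, and \<open>c\<close> more
  copies of the last edge to adapt it to higher powers of the edge ideal.\<close>

definition socle :: "nat \<Rightarrow> nat \<Rightarrow>\<^sub>0 nat" where
  "socle c = ((\<lambda>m. ed b + m) ^^ c) (\<Sum>l\<in>{h..<b}. ed l)"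

lemma socle_Suc: "socle (Suc c) = ed b + socle c"
  by (simp add: socle_def)

lemma socle_join:
  assumes "i \<in> side True" "j \<in> side False"
  shows "socle c + xv i + xv j \<in> pow_exps E (Suc (c + (b - h)))"
proof (induction c)
  case 0
  have "pos i < pos j \<or> pos j < pos i" using assms by (cases "pos i" "pos j" rule: linorder_cases) (auto simp: side_def)
  then have "(\<Sum>l\<in>{h..<b}. ed l) + xv i + xv j \<in> pow_exps E (b - h + 1)"
  proof
    assume "pos i < pos j"
    then show ?thesis using assms join_lt[of i j] by (auto simp: side_def simp del: pow_exps.simps)
  next
    assume "pos j < pos i"
    then have "(\<Sum>l\<in>{h..<b}. ed l) + xv j + xv i \<in> pow_exps E (b - h + 1)"
      using assms join_lt[of j i] by (auto simp: side_def simp del: pow_exps.simps)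
    then show ?thesis by (simp only: add_ac)
  qed
  then show ?case by (simp add: socle_def del: pow_exps.simps)
next
  case (Suc c)
  have "ed b + (socle c + xv i + xv j) \<in> pow_exps E (Suc (Suc (c + (b - h))))"
    by (rule pow_exps_SucI[OF _ Suc.IH]) (use h in auto)
  then show ?case by (simp add: socle_Suc add.assoc del: pow_exps.simps)
qed

lemma socle_exps: "socle c \<in> exps V"
proof (induction c)
  case 0
  have "sum ed L \<in> exps V" if "L \<subseteq> {1..b}" for L
    using that E_exps by (induction L rule: infinite_finite_induct) auto
  moreover have "{h..<b} \<subseteq> {1..b}" using h by auto
  ultimately have "sum ed {h..<b} \<in> exps V" by blast
  then show ?case by (simp add: socle_def)
next
  case (Suc c)
  have "ed b \<in> E" using h by auto
  then show ?case using Suc E_exps by (auto simp: socle_Suc)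
qed

lemma wdeg_socle: "wdeg (side s) (socle c) = c + (b - h)"
proof (induction c)
  case 0
  have "wdeg (side s) (sum ed L) = card L" if "L \<subseteq> {1..b}" for L
    using that
  proof (induction L rule: infinite_finite_induct)
    case (insert l L)
    then show ?case using wdeg_ed[of l s] by (simp add: wdeg_add)
  next
    case (infinite L)
    then show ?case using finite_subset by blast
  qed (simp add: wdeg_def)
  moreover have "{h..<b} \<subseteq> {1..b}" using h by auto
  ultimately have "wdeg (side s) (sum ed {h..<b}) = card {h..<b}" by blast
  then show ?case by (simp add: socle_def)
next
  case (Suc c)
  then show ?case using wdeg_ed[of b s] h by (simp add: socle_Suc wdeg_add)
qed

section \<open>Depth of the powers of the edge ideal of a broom\<close>

abbreviation J :: "nat \<Rightarrow> 'k::field mpoly set" where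
  "J k \<equiv> supp_in (exps V \<inter> pow_exps E k)"

abbreviation mm :: "'k::field mpoly set" where
  "mm \<equiv> graded_max_ideal V"

abbreviation S :: "'k::field mpoly ring" where
  "S \<equiv> mpoly_ring V"

lemma S_cring: "cring S"
  unfolding mpoly_ring_eq by (rule exp_monoid.cring_mono_ring[OF exp_monoid_exps])

lemma J_ideal: "ideal (J k) S"
  by (rule ideal_supp_exps) (rule pow_exps_add)

lemma mm_ideal: "ideal mm S"
  unfolding graded_max_ideal_eq mpoly_ring_eq
  by (rule exp_monoid.ideal_supp_in[OF exp_monoid_exps]) (auto simp: poly_mapping_eq_iff fun_eq_iff lookup_add)

lemma J_sub_mm: "1 \<le> k \<Longrightarrow> J k \<subseteq> mm"
  unfolding graded_max_ideal_eq
proof (rule subsetI, erule supp_in_mono[rotated], rule subsetI)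
  fix m assume k: "1 \<le> k" and m: "m \<in> exps V \<inter> pow_exps E k"
  then have "k \<le> wdeg (side True) m" using wdeg_pow_exps by blast
  then show "m \<in> exps V - {0}" using k m by (auto simp: wdeg_def)
qed

lemma one_notin_mm: "(1 :: 'k::field mpoly) \<notin> mm"
  unfolding graded_max_ideal_eq supp_in_def by simp

lemma Var_diff_mm: "i \<in> V \<Longrightarrow> j \<in> V \<Longrightarrow> Var i - Var j \<in> mm"
  unfolding graded_max_ideal_eq Var_def
  by (intro supp_in_diff supp_in_single) (auto simp: poly_mapping_eq_iff fun_eq_iff lookup_single when_def)

text \<open>Regular for every \<open>k\<close>, since concavity at \<open>h\<close> holds at every level.\<close>

lemma first_regular:
  fixes x :: "'k::field mpoly"
  assumes "x \<in> supp_in (exps V)" "(Var 1 - Var h) * x \<in> J k"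
  shows "x \<in> J k"
proof -
  have "x \<in> supp_in (pow_exps E k)"
  proof (rule binomial_regular[OF pow_exps_add])
    show "(Var 1 - Var h) * x \<in> supp_in (pow_exps E k)" using assms(2) by (rule supp_in_mono[rotated]) auto
  qed (use h meet_leaf_1 in auto)
  then show ?thesis using assms(1) by (auto simp: supp_in_def)
qed

lemma depth_ge_1: "1 \<le> k \<Longrightarrow> 1 \<le> depth S mm (quot_module S (J k :: 'k::field mpoly set))"
proof (rule ideal.depth_ge_1[OF J_ideal S_cring mm_ideal J_sub_mm, where f = "Var 1 - Var h"])
  show "Var 1 - Var h \<in> (mm :: 'k mpoly set)" by (rule Var_diff_mm) (use h in auto)
qed (use one_notin_mm first_regular in \<open>auto simp: mpoly_ring_eq\<close>)

lemma depth_ge_2: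
  assumes "1 \<le> k" "k \<le> b - h"
  shows "2 \<le> depth S mm (quot_module S (J k :: 'k::field mpoly set))"
proof (rule ideal.depth_ge_2[OF J_ideal S_cring mm_ideal J_sub_mm, where f = "Var 1 - Var h" and g = "Var b - Var (Suc b)"])
  note minus = exp_monoid.a_minus_mono_ring[OF exp_monoid_exps]
  note mult = exp_monoid.mult_mem[OF exp_monoid_exps]
  have C: "Var 1 - Var h \<in> (supp_in (exps V) :: 'k mpoly set)" "Var b - Var (Suc b) \<in> (supp_in (exps V) :: 'k mpoly set)"
    using h unfolding Var_def by (intro supp_in_diff supp_in_single; simp)+
  fix x y :: "'k mpoly" assume xy: "x \<in> carrier S" "y \<in> carrier S"
    and "(Var b - Var (Suc b)) \<otimes>\<^bsub>S\<^esub> x \<ominus>\<^bsub>S\<^esub> (Var 1 - Var h) \<otimes>\<^bsub>S\<^esub> y \<in> J k"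
  then have *: "(Var b - Var (Suc b)) * x - (Var 1 - Var h) * y \<in> J k"
    using C by (simp add: mpoly_ring_eq minus mult)
  have "\<exists>z\<in>supp_in (exps V). x - (Var 1 - Var h) * z \<in> J k"
  proof (rule binomial_regular_after_merge[OF _ _ _ E_exps _ _ _ *])
    show "push (merge 1 h) (Var b - Var (Suc b)) = (Var b - Var (Suc b) :: 'k mpoly)"
      using h by (simp add: Var_def push_diff merge_id lookup_single)
    fix p :: "'k mpoly" assume p: "(Var b - Var (Suc b)) * p \<in> supp_in (pow_exps (merge 1 h ` E) k)"
    show "p \<in> supp_in (pow_exps (merge 1 h ` E) k)"
      by (rule binomial_regular[OF pow_exps_add _ _ p]) (use meet_leaf_last assms in auto)
  qed (use h xy in \<open>auto simp: mpoly_ring_eq\<close>)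
  then show "\<exists>z\<in>carrier S. x \<ominus>\<^bsub>S\<^esub> (Var 1 - Var h) \<otimes>\<^bsub>S\<^esub> z \<in> J k"
    using xy C by (auto simp: mpoly_ring_eq minus mult)
next
  show "Var 1 - Var h \<in> (mm :: 'k mpoly set)" "Var b - Var (Suc b) \<in> (mm :: 'k mpoly set)"
    by (rule Var_diff_mm; use h in auto)+
qed (use assms one_notin_mm first_regular in \<open>auto simp: mpoly_ring_eq\<close>)

lemma depth_le_1:
  assumes "b - h < k"
  shows "depth S mm (quot_module S (J k :: 'k::field mpoly set)) \<le> 1"
proof (rule ideal.depth_le_1[OF J_ideal S_cring])
  note minus = exp_monoid.a_minus_mono_ring[OF exp_monoid_exps]
  note mult = exp_monoid.mult_mem[OF exp_monoid_exps]
  interpret mm: ideal mm "S :: 'k mpoly ring" by (rule mm_ideal)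
  show sub: "mm \<subseteq> carrier (S :: 'k mpoly ring)" by (rule mm.a_subset)
  define d where "d = k - 1"
  define c where "c = d - (b - h)"
  have k: "k = Suc d" "d = c + (b - h)" using assms by (auto simp: d_def c_def)
  have side: "V = side True \<union> side False" "side True \<inter> side False = {}" by (auto simp: side_def)
  have "h \<in> side (even h)" "Suc b \<in> side (even (Suc b))" "b \<in> side (even b)"
    using h by (auto simp: side_def pos_def max_def)
  then have ne: "side True \<noteq> {}" "side False \<noteq> {}" by (cases "even b"; auto)+
  fix f g :: "'k mpoly"
  assume f: "f \<in> mm" and g: "g \<in> mm"
    and freg: "\<And>x. x \<in> carrier S \<Longrightarrow> f \<otimes>\<^bsub>S\<^esub> x \<in> J k \<Longrightarrow> x \<in> J k"
    and greg: "\<And>x y. x \<in> carrier S \<Longrightarrow> y \<in> carrier S \<Longrightarrow> g \<otimes>\<^bsub>S\<^esub> x \<ominus>\<^bsub>S\<^esub> f \<otimes>\<^bsub>S\<^esub> y \<in> J k \<Longrightarrow>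
      \<exists>z\<in>carrier S. x \<ominus>\<^bsub>S\<^esub> f \<otimes>\<^bsub>S\<^esub> z \<in> J k"
  have C: "f \<in> supp_in (exps V)" "g \<in> supp_in (exps V)" using f g sub by (auto simp: mpoly_ring_eq)
  show False
  proof (rule no_regular_pair[of V "side True" "side False" "pow_exps E k" d "socle c" f g])
    show "\<exists>z\<in>supp_in (exps V). x - f * z \<in> J k"
      if "x \<in> supp_in (exps V)" "y \<in> supp_in (exps V)" "g * x - f * y \<in> J k" for x y
      using greg[of x y] that C by (auto simp: mpoly_ring_eq minus mult)
    show "d < wdeg (side True) m" "d < wdeg (side False) m" if "m \<in> pow_exps E k" for m
      using wdeg_pow_exps[OF that] k(1) by (simp_all add: Suc_le_eq)
    show "socle c + xv i + xv j \<in> pow_exps E k" if "i \<in> side True" "j \<in> side False" for i j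
      using socle_join[OF that, of c] unfolding k .
    show "x \<in> J k" if "x \<in> supp_in (exps V)" "f * x \<in> J k" for x
      using freg[of x] that by (simp add: mpoly_ring_eq)
    show "f \<in> supp_in (exps V - {0})" "g \<in> supp_in (exps V - {0})"
      using f g unfolding graded_max_ideal_eq .
    show "V = side True \<union> side False" "side True \<inter> side False = {}" "side True \<noteq> {}" "side False \<noteq> {}"
      by (fact side ne)+
  qed (simp_all only: pow_exps_add socle_exps wdeg_socle k(2) finite_atLeastAtMost)
qed

lemma depth_eq_1: "b - h < k \<Longrightarrow> depth S mm (quot_module S (J k :: 'k::field mpoly set)) = 1"
  using depth_ge_1[of k, where 'k = 'k] depth_le_1[of k, where 'k = 'k] by (intro antisym) auto

lemma dstab_J: "dstab S mm (J 1 :: 'k::field mpoly set) = b - h + 1"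
  unfolding dstab_def ideal_pow_monomials[OF E_exps]
proof (rule Least_equality)
  show "1 \<le> b - h + 1 \<and> (\<forall>l\<ge>b - h + 1. depth S mm (quot_module S (J (b - h + 1) :: 'k mpoly set)) = depth S mm (quot_module S (J l :: 'k mpoly set)))"
  proof (intro conjI allI impI)
    fix l assume l: "b - h + 1 \<le> l"
    show "depth S mm (quot_module S (J (b - h + 1) :: 'k mpoly set)) = depth S mm (quot_module S (J l :: 'k mpoly set))"
      by (rule trans[OF depth_eq_1 depth_eq_1[symmetric]]) (use l in auto)
  qed simp
next
  fix k assume k: "1 \<le> k \<and> (\<forall>l\<ge>k. depth S mm (quot_module S (J k :: 'k mpoly set)) = depth S mm (quot_module S (J l :: 'k mpoly set)))"
  show "b - h + 1 \<le> k"
  proof (rule ccontr)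
    assume "\<not> b - h + 1 \<le> k"
    then have "k \<le> b - h" by simp
    have "depth S mm (quot_module S (J k :: 'k mpoly set)) = depth S mm (quot_module S (J (b - h + 1) :: 'k mpoly set))"
      using k \<open>k \<le> b - h\<close> by (metis trans_le_add1)
    also have "\<dots> = 1" by (rule depth_eq_1) simp
    finally show False using depth_ge_2[of k, where 'k = 'k] k \<open>k \<le> b - h\<close> by simp
  qed
qed

end

section \<open>Krull dimension of subalgebras generated by monomials\<close>

lemma krull_dim_surj_le:
  assumes "cring R" "cring T" "f \<in> ring_hom R T" "f ` carrier R = carrier T"
  shows "krull_dim T \<le> krull_dim R"
  unfolding krull_dim_def[of T]
proof (intro Sup_least, elim CollectE exE conjE)
  interpret ring_hom_ring R T f
    using assms by (intro ring_hom_ringI2) (auto dest: cring.axioms(1))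
  fix n r P assume n: "n = enat r" and P: "\<forall>i\<le>r. primeideal (P i) T" "\<forall>i<r. P i \<subset> P (Suc i)"
  define Q where "Q i = {x \<in> carrier R. f x \<in> P i}" for i :: nat
  have "primeideal (Q i) R" if "i \<le> r" for i
    unfolding Q_def using P(1) that by (intro primeideal_vimage assms(1)) auto
  moreover have "Q i \<subset> Q (Suc i)" if "i < r" for i
  proof -
    from P(2) that obtain y where y: "y \<in> P (Suc i)" "y \<notin> P i" by blast
    have "primeideal (P (Suc i)) T" using P(1) that by simp
    then have "y \<in> carrier T" using y(1) by (meson ideal.Icarr primeideal.axioms(1))
    then obtain x where "x \<in> carrier R" "y = f x" using assms(4) by auto
    then show ?thesis using y P(2) that unfolding Q_def by auto
  qed
  ultimately show "n \<le> krull_dim R" unfolding krull_dim_def n by (intro Sup_upper) blast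
qed

lemma krull_dim_iso:
  assumes "cring R" "cring T" "R \<simeq> T"
  shows "krull_dim R = krull_dim T"
proof (rule antisym)
  obtain f where f: "f \<in> ring_iso R T" using assms(3) by (auto simp: is_ring_iso_def)
  then show "krull_dim T \<le> krull_dim R"
    by (intro krull_dim_surj_le[of R T f] assms) (auto simp: ring_iso_def bij_betw_def)
  have "inv_into (carrier R) f \<in> ring_iso T R" by (rule ring_iso_set_sym[OF cring.axioms(1)[OF assms(1)] f])
  then show "krull_dim R \<le> krull_dim T"
    by (intro krull_dim_surj_le[of T R "inv_into (carrier R) f"] assms) (auto simp: ring_iso_def bij_betw_def)
qed

text \<open>Gaussian elimination: the equation for \<open>y\<close> is solved for one unknown with a nonzero coefficient.\<close>

lemma more_unknowns_than_equations:
  fixes a :: "'e \<Rightarrow> 'y \<Rightarrow> 'k::field"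
  assumes "finite Y" "finite F" "card Y < card F"
  shows "\<exists>c. (\<exists>e\<in>F. c e \<noteq> 0) \<and> (\<forall>y\<in>Y. (\<Sum>e\<in>F. c e * a e y) = 0)"
  using assms
proof (induction Y arbitrary: F a rule: finite_induct)
  case empty
  then show ?case by (intro exI[of _ "\<lambda>_. 1"]) (auto simp: card_gt_0_iff)
next
  case (insert y Y)
  show ?case
  proof (cases "\<forall>e\<in>F. a e y = 0")
    case True
    obtain c where "\<exists>e\<in>F. c e \<noteq> 0" "\<forall>y\<in>Y. (\<Sum>e\<in>F. c e * a e y) = 0"
      using insert.IH[of F a] insert.prems insert.hyps by auto
    then show ?thesis using True by (intro exI[of _ c]) auto
  next
    case False
    then obtain e0 where e0: "e0 \<in> F" "a e0 y \<noteq> 0" by auto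
    define a' where "a' e z = a e z - a e y / a e0 y * a e0 z" for e z
    have "card Y < card (F - {e0})" using insert e0 by simp
    then obtain c where c: "\<exists>e\<in>F - {e0}. c e \<noteq> 0" "\<forall>z\<in>Y. (\<Sum>e\<in>F - {e0}. c e * a' e z) = 0"
      using insert.IH[of "F - {e0}" a'] insert.prems by auto
    define s where "s = (\<Sum>e\<in>F - {e0}. c e * a e y)"
    define c0 where "c0 = - s / a e0 y"
    define d where "d = c(e0 := c0)"
    have sum: "(\<Sum>e\<in>F. d e * a e z) = c0 * a e0 z + (\<Sum>e\<in>F - {e0}. c e * a e z)" for z
    proof -
      have "(\<Sum>e\<in>F. d e * a e z) = d e0 * a e0 z + (\<Sum>e\<in>F - {e0}. d e * a e z)"
        using e0 insert.prems by (intro sum.remove) auto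
      also have "(\<Sum>e\<in>F - {e0}. d e * a e z) = (\<Sum>e\<in>F - {e0}. c e * a e z)"
        by (intro sum.cong) (auto simp: d_def)
      finally show ?thesis by (simp add: d_def)
    qed
    have "(\<Sum>e\<in>F. d e * a e z) = 0" if "z \<in> insert y Y" for z
    proof (cases "z = y")
      case True
      then show ?thesis using e0 by (simp add: sum c0_def s_def)
    next
      case False
      then have "z \<in> Y" using that by simp
      then have "(\<Sum>e\<in>F - {e0}. c e * a e z - c e * a e y * (a e0 z / a e0 y)) = 0"
        using c(2) by (simp add: a'_def algebra_simps)
      then have "(\<Sum>e\<in>F - {e0}. c e * a e z) = s * (a e0 z / a e0 y)"
        unfolding s_def by (simp add: sum_subtractf sum_distrib_right sum_divide_distrib)
      then show ?thesis by (simp add: sum c0_def)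
    qed
    moreover have "\<exists>e\<in>F. d e \<noteq> 0" using c(1) by (auto simp: d_def)
    ultimately show ?thesis by blast
  qed
qed

lemma dependent_polys:
  fixes w :: "'e \<Rightarrow> ('m::comm_monoid_add \<Rightarrow>\<^sub>0 'k::field)"
  assumes "finite Y" "finite F" "card Y < card F" "\<And>e. e \<in> F \<Longrightarrow> w e \<in> supp_in Y"
  shows "\<exists>c. (\<exists>e\<in>F. c e \<noteq> 0) \<and> (\<Sum>e\<in>F. single 0 (c e) * w e) = 0"
proof -
  obtain c where c: "\<exists>e\<in>F. c e \<noteq> 0" "\<forall>y\<in>Y. (\<Sum>e\<in>F. c e * lookup (w e) y) = 0"
    using more_unknowns_than_equations[OF assms(1-3), of "\<lambda>e. lookup (w e)"] by blast
  have lookup: "lookup (single 0 (c e) * w e) m = c e * lookup (w e) m" for e m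
    by (simp flip: mult_map_scale_conv_mult add: map.rep_eq when_def)
  have "(\<Sum>e\<in>F. single 0 (c e) * w e) = 0"
  proof (rule poly_mapping_eqI)
    fix m
    have "(\<Sum>e\<in>F. c e * lookup (w e) m) = 0"
    proof (cases "m \<in> Y")
      case False
      then show ?thesis using assms(4) by (intro sum.neutral) (auto simp: supp_in_iff)
    qed (use c in auto)
    then show "lookup (\<Sum>e\<in>F. single 0 (c e) * w e) m = lookup 0 m"
      by (simp add: lookup_sum lookup)
  qed
  then show ?thesis using c(1) by blast
qed

context exp_monoid
begin

lemma prime_facts:
  fixes P :: "('m \<Rightarrow>\<^sub>0 'k::field) set"
  assumes "primeideal P (mono_ring T)"
  shows "P \<subseteq> supp_in T" "0 \<in> P" "p \<in> P \<Longrightarrow> q \<in> P \<Longrightarrow> p + q \<in> P" "p \<in> P \<Longrightarrow> q \<in> P \<Longrightarrow> p - q \<in> P"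
    "a \<in> supp_in T \<Longrightarrow> p \<in> P \<Longrightarrow> a * p \<in> P" "a \<in> supp_in T \<Longrightarrow> q \<in> supp_in T \<Longrightarrow> a * q \<in> P \<Longrightarrow> a \<in> P \<or> q \<in> P"
    "1 \<notin> P"
proof -
  interpret R: cring "mono_ring T :: ('m \<Rightarrow>\<^sub>0 'k) ring" by (rule cring_mono_ring)
  interpret P: primeideal P "mono_ring T" by fact
  show sub: "P \<subseteq> supp_in T" using P.a_subset by simp
  have add: "p + q \<in> P" if "p \<in> P" "q \<in> P" for p q
    using additive_subgroup.a_closed[OF P.is_additive_subgroup that] by simp
  show "0 \<in> P" using additive_subgroup.zero_closed[OF P.is_additive_subgroup] by simp
  have mul: "a * p \<in> P" if "a \<in> supp_in T" "p \<in> P" for a p using P.I_l_closed[of p a] that by simp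
  have "- (1 :: 'm \<Rightarrow>\<^sub>0 'k) \<in> supp_in T" using one_mem[where 'k = 'k] by simp
  then have neg: "- p \<in> P" if "p \<in> P" for p using mul[of "- 1" p] that by simp
  show "p \<in> P \<Longrightarrow> q \<in> P \<Longrightarrow> p - q \<in> P" using add[of p "- q"] neg[of q] by simp
  show "a \<in> supp_in T \<Longrightarrow> q \<in> supp_in T \<Longrightarrow> a * q \<in> P \<Longrightarrow> a \<in> P \<or> q \<in> P" using P.I_prime[of a q] by simp
  show "1 \<notin> P" using P.one_imp_carrier P.I_notcarr by auto
  show "p \<in> P \<Longrightarrow> q \<in> P \<Longrightarrow> p + q \<in> P" "a \<in> supp_in T \<Longrightarrow> p \<in> P \<Longrightarrow> a * p \<in> P" using add mul by auto
qed

lemma sum_in_prime: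
  assumes "primeideal P (mono_ring T)" "\<And>i. i \<in> A \<Longrightarrow> f i \<in> P"
  shows "sum f A \<in> (P :: ('m \<Rightarrow>\<^sub>0 'k::field) set)"
  using assms(2) by (induction A rule: infinite_finite_induct) (auto intro: prime_facts[OF assms(1)])

lemma power_mem: "x \<in> supp_in T \<Longrightarrow> x ^ n \<in> supp_in T" for x :: "'m \<Rightarrow>\<^sub>0 'k::field"
  by (induction n) (auto intro: one_mem mult_mem)

lemma prod_mem: "(\<And>i. i \<in> A \<Longrightarrow> f i \<in> supp_in T) \<Longrightarrow> prod f A \<in> supp_in T" for f :: "_ \<Rightarrow> ('m \<Rightarrow>\<^sub>0 'k::field)"
  by (induction A rule: infinite_finite_induct) (auto intro: one_mem mult_mem)

lemma const_mem: "single 0 c \<in> supp_in T"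
  by (rule supp_in_single) (rule zero_mem)

text \<open>Consider the term of the relation whose exponent tuple is lexicographically smallest. Modulo \<open>P\<^sub>0\<close> the
  relation can be divided by the smallest power of \<open>x\<^sub>0\<close>, because \<open>x\<^sub>0 \<notin> P\<^sub>0\<close>; modulo \<open>P\<^sub>1\<close> only the terms with this
  power survive, because \<open>x\<^sub>0 \<in> P\<^sub>1\<close>. Continuing like this, \<open>P\<^sub>r\<close> contains the coefficient of that term.\<close>

lemma no_relation_along_chain:
  fixes P :: "nat \<Rightarrow> ('m \<Rightarrow>\<^sub>0 'k::field) set"
  assumes P: "\<And>i. i \<le> r \<Longrightarrow> primeideal (P i) (mono_ring T)" "\<And>i. i < r \<Longrightarrow> P i \<subseteq> P (Suc i)"
    and x: "\<And>i. i < r \<Longrightarrow> x i \<in> P (Suc i)" "\<And>i. i < r \<Longrightarrow> x i \<notin> P i"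
    and F: "finite F" "F \<subseteq> extensional {..<r}" "\<exists>e\<in>F. c e \<noteq> 0"
    and zero: "(\<Sum>e\<in>F. single 0 (c e) * (\<Prod>i\<in>{0..<r}. x i ^ e i)) = 0"
  shows False
proof -
  have xT: "x i \<in> supp_in T" if "i < r" for i using prime_facts(1)[OF P(1)[of "Suc i"]] x(1) that by auto
  define w where "w j e = single 0 (c e) * (\<Prod>i\<in>{j..<r}. x i ^ e i)" for j e
  have wT: "w j e \<in> supp_in T" for j e
    unfolding w_def by (intro mult_mem const_mem prod_mem power_mem xT) auto
  \<comment> \<open>\<open>G\<close> consists of the terms that agree with the lexicographically smallest one in the first \<open>j\<close> exponents.\<close>
  have "\<exists>G\<subseteq>F. G \<noteq> {} \<and> (\<forall>e\<in>G. c e \<noteq> 0) \<and> (\<forall>e\<in>G. \<forall>e'\<in>G. \<forall>i<j. e i = e' i) \<and> (\<Sum>e\<in>G. w j e) \<in> P j" if "j \<le> r" for j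
    using that
  proof (induction j)
    case 0
    define G where "G = {e \<in> F. c e \<noteq> 0}"
    have "(\<Sum>e\<in>G. w 0 e) = (\<Sum>e\<in>F. w 0 e)"
      unfolding G_def using F(1) by (intro sum.mono_neutral_left) (auto simp: w_def)
    also have "\<dots> = 0" using zero by (simp add: w_def)
    finally have "(\<Sum>e\<in>G. w 0 e) \<in> P 0" using prime_facts(2)[OF P(1)[of 0]] by simp
    then show ?case using F(3) by (intro exI[of _ G]) (auto simp: G_def)
  next
    case (Suc j)
    then obtain G where G: "G \<subseteq> F" "G \<noteq> {}" "\<forall>e\<in>G. c e \<noteq> 0" "\<forall>e\<in>G. \<forall>e'\<in>G. \<forall>i<j. e i = e' i"
      "(\<Sum>e\<in>G. w j e) \<in> P j" by auto
    have j: "j < r" using Suc by simp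
    note Pj = prime_facts[OF P(1)[of j]] and PS = prime_facts[OF P(1)[of "Suc j"]]
    have finG: "finite G" using G(1) F(1) finite_subset by blast
    define \<mu> where "\<mu> = Min ((\<lambda>e. e j) ` G)"
    have \<mu>: "\<mu> \<le> e j" if "e \<in> G" for e using that finG by (simp add: \<mu>_def)
    have "\<mu> \<in> (\<lambda>e. e j) ` G" unfolding \<mu>_def using finG G(2) by (intro Min_in) auto
    then obtain e0 where e0: "e0 \<in> G" "e0 j = \<mu>" by auto
    define G' where "G' = {e \<in> G. e j = \<mu>}"
    define t where "t e = x j ^ (e j - \<mu>) * w (Suc j) e" for e
    have "w j e = x j ^ \<mu> * t e" if "e \<in> G" for e
    proof -
      have "{j..<r} = insert j {Suc j..<r}" using j by auto
      then have "w j e = x j ^ e j * w (Suc j) e" by (simp add: w_def mult_ac)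
      also have "x j ^ e j = x j ^ \<mu> * x j ^ (e j - \<mu>)" using \<mu>[OF that] by (simp flip: power_add)
      finally show ?thesis by (simp add: t_def mult_ac)
    qed
    then have "(\<Sum>e\<in>G. w j e) = x j ^ \<mu> * (\<Sum>e\<in>G. t e)" by (simp add: sum_distrib_left)
    then have 1: "x j ^ \<mu> * (\<Sum>e\<in>G. t e) \<in> P j" using G(5) by simp
    have tT: "t e \<in> supp_in T" for e unfolding t_def by (intro mult_mem power_mem xT j wT)
    have "x j ^ k \<notin> P j" for k
    proof (induction k)
      case (Suc k)
      then show ?case using Pj(6)[of "x j" "x j ^ k"] x(2)[OF j] j xT power_mem[OF xT[OF j]] by auto
    qed (use Pj(7) j in simp)
    then have "(\<Sum>e\<in>G. t e) \<in> P j"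
      using Pj(6)[OF _ power_mem[OF xT[OF j]] supp_in_sum[OF tT] 1] j by auto
    then have 2: "(\<Sum>e\<in>G. t e) \<in> P (Suc j)" using P(2)[OF j] by auto
    have "t e \<in> P (Suc j)" if "e \<in> G - G'" for e
    proof -
      have "e j - \<mu> \<noteq> 0" using that \<mu>[of e] by (auto simp: G'_def)
      then obtain k where "e j - \<mu> = Suc k" by (cases "e j - \<mu>") auto
      then have "t e = (x j ^ k * w (Suc j) e) * x j" by (simp add: t_def mult_ac)
      then show ?thesis using PS(5)[OF _ mult_mem[OF power_mem[OF xT[OF j]] wT] x(1)[OF j]] j by auto
    qed
    then have 3: "(\<Sum>e\<in>G - G'. t e) \<in> P (Suc j)" using j by (intro sum_in_prime P(1)) auto
    have "(\<Sum>e\<in>G. t e) = (\<Sum>e\<in>G'. t e) + (\<Sum>e\<in>G - G'. t e)"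
      using finG by (subst sum.subset_diff[of G' G]) (auto simp: G'_def)
    then have "(\<Sum>e\<in>G'. t e) = (\<Sum>e\<in>G. t e) - (\<Sum>e\<in>G - G'. t e)" by simp
    also have "\<dots> \<in> P (Suc j)" using PS(4)[OF _ 2 3] j by simp
    finally have "(\<Sum>e\<in>G'. t e) \<in> P (Suc j)" .
    moreover have "(\<Sum>e\<in>G'. t e) = (\<Sum>e\<in>G'. w (Suc j) e)" by (intro sum.cong) (auto simp: t_def G'_def)
    ultimately have "(\<Sum>e\<in>G'. w (Suc j) e) \<in> P (Suc j)" by simp
    moreover have "\<forall>e\<in>G'. \<forall>e'\<in>G'. \<forall>i<Suc j. e i = e' i" using G(4) by (auto simp: G'_def less_Suc_eq)
    moreover have "G' \<subseteq> F" "G' \<noteq> {}" "\<forall>e\<in>G'. c e \<noteq> 0" using G e0 by (auto simp: G'_def)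
    ultimately show ?case by blast
  qed
  from this[of r] obtain G where G: "G \<subseteq> F" "G \<noteq> {}" "\<forall>e\<in>G. c e \<noteq> 0" "\<forall>e\<in>G. \<forall>e'\<in>G. \<forall>i<r. e i = e' i"
      "(\<Sum>e\<in>G. w r e) \<in> P r" by blast
  obtain e where e: "e \<in> G" using G(2) by auto
  have "e' = e" if "e' \<in> G" for e'
  proof (rule extensionalityI[of _ "{..<r}"])
    show "e' \<in> extensional {..<r}" "e \<in> extensional {..<r}" using that e G(1) F(2) by blast+
    show "e' i = e i" if "i \<in> {..<r}" for i using G(4) \<open>e' \<in> G\<close> e that by blast
  qed
  then have "G = {e}" using e by blast
  then have "single 0 (c e) \<in> P r" using G(5) by (simp add: w_def)
  then have "single 0 (inverse (c e)) * single 0 (c e) \<in> P r"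
    using prime_facts(5)[OF P(1)[of r] const_mem] by simp
  moreover have "single 0 (inverse (c e)) * single 0 (c e) = (1 :: 'm \<Rightarrow>\<^sub>0 'k)"
    using G(3) e by (simp add: mult_single)
  ultimately show False using prime_facts(7)[OF P(1)[of r]] by simp
qed

text \<open>The sets \<open>W n\<close> stand for the monomials of degree at most \<open>n\<close> in each of \<open>b\<close> generators. A power product of
  \<open>b + 1\<close> given elements with exponents up to \<open>N\<close> is supported in \<open>W (c N)\<close> for some constant \<open>c\<close>. There
  are \<open>(N + 1)\<^sup>b\<^sup>+\<^sup>1\<close> of them, which exceeds the dimension of order \<open>N\<^sup>b\<close> available for them when \<open>N\<close> is large. So they are linearly
  dependent, which is a relation as in \<open>no_relation_along_chain\<close>.\<close>

lemma krull_dim_le_generators: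
  fixes g :: "nat \<Rightarrow> 'm" and W :: "nat \<Rightarrow> 'm set"
  assumes W: "\<And>n. finite (W n)" "\<And>n. card (W n) \<le> (n + 1) ^ b" "\<And>m n. m \<le> n \<Longrightarrow> W m \<subseteq> W n"
    "0 \<in> W 0" "\<And>i j m n. m \<in> W i \<Longrightarrow> n \<in> W j \<Longrightarrow> m + n \<in> W (i + j)" "T \<subseteq> (\<Union>n. W n)"
  shows "krull_dim (mono_ring T :: ('m \<Rightarrow>\<^sub>0 'k::field) ring) \<le> enat b"
  unfolding krull_dim_def
proof (intro Sup_least, elim CollectE exE conjE)
  fix n r and P :: "nat \<Rightarrow> ('m \<Rightarrow>\<^sub>0 'k) set"
  assume n: "n = enat r" and P: "\<forall>i\<le>r. primeideal (P i) (mono_ring T)" "\<forall>i<r. P i \<subset> P (Suc i)"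
  have "r \<le> b"
  proof (rule ccontr)
    assume "\<not> r \<le> b"
    define s where "s = Suc b"
    have s: "s \<le> r" using \<open>\<not> r \<le> b\<close> by (simp add: s_def)
    have "\<exists>y. y \<in> P (Suc i) \<and> y \<notin> P i" if "i < s" for i using P(2) that s by (meson less_le_trans psubsetE subsetI)
    then obtain x where x: "\<And>i. i < s \<Longrightarrow> x i \<in> P (Suc i)" "\<And>i. i < s \<Longrightarrow> x i \<notin> P i" by metis
    have "\<exists>D. x i \<in> supp_in (W D)" if "i < s" for i
    proof -
      have "primeideal (P (Suc i)) (mono_ring T)" using P(1) that s by simp
      then have xT: "x i \<in> supp_in T" using prime_facts(1) x(1)[OF that] by blast
      have "\<forall>m\<in>keys (x i). \<exists>k. m \<in> W k" using W(6) xT unfolding supp_in_def by blast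
      then obtain k where k: "\<forall>m\<in>keys (x i). m \<in> W (k m)" by metis
      have "keys (x i) \<subseteq> W (\<Sum>m\<in>keys (x i). k m)"
      proof
        fix m assume m: "m \<in> keys (x i)"
        then have "k m \<le> (\<Sum>m\<in>keys (x i). k m)" by (intro member_le_sum) auto
        then show "m \<in> W (\<Sum>m\<in>keys (x i). k m)" using W(3) k m by blast
      qed
      then show ?thesis by (auto simp: supp_in_def)
    qed
    then obtain Df where Df: "\<And>i. i < s \<Longrightarrow> x i \<in> supp_in (W (Df i))" by metis
    define D where "D = (\<Sum>i<s. Df i)"
    have D: "x i \<in> supp_in (W D)" if "i < s" for i
    proof -
      have "Df i \<le> D" unfolding D_def using that by (intro member_le_sum) auto
      then show ?thesis using Df[OF that] supp_in_mono W(3) by blast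
    qed
    have pow: "x i ^ k \<in> supp_in (W (k * D))" if "i < s" for i k
    proof (induction k)
      case 0
      show ?case using W(4) by (simp add: supp_in_def)
    next
      case (Suc k)
      have "x i * x i ^ k \<in> supp_in (W (D + k * D))" by (rule supp_in_mult[OF D[OF that] Suc W(5)])
      then show ?case by simp
    qed
    \<comment> \<open>\<open>N\<close> is chosen such that \<open>(s N D + 1)\<^sup>b \<le> (K (N + 1))\<^sup>b = N (N + 1)\<^sup>b < (N + 1)\<^sup>b\<^sup>+\<^sup>1\<close>.\<close>
    define K where "K = s * D + 1"
    define N where "N = K ^ b"
    define F where "F = PiE {..<s} (\<lambda>_. {..N})"
    define w where "w e = (\<Prod>i\<in>{0..<s}. x i ^ e i)" for e
    have w: "w e \<in> supp_in (W (s * (N * D)))" if "e \<in> F" for e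
    proof -
      have "(\<Prod>i\<in>{0..<k}. x i ^ e i) \<in> supp_in (W (k * (N * D)))" if "k \<le> s" for k
        using that
      proof (induction k)
        case 0
        show ?case using W(4) by (simp add: supp_in_def)
      next
        case (Suc k)
        have "e k \<le> N" using PiE_mem[OF \<open>e \<in> F\<close>[unfolded F_def], of k] Suc.prems by simp
        then have "W (e k * D) \<subseteq> W (N * D)" by (intro W(3) mult_right_mono) auto
        moreover have "x k ^ e k \<in> supp_in (W (e k * D))" using pow Suc.prems by simp
        ultimately have x: "x k ^ e k \<in> supp_in (W (N * D))" by (rule supp_in_mono)
        have IH: "(\<Prod>i\<in>{0..<k}. x i ^ e i) \<in> supp_in (W (k * (N * D)))" using Suc by simp
        have "(\<Prod>i\<in>{0..<k}. x i ^ e i) * x k ^ e k \<in> supp_in (W (k * (N * D) + N * D))"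
          by (rule supp_in_mult[OF IH x W(5)])
        then show ?case by (simp add: add.commute)
      qed
      then show ?thesis by (simp add: w_def)
    qed
    have "card (W (s * (N * D))) \<le> (s * (N * D) + 1) ^ b" by (rule W(2))
    also have "\<dots> \<le> (K * (N + 1)) ^ b" by (intro power_mono) (auto simp: K_def algebra_simps)
    also have "\<dots> = N * (N + 1) ^ b" unfolding N_def by (rule power_mult_distrib)
    also have "\<dots> < (N + 1) ^ s" by (simp add: s_def)
    also have "\<dots> = card F" by (simp add: F_def card_PiE)
    finally have card: "card (W (s * (N * D))) < card F" .
    have finF: "finite F" by (auto simp: F_def intro: finite_PiE)
    have "\<exists>c. (\<exists>e\<in>F. c e \<noteq> 0) \<and> (\<Sum>e\<in>F. single 0 (c e) * w e) = 0"
      by (rule dependent_polys[OF W(1) finF card w])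
    then obtain c where c: "\<exists>e\<in>F. c e \<noteq> 0" "(\<Sum>e\<in>F. single 0 (c e) * w e) = 0"
      by (elim exE conjE)
    show False
    proof (rule no_relation_along_chain[of s P x F c])
      show "F \<subseteq> extensional {..<s}" by (auto simp: F_def PiE_def)
      show "primeideal (P i) (mono_ring T)" if "i \<le> s" for i using P(1) that s by simp
      show "P i \<subseteq> P (Suc i)" if "i < s" for i using P(2) that s by (simp add: psubset_imp_subset)
      show "(\<Sum>e\<in>F. single 0 (c e) * (\<Prod>i\<in>{0..<s}. x i ^ e i)) = 0"
        using c(2) unfolding w_def .
    qed (fact x finF c)+
  qed
  then show "n \<le> enat b" by (simp add: n)
qed

end

text \<open>The quotient is the subalgebra of the monomials free of the variables in \<open>W\<close>, a domain.\<close>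

lemma primeideal_variables:
  assumes "exp_monoid T"
  shows "primeideal (supp_in {m \<in> T. keys m \<inter> W \<noteq> {}}) (mono_ring T :: 'k::field mpoly ring)"
proof -
  interpret exp_monoid T by fact
  let ?A = "{m \<in> T. keys m \<inter> W \<noteq> {}}" and ?B = "{m. keys m \<inter> W = {}}"
  show ?thesis
  proof (rule primeidealI)
    show "ideal (supp_in ?A) (mono_ring T :: 'k mpoly ring)"
      by (rule ideal_supp_in) (auto simp: add_mem keys_add_exp)
    show "cring (mono_ring T :: 'k mpoly ring)" by (rule cring_mono_ring)
    have "(1 :: 'k mpoly) \<notin> supp_in ?A" by (simp add: supp_in_def)
    then show "carrier (mono_ring T :: 'k mpoly ring) \<noteq> supp_in ?A"
      using one_mem[where 'k = 'k] by (metis mono_ring_simps(1))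
    fix p q :: "'k mpoly"
    assume pq: "p \<in> carrier (mono_ring T)" "q \<in> carrier (mono_ring T)" "p \<otimes>\<^bsub>mono_ring T\<^esub> q \<in> supp_in ?A"
    define p0 where "p0 = part ?B p" define q0 where "q0 = part ?B q"
    define p1 where "p1 = part (- ?B) p" define q1 where "q1 = part (- ?B) q"
    have dec: "p = p0 + p1" "q = q0 + q1"
      by (rule poly_mapping_eqI; simp add: lookup_add lookup_part p0_def p1_def q0_def q1_def)+
    have supp: "p0 \<in> supp_in ?B" "q0 \<in> supp_in ?B" "p1 \<in> supp_in (- ?B)" "q1 \<in> supp_in (- ?B)"
      by (auto simp: supp_in_iff lookup_part p0_def p1_def q0_def q1_def)
    have U: "r \<in> supp_in UNIV" for r :: "'k mpoly" by (simp add: supp_in_def)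
    have "p0 * q0 \<in> supp_in ?B" by (rule supp_in_mult[OF supp(1,2)]) (auto simp: keys_add_exp)
    moreover have "p1 * q \<in> supp_in (- ?B)" "q1 * p0 \<in> supp_in (- ?B)"
      by (rule supp_in_mult[OF supp(3) U] supp_in_mult[OF supp(4) U]; auto simp: keys_add_exp)+
    moreover have "p * q \<in> supp_in (- ?B)" using pq(3) by (auto simp: supp_in_def)
    moreover have "p0 * q0 = p * q - p1 * q - q1 * p0" by (simp add: dec algebra_simps)
    ultimately have "p0 * q0 \<in> supp_in ?B" "p0 * q0 \<in> supp_in (- ?B)" using supp_in_diff by metis+
    then have "p0 * q0 = 0" by (rule supp_in_disjoint)
    then have "p0 = 0 \<or> q0 = 0" by simp
    then have "p \<in> supp_in (- ?B) \<or> q \<in> supp_in (- ?B)" using dec supp by auto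
    then show "p \<in> supp_in ?A \<or> q \<in> supp_in ?A" using pq(1,2) by (auto simp: supp_in_def)
  qed
qed

context broom
begin

text \<open>The submonoid generated by the edges. Exponents multiply by convolution, and the product with
  \<open>of_nat n\<close> is the \<open>n\<close>-fold sum.\<close>

definition edge_monoid :: "(nat \<Rightarrow>\<^sub>0 nat) set" where
  "edge_monoid = {m. \<exists>c. m = (\<Sum>i\<in>{1..b}. of_nat (c i) * ed i)}"

lemma exp_monoid_edge_monoid: "exp_monoid edge_monoid"
proof
  show "0 \<in> edge_monoid" unfolding edge_monoid_def by (intro CollectI exI[of _ "\<lambda>_. 0"]) simp
  fix m n assume "m \<in> edge_monoid" "n \<in> edge_monoid"
  then obtain c d where "m = (\<Sum>i\<in>{1..b}. of_nat (c i) * ed i)" "n = (\<Sum>i\<in>{1..b}. of_nat (d i) * ed i)" by (auto simp: edge_monoid_def)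
  then have "m + n = (\<Sum>i\<in>{1..b}. of_nat (c i + d i) * ed i)" by (simp add: sum.distrib distrib_right)
  then show "m + n \<in> edge_monoid" unfolding edge_monoid_def by (intro CollectI exI[of _ "\<lambda>i. c i + d i"])
qed

lemma krull_dim_edge_ring_le: "krull_dim (mono_ring edge_monoid :: 'k::field mpoly ring) \<le> enat b"
proof -
  define W where "W n = (\<lambda>c. \<Sum>i\<in>{1..b}. of_nat (c i) * ed i) ` PiE {1..b} (\<lambda>_. {..n})" for n :: nat
  have W_I: "(\<Sum>i\<in>{1..b}. of_nat (c i) * ed i) \<in> W n" if "\<And>i. i \<in> {1..b} \<Longrightarrow> c i \<le> n" for c n
  proof -
    have "(\<Sum>i\<in>{1..b}. of_nat (c i) * ed i) = (\<Sum>i\<in>{1..b}. of_nat (restrict c {1..b} i) * ed i)"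
      by (intro sum.cong) auto
    moreover have "restrict c {1..b} \<in> PiE {1..b} (\<lambda>_. {..n})" using that by auto
    ultimately show ?thesis unfolding W_def by blast
  qed
  show ?thesis
  proof (rule exp_monoid.krull_dim_le_generators[OF exp_monoid_edge_monoid, of W])
    show "finite (W n)" for n unfolding W_def by (intro finite_imageI finite_PiE) auto
    show "card (W n) \<le> (n + 1) ^ b" for n
    proof -
      have "card (W n) \<le> card (PiE {1..b} (\<lambda>_. {..n}))" unfolding W_def by (intro card_image_le finite_PiE) auto
      then show ?thesis by (simp add: card_PiE)
    qed
    show "W m \<subseteq> W n" if "m \<le> n" for m n
      unfolding W_def using that by (intro image_mono PiE_mono) auto
    show "0 \<in> W 0" using W_I[of "\<lambda>_. 0" 0] by simp
    show "m + n \<in> W (i + j)" if "m \<in> W i" "n \<in> W j" for i j m n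
    proof -
      obtain c d where c: "c \<in> PiE {1..b} (\<lambda>_. {..i})" "m = (\<Sum>i\<in>{1..b}. of_nat (c i) * ed i)"
        and d: "d \<in> PiE {1..b} (\<lambda>_. {..j})" "n = (\<Sum>i\<in>{1..b}. of_nat (d i) * ed i)"
        using \<open>m \<in> W i\<close> \<open>n \<in> W j\<close> unfolding W_def by auto
      have "m + n = (\<Sum>i\<in>{1..b}. of_nat (c i + d i) * ed i)" by (simp add: c d sum.distrib distrib_right)
      moreover have "c l + d l \<le> i + j" if "l \<in> {1..b}" for l
        using PiE_mem[OF c(1) that] PiE_mem[OF d(1) that] by simp
      ultimately show ?thesis using W_I[of "\<lambda>i. c i + d i" "i + j"] by simp
    qed
    show "edge_monoid \<subseteq> (\<Union>n. W n)"
    proof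
      fix m assume "m \<in> edge_monoid"
      then obtain c where c: "m = (\<Sum>i\<in>{1..b}. of_nat (c i) * ed i)" by (auto simp: edge_monoid_def)
      have "m \<in> W (\<Sum>i\<in>{1..b}. c i)" unfolding c by (rule W_I) (intro member_le_sum, auto)
      then show "m \<in> (\<Union>n. W n)" by blast
    qed
  qed
qed

lemma ed_mem_edge_monoid:
  assumes "i \<in> {1..b}"
  shows "ed i \<in> edge_monoid"
proof -
  have "(\<Sum>j\<in>{1..b}. of_nat (if j = i then 1 else 0) * ed j) = (\<Sum>j\<in>{1..b}. if j = i then ed j else 0)"
    by (intro sum.cong) auto
  also have "\<dots> = ed i" using assms by simp
  finally show ?thesis unfolding edge_monoid_def by (intro CollectI exI[of _ "\<lambda>j. if j = i then 1 else 0"]) simp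
qed

text \<open>The edge \<open>i + 1\<close> contains the vertex \<open>i + 1\<close> but none of \<open>1, \<dots>, i\<close>, so that contracting the ideals
  \<open>(x\<^sub>1, \<dots>, x\<^sub>i)\<close> gives a strictly increasing chain of \<open>b + 1\<close> primes.\<close>

lemma krull_dim_edge_ring: "krull_dim (mono_ring edge_monoid :: 'k::field mpoly ring) = enat b"
proof (rule antisym[OF krull_dim_edge_ring_le])
  define P :: "nat \<Rightarrow> 'k mpoly set" where "P i = supp_in {m \<in> edge_monoid. keys m \<inter> {1..i} \<noteq> {}}" for i
  have "primeideal (P i) (mono_ring edge_monoid)" for i unfolding P_def by (rule primeideal_variables[OF exp_monoid_edge_monoid])
  moreover have "P i \<subset> P (Suc i)" if "i < b" for i
  proof
    show "P i \<subseteq> P (Suc i)" unfolding P_def by (intro subsetI, erule supp_in_mono[rotated]) auto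
    have keys: "keys (ed j) = {j, parent j}" for j by (auto simp: in_keys_iff lookup_ed split: if_splits)
    let ?e = "single (ed (Suc i)) (1 :: 'k)"
    have "?e \<in> P (Suc i)" unfolding P_def using that ed_mem_edge_monoid[of "Suc i"] by (intro supp_in_single) (auto simp: keys)
    moreover have "?e \<notin> P i" using parent_gt[of "Suc i"] by (auto simp: P_def supp_in_def keys)
    ultimately show "P i \<noteq> P (Suc i)" by blast
  qed
  ultimately show "enat b \<le> krull_dim (mono_ring edge_monoid :: 'k mpoly ring)"
    unfolding krull_dim_def by (intro Sup_upper) blast
qed

end

section \<open>The fibre ring of the edge ideal of a broom\<close>

context broom
begin

lemma wdeg_V_ed: "i \<in> {1..b} \<Longrightarrow> wdeg V (ed i) = 2"
  using parent_le[of i] parent_gt[of i] by (auto simp: ed_def wdeg_add wdeg_single)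

lemma wdeg_V_pow: "m \<in> pow_exps E k \<Longrightarrow> 2 * k \<le> wdeg V m"
proof (induction k arbitrary: m)
  case (Suc k)
  then obtain e n where m: "m = e + n" "e \<in> E" "n \<in> pow_exps E k" by auto
  then have "wdeg V e = 2" using wdeg_V_ed by blast
  then show ?case using Suc.IH[OF m(3)] by (simp add: m(1) wdeg_add)
qed simp

lemma wdeg_V_0: "m \<in> exps V \<Longrightarrow> wdeg V m = 0 \<Longrightarrow> m = 0"
proof (rule poly_mapping_eqI)
  fix v assume m: "m \<in> exps V" "wdeg V m = 0"
  show "lookup m v = lookup 0 v"
  proof (cases "v \<in> V")
    case False
    then have "v \<notin> keys m" using m(1) unfolding exps_def by blast
    then show ?thesis by (simp add: in_keys_iff)
  next
    case True
    have "\<forall>i\<in>V. lookup m i = 0"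
      using m(2) by (simp only: wdeg_def sum_eq_0_iff finite_atLeastAtMost)
    then show ?thesis using True by (metis lookup_zero)
  qed
qed

text \<open>The exponents of the minimal generators of \<open>I\<^sup>k\<close>: all products of \<open>k\<close> edges have the same degree \<open>2k\<close>, the
  least one in \<open>I\<^sup>k\<close>.\<close>

definition top_exps :: "nat \<Rightarrow> (nat \<Rightarrow>\<^sub>0 nat) set" where
  "top_exps k = {m \<in> exps V \<inter> pow_exps E k. wdeg V m = 2 * k}"

lemma top_exps_in_edge_monoid: "m \<in> top_exps k \<Longrightarrow> m \<in> edge_monoid"
proof (induction k arbitrary: m)
  case 0
  then show ?case using wdeg_V_0 exp_monoid.zero_mem[OF exp_monoid_edge_monoid] by (auto simp: top_exps_def)
next
  case (Suc k)
  then obtain e n where m: "m = e + n" "e \<in> E" "n \<in> pow_exps E k" by (auto simp: top_exps_def)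
  have "wdeg V e = 2" using m(2) wdeg_V_ed by blast
  then have "n \<in> top_exps k" using Suc.prems m by (auto simp: top_exps_def wdeg_add)
  then have "n \<in> edge_monoid" by (rule Suc.IH)
  moreover have "e \<in> edge_monoid" using m(2) ed_mem_edge_monoid by blast
  ultimately show ?case unfolding m(1) by (intro exp_monoid.add_mem[OF exp_monoid_edge_monoid])
qed

lemma top_exps_add: "m \<in> top_exps k \<Longrightarrow> n \<in> top_exps l \<Longrightarrow> m + n \<in> top_exps (k + l)"
  unfolding top_exps_def using pow_exps_plus by (auto simp: wdeg_add)

lemma top_exps_0: "0 \<in> top_exps 0"
  by (simp add: top_exps_def wdeg_def)

lemma edge_monoid_in_top_exps: "m \<in> edge_monoid \<Longrightarrow> \<exists>k. m \<in> top_exps k"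
proof -
  assume "m \<in> edge_monoid"
  then obtain c where m: "m = (\<Sum>i\<in>{1..b}. of_nat (c i) * ed i)" by (auto simp: edge_monoid_def)
  have ed: "ed i \<in> top_exps 1" if "i \<in> {1..b}" for i
  proof -
    have "ed i + 0 \<in> pow_exps E (Suc 0)" by (rule pow_exps_SucI) (use that in auto)
    moreover have "ed i \<in> exps V" using that E_exps by blast
    ultimately show ?thesis using wdeg_V_ed[OF that] by (simp add: top_exps_def del: pow_exps.simps)
  qed
  have mult: "\<exists>k. of_nat n * ed i \<in> top_exps k" if "i \<in> {1..b}" for n i
  proof (induction n)
    case 0
    then show ?case using top_exps_0 by auto
  next
    case (Suc n)
    then show ?case using top_exps_add[OF ed[OF that]] by (auto simp: distrib_right)
  qed
  have "\<exists>k. (\<Sum>i\<in>I. of_nat (c i) * ed i) \<in> top_exps k" if "finite I" "I \<subseteq> {1..b}" for I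
    using that
  proof (induction I rule: finite_induct)
    case empty
    then show ?case using top_exps_0 by auto
  next
    case (insert i I)
    then obtain k l where "of_nat (c i) * ed i \<in> top_exps k" "(\<Sum>i\<in>I. of_nat (c i) * ed i) \<in> top_exps l"
      using mult[of i "c i"] by auto
    then have "of_nat (c i) * ed i + (\<Sum>i\<in>I. of_nat (c i) * ed i) \<in> top_exps (k + l)" by (rule top_exps_add)
    then show ?case using insert.hyps by auto
  qed
  then show ?thesis unfolding m by blast
qed

definition top_part :: "nat \<Rightarrow> 'k::field mpoly \<Rightarrow> 'k mpoly" where
  "top_part k p = part {m. wdeg V m = 2 * k} p"

lemma top_part_mem: "p \<in> J k \<Longrightarrow> top_part k p \<in> supp_in (top_exps k)"
  unfolding top_part_def using part_supp[of p "exps V \<inter> pow_exps E k" "{m. wdeg V m = 2 * k}"]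
  by (rule supp_in_mono[rotated]) (auto simp: top_exps_def)

lemma top_part_add: "top_part k (p + q) = top_part k p + top_part k q"
  by (simp add: top_part_def part_add)

text \<open>The components of degree \<open>2i\<close> and \<open>2j\<close> are the ones of least degree in \<open>I\<^sup>i\<close> and \<open>I\<^sup>j\<close>, so no others
  contribute to degree \<open>2(i + j)\<close> of a product.\<close>

lemma top_part_mult:
  fixes p q :: "'k::field mpoly"
  assumes "p \<in> J i" "q \<in> J j"
  shows "top_part (i + j) (p * q) = top_part i p * top_part j q"
proof -
  let ?H = "\<lambda>k. {m. wdeg V m = 2 * k}" and ?G = "\<lambda>k. {m. 2 * k < wdeg V m}" and ?L = "\<lambda>k. {m. 2 * k \<le> wdeg V m}"
  have JL: "r \<in> supp_in (?L k)" if "r \<in> J k" for r :: "'k mpoly" and k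
    using that wdeg_V_pow by (auto simp: supp_in_def)
  have rest: "r - top_part k r \<in> supp_in (?G k)" if "r \<in> J k" for r :: "'k mpoly" and k
    using JL[OF that] unfolding supp_in_iff top_part_def by (auto simp: lookup_minus lookup_part)
  have top: "top_part k r \<in> supp_in (?H k)" for r :: "'k mpoly" and k
    unfolding top_part_def by (rule part_in)
  have 1: "top_part i p * top_part j q \<in> supp_in (?H (i + j))"
    by (rule supp_in_mult[OF top top]) (simp add: wdeg_add)
  have "top_part i p * (q - top_part j q) \<in> supp_in (?G (i + j))"
    by (rule supp_in_mult[OF top rest[OF assms(2)]]) (simp add: wdeg_add)
  moreover have "(p - top_part i p) * q \<in> supp_in (?G (i + j))"
    by (rule supp_in_mult[OF rest[OF assms(1)] JL[OF assms(2)]]) (simp add: wdeg_add)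
  ultimately have 2: "top_part i p * (q - top_part j q) + (p - top_part i p) * q \<in> supp_in (?G (i + j))"
    by (rule supp_in_add)
  have "p * q = top_part i p * top_part j q + (top_part i p * (q - top_part j q) + (p - top_part i p) * q)"
    by (simp add: algebra_simps)
  then have "top_part (i + j) (p * q) = top_part (i + j) (top_part i p * top_part j q)
     + top_part (i + j) (top_part i p * (q - top_part j q) + (p - top_part i p) * q)"
    by (simp only: top_part_add[symmetric])
  also have "top_part (i + j) (top_part i p * top_part j q) = top_part i p * top_part j q"
    using part_id[OF 1] by (simp add: top_part_def)
  also have "top_part (i + j) (top_part i p * (q - top_part j q) + (p - top_part i p) * q) = 0"
    unfolding top_part_def[of "i + j"] by (rule part_disjoint[OF 2]) auto
  finally show ?thesis by simp
qed

lemma top_part_zero [simp]: "top_part k 0 = 0"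
  by (simp add: top_part_def part_def)

definition rees_carrier :: "(nat \<Rightarrow> 'k::field mpoly) set" where
  "rees_carrier = {p. (\<forall>k. p k \<in> J k) \<and> (\<exists>n. \<forall>k>n. p k = 0)}"

abbreviation RR :: "('k::field mpoly, nat \<Rightarrow> 'k mpoly) up_ring" where
  "RR \<equiv> rees_ring S (J 1)"

lemma J_sub: "p \<in> J k \<Longrightarrow> p \<in> supp_in (exps V)"
  by (rule supp_in_mono[rotated]) auto

lemma rees_coeff:
  assumes "p \<in> rees_carrier"
  shows "p k \<in> supp_in (exps V)"
proof (rule J_sub)
  show "p k \<in> J k" using assms unfolding rees_carrier_def by blast
qed

lemma rees_carrier_up: "p \<in> rees_carrier \<Longrightarrow> p \<in> up S"
  using J_sub by (fastforce simp: rees_carrier_def up_def mpoly_ring_eq bound_def)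

lemma carrier_rees: "carrier RR = (rees_carrier :: (nat \<Rightarrow> 'k::field mpoly) set)"
proof (intro equalityI subsetI)
  fix p :: "nat \<Rightarrow> 'k mpoly" assume "p \<in> carrier RR"
  then have "p \<in> up S" "\<forall>k. p k \<in> J k"
    by (auto simp: rees_ring_def UP_def ideal_pow_monomials[OF E_exps] simp del: pow_exps.simps One_nat_def)
  then show "p \<in> rees_carrier" by (auto simp: rees_carrier_def up_def bound_def mpoly_ring_eq)
next
  fix p :: "nat \<Rightarrow> 'k mpoly" assume p: "p \<in> rees_carrier"
  then show "p \<in> carrier RR" using rees_carrier_up[OF p]
    by (auto simp: rees_carrier_def rees_ring_def UP_def ideal_pow_monomials[OF E_exps] simp del: pow_exps.simps One_nat_def)
qed

lemma rees_add: "p \<in> rees_carrier \<Longrightarrow> q \<in> rees_carrier \<Longrightarrow> p \<oplus>\<^bsub>RR\<^esub> q = (\<lambda>i. p i + q i)"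
  using rees_carrier_up[of p] rees_carrier_up[of q] by (simp add: rees_ring_def UP_def mpoly_ring_eq)

lemma rees_mult:
  assumes "p \<in> rees_carrier" "q \<in> rees_carrier"
  shows "p \<otimes>\<^bsub>RR\<^esub> q = (\<lambda>n. \<Sum>i\<le>n. p i * q (n - i))"
proof
  fix n
  have "(p \<otimes>\<^bsub>RR\<^esub> q) n = (\<Oplus>\<^bsub>S\<^esub>i\<in>{..n}. p i \<otimes>\<^bsub>S\<^esub> q (n - i))"
    using rees_carrier_up[OF assms(1)] rees_carrier_up[OF assms(2)] by (simp add: rees_ring_def UP_def)
  also have "\<dots> = (\<Sum>i\<le>n. p i * q (n - i))"
  proof -
    have "(\<lambda>i. p i * q (n - i)) \<in> {..n} \<rightarrow> supp_in (exps V)"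
      by (intro funcsetI exp_monoid.mult_mem[OF exp_monoid_exps] rees_coeff assms)
    then show ?thesis using finsum_mono_ring[OF exp_monoid_exps] by (simp add: mpoly_ring_eq)
  qed
  finally show "(p \<otimes>\<^bsub>RR\<^esub> q) n = (\<Sum>i\<le>n. p i * q (n - i))" .
qed

lemma rees_zero: "\<zero>\<^bsub>RR\<^esub> = (\<lambda>_. 0)"
  by (simp add: rees_ring_def UP_def mpoly_ring_eq)

lemma rees_one: "\<one>\<^bsub>RR\<^esub> = (\<lambda>i. if i = 0 then 1 else 0)"
  by (simp add: rees_ring_def UP_def mpoly_ring_eq cong: if_cong)

lemma J_mult: "p \<in> J i \<Longrightarrow> q \<in> J j \<Longrightarrow> p * q \<in> J (i + j)"
  by (erule supp_in_mult, assumption) (auto intro: pow_exps_plus)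

lemma rees_add_closed: "p \<in> rees_carrier \<Longrightarrow> q \<in> rees_carrier \<Longrightarrow> (\<lambda>i. p i + q i) \<in> rees_carrier"
proof -
  assume p: "p \<in> rees_carrier" and q: "q \<in> rees_carrier"
  then obtain n n' where "\<forall>k>n. p k = 0" "\<forall>k>n'. q k = 0" by (auto simp: rees_carrier_def)
  then have "\<forall>k>max n n'. p k + q k = 0" by simp
  moreover have "p k + q k \<in> J k" for k
    by (rule supp_in_add) (use p q in \<open>simp_all only: rees_carrier_def mem_Collect_eq\<close>)
  ultimately show ?thesis unfolding rees_carrier_def by blast
qed

lemma rees_mult_closed: "p \<in> rees_carrier \<Longrightarrow> q \<in> rees_carrier \<Longrightarrow> (\<lambda>n. \<Sum>i\<le>n. p i * q (n - i)) \<in> rees_carrier"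
proof -
  assume p: "p \<in> rees_carrier" and q: "q \<in> rees_carrier"
  then obtain n n' where n: "\<forall>k>n. p k = 0" "\<forall>k>n'. q k = 0" by (auto simp: rees_carrier_def)
  have "(\<Sum>i\<le>k. p i * q (k - i)) = 0" if "k > n + n'" for k
  proof (rule sum.neutral, rule ballI)
    fix i
    have "i > n \<or> k - i > n'" using that by auto
    then show "p i * q (k - i) = 0" using n by auto
  qed
  moreover have "(\<Sum>i\<le>k. p i * q (k - i)) \<in> J k" for k
  proof (rule supp_in_sum)
    fix i assume "i \<in> {..k}"
    then show "p i * q (k - i) \<in> J k" using J_mult[of "p i" i "q (k - i)" "k - i"] p q
      by (simp add: rees_carrier_def del: pow_exps.simps)
  qed
  ultimately show ?thesis unfolding rees_carrier_def by blast
qed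

lemma rees_cring: "cring (RR :: ('k::field mpoly, nat \<Rightarrow> 'k mpoly) up_ring)"
proof -
  interpret S: cring "S :: 'k mpoly ring" by (rule S_cring)
  interpret UP: UP_cring "S :: 'k mpoly ring" "UP S" by unfold_locales simp
  let ?UP = "UP (S :: 'k mpoly ring)"
  have RR: "RR = (?UP)\<lparr>carrier := rees_carrier\<rparr>" using carrier_rees[where 'k = 'k] by (simp add: rees_ring_def)
  have up: "carrier (?UP) = up S" by (simp add: UP_def)
  have "subring rees_carrier (?UP)"
  proof (rule UP.P.subringI)
    show "rees_carrier \<subseteq> carrier (?UP)" using rees_carrier_up up by auto
    show "\<one>\<^bsub>?UP\<^esub> \<in> rees_carrier"
      using exp_monoid.one_mem[OF exp_monoid_exps]
      by (auto simp: UP_def mpoly_ring_eq rees_carrier_def cong: if_cong)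
    fix p q :: "nat \<Rightarrow> 'k mpoly" assume p: "p \<in> rees_carrier" and q: "q \<in> rees_carrier"
    show "p \<oplus>\<^bsub>?UP\<^esub> q \<in> rees_carrier" using rees_add_closed[OF p q] rees_add[OF p q] by (simp add: rees_ring_def)
    show "p \<otimes>\<^bsub>?UP\<^esub> q \<in> rees_carrier" using rees_mult_closed[OF p q] rees_mult[OF p q] by (simp add: rees_ring_def)
  next
    fix p :: "nat \<Rightarrow> 'k mpoly" assume p: "p \<in> rees_carrier"
    have pc: "p \<in> carrier (?UP)" using rees_carrier_up[OF p] up by simp
    have "(\<lambda>i. - p i) \<in> rees_carrier" using p by (simp add: rees_carrier_def)
    moreover have "\<ominus>\<^bsub>?UP\<^esub> p = (\<lambda>i. - p i)"
    proof (rule UP.P.minus_equality[OF _ pc])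
      show "(\<lambda>i. - p i) \<in> carrier ?UP" using rees_carrier_up[OF calculation] up by simp
      have "(\<lambda>i. - p i) \<oplus>\<^bsub>RR\<^esub> p = (\<lambda>_. 0)" using rees_add[OF calculation p] by simp
      moreover have "\<zero>\<^bsub>?UP\<^esub> = (\<lambda>_. 0)" by (simp add: UP_def mpoly_ring_eq)
      ultimately show "(\<lambda>i. - p i) \<oplus>\<^bsub>?UP\<^esub> p = \<zero>\<^bsub>?UP\<^esub>" by (simp add: rees_ring_def)
    qed
    ultimately show "\<ominus>\<^bsub>?UP\<^esub> p \<in> rees_carrier" by simp
  qed
  then have "subcring rees_carrier (?UP)" by (rule UP.P.subcringI')
  then show ?thesis unfolding RR using UP.P.subcring_iff rees_carrier_up up by (metis subsetI)
qed

text \<open>The components of degree \<open>2k\<close> for different \<open>k\<close> do not interfere, so they can be collected in one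
  polynomial: the Rees degree is recovered as half of the degree.\<close>

definition initial :: "(nat \<Rightarrow> 'k::field mpoly) \<Rightarrow> 'k mpoly" where
  "initial p = (\<Sum>k\<in>{k. p k \<noteq> 0}. top_part k (p k))"

lemma initial_bound: "\<forall>k>n. p k = 0 \<Longrightarrow> initial p = (\<Sum>k\<le>n. top_part k (p k))"
  unfolding initial_def by (rule sum.mono_neutral_left) (auto intro: leI)

lemma lookup_initial:
  assumes "p \<in> rees_carrier" "wdeg V m = 2 * k"
  shows "lookup (initial p) m = lookup (p k) m"
proof -
  obtain n where n: "\<forall>k>n. p k = 0" using assms(1) by (auto simp: rees_carrier_def)
  have "lookup (initial p) m = (\<Sum>j\<le>n. if j = k then lookup (p j) m else 0)"
    unfolding initial_bound[OF n] lookup_sum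
    using assms(2) by (intro sum.cong) (auto simp: top_part_def lookup_part)
  then show ?thesis using n by (auto simp: not_le)
qed

lemma initial_mem: "p \<in> rees_carrier \<Longrightarrow> initial p \<in> supp_in edge_monoid"
  unfolding initial_def
proof (rule supp_in_sum)
  fix k assume "p \<in> rees_carrier"
  then have "top_part k (p k) \<in> supp_in (top_exps k)" by (intro top_part_mem) (simp add: rees_carrier_def)
  then show "top_part k (p k) \<in> supp_in edge_monoid" by (rule supp_in_mono[rotated]) (use top_exps_in_edge_monoid in auto)
qed

lemma initial_hom: "initial \<in> ring_hom RR (mono_ring edge_monoid :: 'k::field mpoly ring)"
proof (rule ring_hom_memI)
  fix p q :: "nat \<Rightarrow> 'k mpoly" assume "p \<in> carrier RR" "q \<in> carrier RR"
  then have p: "p \<in> rees_carrier" and q: "q \<in> rees_carrier" by (simp_all only: carrier_rees)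
  show "initial p \<in> carrier (mono_ring edge_monoid)" using initial_mem[OF p] by simp
  obtain n where n: "\<forall>k>n. p k = 0" using p by (auto simp: rees_carrier_def)
  obtain n' where n': "\<forall>k>n'. q k = 0" using q by (auto simp: rees_carrier_def)
  have "\<forall>k>max n n'. p k + q k = 0" "\<forall>k>max n n'. p k = 0" "\<forall>k>max n n'. q k = 0" using n n' by auto
  then show "initial (p \<oplus>\<^bsub>RR\<^esub> q) = initial p \<oplus>\<^bsub>mono_ring edge_monoid\<^esub> initial q"
    using initial_bound[of "max n n'" p] initial_bound[of "max n n'" q] initial_bound[of "max n n'" "\<lambda>i. p i + q i"]
    unfolding rees_add[OF p q] by (simp add: top_part_def part_add sum.distrib)
  \<comment> \<open>The Cauchy product of two finite sums is that of polynomials, evaluated at 1.\<close>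
  have "initial p * initial q = (\<Sum>i\<le>n. top_part i (p i) * 1 ^ i) * (\<Sum>j\<le>n'. top_part j (q j) * 1 ^ j)"
    by (simp add: initial_bound[OF n] initial_bound[OF n'])
  also have "\<dots> = (\<Sum>r\<le>n + n'. (\<Sum>k\<le>r. top_part k (p k) * top_part (r - k) (q (r - k))) * 1 ^ r)"
    by (rule polynomial_product) (use n n' in auto)
  also have "\<dots> = (\<Sum>r\<le>n + n'. top_part r (\<Sum>k\<le>r. p k * q (r - k)))"
  proof (rule sum.cong[OF refl])
    fix r
    have "top_part k (p k) * top_part (r - k) (q (r - k)) = top_part r (p k * q (r - k))" if "k \<le> r" for k
      using top_part_mult[of "p k" k "q (r - k)" "r - k"] p q that by (simp add: rees_carrier_def)
    then show "(\<Sum>k\<le>r. top_part k (p k) * top_part (r - k) (q (r - k))) * 1 ^ r = top_part r (\<Sum>k\<le>r. p k * q (r - k))"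
      by (simp add: top_part_def part_sum)
  qed
  also have "\<dots> = initial (\<lambda>r. \<Sum>k\<le>r. p k * q (r - k))"
  proof (rule initial_bound[symmetric], intro allI impI sum.neutral ballI)
    fix r k assume "n + n' < r"
    then have "k > n \<or> r - k > n'" by auto
    then show "p k * q (r - k) = 0" using n n' by auto
  qed
  finally show "initial (p \<otimes>\<^bsub>RR\<^esub> q) = initial p \<otimes>\<^bsub>mono_ring edge_monoid\<^esub> initial q"
    unfolding rees_mult[OF p q] by simp
next
  have "(1 :: 'k mpoly) \<in> supp_in {m. wdeg V m = 0}" by (simp add: supp_in_def wdeg_def)
  then have "top_part 0 (1 :: 'k mpoly) = 1" by (simp add: top_part_def part_id)
  moreover have "initial (\<lambda>i. if i = 0 then 1 else 0) = (\<Sum>k\<le>0. top_part k (if k = 0 then 1 else 0 :: 'k mpoly))"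
    by (rule initial_bound) simp
  ultimately have "initial (\<lambda>i. if i = 0 then 1 else 0) = (1 :: 'k mpoly)" by simp
  then show "initial \<one>\<^bsub>RR\<^esub> = \<one>\<^bsub>mono_ring edge_monoid :: 'k mpoly ring\<^esub>" unfolding rees_one mono_ring_simps .
qed

lemma initial_surj: "initial ` carrier RR = carrier (mono_ring edge_monoid :: 'k::field mpoly ring)"
proof (intro equalityI subsetI)
  fix q :: "'k mpoly" assume "q \<in> initial ` carrier RR"
  then show "q \<in> carrier (mono_ring edge_monoid)" using initial_mem unfolding carrier_rees by auto
next
  fix q :: "'k mpoly" assume "q \<in> carrier (mono_ring edge_monoid)"
  then have q: "q \<in> supp_in edge_monoid" by simp
  define p where "p k = top_part k q" for k
  have "lookup q m = 0" if "wdeg V m = 2 * k" "m \<notin> top_exps k" for m k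
  proof (rule ccontr)
    assume "lookup q m \<noteq> 0"
    then have "m \<in> edge_monoid" using q by (auto simp: supp_in_iff)
    then obtain l where "m \<in> top_exps l" using edge_monoid_in_top_exps by blast
    then show False using that by (auto simp: top_exps_def)
  qed
  then have "p k \<in> supp_in (top_exps k)" for k
    by (auto simp: p_def top_part_def supp_in_iff lookup_part)
  then have J: "p k \<in> J k" for k by (rule supp_in_mono[rotated]) (auto simp: top_exps_def)
  define n where "n = (\<Sum>m\<in>keys q. wdeg V m)"
  have "p k = 0" if "k > n" for k
  proof (rule poly_mapping_eqI)
    fix m
    have "lookup q m = 0" if "wdeg V m = 2 * k"
    proof (rule ccontr)
      assume "lookup q m \<noteq> 0"
      then have "wdeg V m \<le> n" unfolding n_def by (intro member_le_sum) (auto simp: in_keys_iff)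
      then show False using that \<open>k > n\<close> by simp
    qed
    then show "lookup (p k) m = lookup 0 m" by (simp add: p_def top_part_def lookup_part)
  qed
  then have p: "p \<in> rees_carrier" using J unfolding rees_carrier_def by blast
  have "initial p = q"
  proof (rule poly_mapping_eqI)
    fix m
    show "lookup (initial p) m = lookup q m"
    proof (cases "m \<in> edge_monoid")
      case True
      then obtain k where "m \<in> top_exps k" using edge_monoid_in_top_exps by blast
      then have "wdeg V m = 2 * k" by (simp add: top_exps_def)
      then show ?thesis using lookup_initial[OF p] by (simp add: p_def top_part_def lookup_part)
    next
      case False
      then show ?thesis using q initial_mem[OF p] by (auto simp: supp_in_iff)
    qed
  qed
  then show "q \<in> initial ` carrier RR" using p unfolding carrier_rees by blast
qed

text \<open>After removing \<open>k\<close> edges from the monomial, the remaining cofactor has positive degree. So the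
  monomial lies in \<open>\<mm> I\<^sup>k\<close>.\<close>

lemma excess_variable:
  assumes "m \<in> pow_exps E k" "m \<in> exps V" "2 * k < wdeg V m"
  shows "\<exists>v\<in>V. \<exists>n\<in>pow_exps E k. m = n + xv v"
  using assms
proof (induction k arbitrary: m)
  case 0
  have "\<not> (\<forall>v\<in>V. lookup m v = 0)"
  proof
    assume "\<forall>v\<in>V. lookup m v = 0"
    then have "wdeg V m = 0" unfolding wdeg_def by (intro sum.neutral)
    then show False using 0(3) by simp
  qed
  then obtain v where v: "v \<in> V" "lookup m v \<noteq> 0" by blast
  then obtain n where "m = n + xv v" by (auto elim: exp_split)
  then show ?case using v by auto
next
  case (Suc k)
  then obtain e r where m: "m = e + r" "e \<in> E" "r \<in> pow_exps E k" by auto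
  have "wdeg V e = 2" using m(2) wdeg_V_ed by blast
  then have "2 * k < wdeg V r" "r \<in> exps V" using Suc.prems m by (auto simp: wdeg_add)
  from Suc.IH[OF m(3) this(2,1)] obtain v n where v: "v \<in> V" "n \<in> pow_exps E k" "r = n + xv v" by blast
  then have "m = (e + n) + xv v" by (simp only: m(1) add.assoc)
  moreover have "e + n \<in> pow_exps E (Suc k)" by (intro pow_exps_SucI m v)
  ultimately show ?case using v(1) by blast
qed

definition mon :: "'k::field mpoly \<Rightarrow> nat \<Rightarrow> nat \<Rightarrow> 'k mpoly" where
  "mon r k = (\<lambda>i. if i = k then r else 0)"

lemma monom_UP: "r \<in> supp_in (exps V) \<Longrightarrow> up_ring.monom (UP S) r k = mon r k"
  by (auto simp: UP_def mpoly_ring_eq mon_def)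

lemma mon_mem: "r \<in> J k \<Longrightarrow> mon r k \<in> rees_carrier"
  by (auto simp: mon_def rees_carrier_def)

lemma mon_0_mult:
  assumes "r \<in> J 0" "q \<in> J k"
  shows "mon r 0 \<otimes>\<^bsub>RR\<^esub> mon q k = mon (r * q) k"
proof
  fix n
  have "(\<Sum>i\<le>n. mon r 0 i * mon q k (n - i)) = (\<Sum>i\<le>n. if i = 0 then r * mon q k n else 0)"
    by (intro sum.cong) (auto simp: mon_def)
  also have "\<dots> = mon (r * q) k n" by (simp add: mon_def)
  finally show "(mon r 0 \<otimes>\<^bsub>RR\<^esub> mon q k) n = mon (r * q) k n"
    unfolding rees_mult[OF mon_mem[OF assms(1)] mon_mem[OF assms(2)]] .
qed

lemma mm_sub: "r \<in> mm \<Longrightarrow> r \<in> supp_in (exps V)"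
  unfolding graded_max_ideal_eq by (erule supp_in_mono[rotated]) auto

lemma rees_extension_eq: "rees_extension S mm (J 1) = Idl\<^bsub>RR\<^esub> ((\<lambda>r. mon r 0) ` (mm :: 'k::field mpoly set))"
  unfolding rees_extension_def by (intro arg_cong[where f = "genideal RR"] image_cong refl monom_UP mm_sub)

text \<open>An element of the kernel has in Rees degree \<open>k\<close> only monomials of degree greater than \<open>2k\<close>. By
  \<open>excess_variable\<close> these split off a variable, that is, an element of \<open>\<mm>\<close> in Rees degree 0.\<close>

lemma kernel_initial: "a_kernel RR (mono_ring edge_monoid) initial = rees_extension S mm (J 1 :: 'k::field mpoly set)"
proof
  interpret R: cring "RR :: ('k mpoly, nat \<Rightarrow> 'k mpoly) up_ring" by (rule rees_cring)
  interpret h: ring_hom_ring "RR :: ('k mpoly, nat \<Rightarrow> 'k mpoly) up_ring" "mono_ring edge_monoid :: 'k mpoly ring" initial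
    by (intro ring_hom_ringI2 R.ring_axioms cring.axioms(1)[OF exp_monoid.cring_mono_ring[OF exp_monoid_edge_monoid]] initial_hom)
  let ?G = "(\<lambda>r. mon r 0) ` (mm :: 'k mpoly set)"
  let ?X = "Idl\<^bsub>RR\<^esub> ?G"
  have G: "?G \<subseteq> carrier RR" using mon_mem[of _ 0] mm_sub unfolding carrier_rees by auto
  show "rees_extension S mm (J 1 :: 'k mpoly set) \<subseteq> a_kernel RR (mono_ring edge_monoid) initial"
    unfolding rees_extension_eq
  proof (rule R.genideal_minimal[OF h.kernel_is_ideal], rule image_subsetI)
    fix r :: "'k mpoly" assume r: "r \<in> mm"
    have "top_part 0 r = 0"
      using r wdeg_V_0 unfolding top_part_def graded_max_ideal_eq
      by (intro part_disjoint[of _ "exps V - {0}"]) auto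
    moreover have "initial (mon r 0) = (\<Sum>k\<le>0. top_part k (mon r 0 k))" by (rule initial_bound) (simp add: mon_def)
    ultimately have "initial (mon r 0) = 0" by (simp add: mon_def)
    then show "mon r 0 \<in> a_kernel RR (mono_ring edge_monoid) initial"
      unfolding a_kernel_def' using r G by auto
  qed
  show "a_kernel RR (mono_ring edge_monoid) initial \<subseteq> rees_extension S mm (J 1 :: 'k mpoly set)"
    unfolding rees_extension_eq
  proof
    fix p :: "nat \<Rightarrow> 'k mpoly" assume "p \<in> a_kernel RR (mono_ring edge_monoid) initial"
    then have p: "p \<in> rees_carrier" and p0: "initial p = 0" unfolding a_kernel_def' carrier_rees by auto
    interpret X: ideal ?X RR by (rule R.genideal_ideal[OF G])
    have X_sub: "x \<in> rees_carrier" if "x \<in> ?X" for x using X.a_subset that carrier_rees by blast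
    have X_add: "(\<lambda>i. x i + y i) \<in> ?X" if "x \<in> ?X" "y \<in> ?X" for x y
      using additive_subgroup.a_closed[OF X.is_additive_subgroup that]
      unfolding rees_add[OF X_sub[OF that(1)] X_sub[OF that(2)]] .
    have X_zero: "(\<lambda>_. 0) \<in> ?X" using additive_subgroup.zero_closed[OF X.is_additive_subgroup] by (simp only: rees_zero)
    have single: "mon (single m c) k \<in> ?X"
      if m: "m \<in> exps V \<inter> pow_exps E k" "2 * k < wdeg V m" for m k and c :: 'k
    proof -
      obtain v n where v: "v \<in> V" "n \<in> pow_exps E k" "m = n + xv v" using excess_variable m by blast
      have n: "n \<in> exps V" using m v by auto
      have Var: "(Var v :: 'k mpoly) \<in> mm" unfolding graded_max_ideal_eq Var_def
        using v(1) by (intro supp_in_single) (auto simp: poly_mapping_eq_iff fun_eq_iff lookup_single when_def)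
      have Var0: "(Var v :: 'k mpoly) \<in> J 0" using mm_sub[OF Var] by simp
      have s: "single n c \<in> J k" using v n by (intro supp_in_single) auto
      have "mon (Var v) 0 \<otimes>\<^bsub>RR\<^esub> mon (single n c) k \<in> ?X"
      proof (rule X.I_r_closed)
        show "mon (Var v) 0 \<in> ?X" using R.genideal_self[OF G] Var by blast
        show "mon (single n c) k \<in> carrier RR" using mon_mem[OF s] by (simp only: carrier_rees)
      qed
      also have "mon (Var v) 0 \<otimes>\<^bsub>RR\<^esub> mon (single n c) k = mon (single m c) k"
        unfolding mon_0_mult[OF Var0 s] by (simp add: Var_def mult_single v(3) add.commute)
      finally show ?thesis .
    qed
    have keys: "m \<in> exps V \<inter> pow_exps E k \<and> 2 * k < wdeg V m" if m: "m \<in> keys (p k)" for m k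
    proof -
      have mem: "m \<in> exps V \<inter> pow_exps E k" using p m by (auto simp: rees_carrier_def supp_in_def)
      have "wdeg V m \<noteq> 2 * k" using lookup_initial[OF p, of m k] p0 m by (auto simp: in_keys_iff)
      then show ?thesis using mem wdeg_V_pow[of m k] by auto
    qed
    have mon_p: "mon (p k) k \<in> ?X" for k
    proof -
      have "mon (\<Sum>m\<in>A. single m (lookup (p k) m)) k \<in> ?X"
        if "finite A" "A \<subseteq> keys (p k)" for A
        using that
      proof (induction A rule: finite_induct)
        case empty
        show ?case using X_zero by (simp add: mon_def cong: if_cong)
      next
        case (insert m A)
        let ?s = "\<lambda>A. \<Sum>m\<in>A. single m (lookup (p k) m)"
        have "(\<lambda>i. mon (single m (lookup (p k) m)) k i + mon (?s A) k i) \<in> ?X"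
          using insert keys by (intro X_add single) auto
        moreover have "(\<lambda>i. mon (single m (lookup (p k) m)) k i + mon (?s A) k i) = mon (?s (insert m A)) k"
          using insert by (auto simp: mon_def)
        ultimately show ?case by simp
      qed
      from this[of "keys (p k)"] show ?thesis by (simp add: sum_singles)
    qed
    \<comment> \<open>Only finitely many Rees degrees occur, so adding up the homogeneous pieces reaches \<open>p\<close>.\<close>
    have trunc: "(\<lambda>i. if i < n then p i else 0) \<in> ?X" for n
    proof (induction n)
      case 0
      then show ?case using X_zero by simp
    next
      case (Suc n)
      have "(\<lambda>i. (if i < n then p i else 0) + mon (p n) n i) \<in> ?X" by (rule X_add[OF Suc mon_p])
      also have "(\<lambda>i. (if i < n then p i else 0) + mon (p n) n i) = (\<lambda>i. if i < Suc n then p i else 0)"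
        by (auto simp: mon_def less_Suc_eq)
      finally show ?case .
    qed
    obtain n where "\<forall>k>n. p k = 0" using p by (auto simp: rees_carrier_def)
    then have "p = (\<lambda>i. if i < Suc n then p i else 0)" by (auto simp: less_Suc_eq_le not_le)
    then show "p \<in> ?X" using trunc[of "Suc n"] by simp
  qed
qed

lemma analytic_spread_J: "analytic_spread S mm (J 1 :: 'k::field mpoly set) = enat b"
proof -
  interpret R: cring "RR :: ('k mpoly, nat \<Rightarrow> 'k mpoly) up_ring" by (rule rees_cring)
  have A: "cring (mono_ring edge_monoid :: 'k mpoly ring)" by (rule exp_monoid.cring_mono_ring[OF exp_monoid_edge_monoid])
  interpret h: ring_hom_ring "RR :: ('k mpoly, nat \<Rightarrow> 'k mpoly) up_ring" "mono_ring edge_monoid :: 'k mpoly ring" initial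
    by (intro ring_hom_ringI2 R.ring_axioms cring.axioms(1)[OF A] initial_hom)
  have "RR Quot rees_extension S mm (J 1 :: 'k mpoly set) \<simeq> (mono_ring edge_monoid :: 'k mpoly ring)"
    using h.FactRing_iso[OF initial_surj] by (simp only: kernel_initial)
  moreover have "cring (RR Quot rees_extension S mm (J 1 :: 'k mpoly set))"
    unfolding kernel_initial[symmetric] by (intro ideal.quotient_is_cring h.kernel_is_ideal rees_cring)
  ultimately show ?thesis unfolding analytic_spread_def using krull_dim_iso[OF _ A] krull_dim_edge_ring[where 'k = 'k] by metis
qed

end

section \<open>Brooms are trees\<close>

lemma pcas_last: "pcas u p v \<Longrightarrow> p \<noteq> [] \<Longrightarrow> snd (last p) = v"
  by (induction p arbitrary: u) auto

lemma pcas_hd: "pcas u p v \<Longrightarrow> p \<noteq> [] \<Longrightarrow> fst (p ! 0) = u"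
  by (cases p) auto

lemma pcas_step: "pcas u p v \<Longrightarrow> Suc i < length p \<Longrightarrow> fst (p ! Suc i) = snd (p ! i)"
proof (induction p arbitrary: u i)
  case (Cons e p)
  then show ?case by (cases i; cases p) auto
qed simp

lemma pawalk_verts_eq: "pcas u p v \<Longrightarrow> pawalk_verts u p = u # map snd p"
proof (induction p arbitrary: u)
  case (Cons e p)
  then show ?case by auto
qed simp

text \<open>The smallest vertex of a cycle would have its only larger neighbour both before and after it, and
  these are different vertices of the cycle as soon as its length is at least 3.\<close>

lemma no_cycle_from_parents:
  fixes f :: "nat \<Rightarrow> nat"
  assumes arcs: "\<And>x y. (x, y) \<in> parcs G \<Longrightarrow> (y = f x \<and> x < y) \<or> (x = f y \<and> y < x)"
    and len: "3 \<le> length p"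
  shows "\<not> pre_digraph.cycle (with_proj G) p"
proof
  assume "pre_digraph.cycle (with_proj G) p"
  then obtain u where sub: "set p \<subseteq> parcs G" and cas: "pcas u p u" and "distinct (tl (pawalk_verts u p))"
    by (auto simp: pre_digraph.cycle_def pre_digraph.awalk_def cas_with_proj_eq awalk_verts_with_proj_eq)
  then have dist: "distinct (map snd p)" by (simp add: pawalk_verts_eq)
  define L where "L = length p"
  define c where "c i = snd (p ! i)" for i
  have ne: "p \<noteq> []" using len by auto
  have c_inj: "i = j" if "c i = c j" "i < L" "j < L" for i j
    using dist that by (auto simp: c_def L_def distinct_conv_nth)
  have arc: "(fst (p ! i), c i) \<in> parcs G" if "i < L" for i
    using sub nth_mem[of i p] that by (auto simp: c_def L_def)
  have first: "fst (p ! 0) = c (L - 1)"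
    using pcas_hd[OF cas ne] pcas_last[OF cas ne] ne by (simp add: c_def L_def last_conv_nth)
  have step: "fst (p ! Suc i) = c i" if "Suc i < L" for i
    using pcas_step[OF cas] that by (simp add: c_def L_def)
  have L: "3 \<le> L" using len by (simp add: L_def)
  obtain i where i: "i < L" "\<And>j. j < L \<Longrightarrow> c i \<le> c j"
  proof -
    have "Min (c ` {..<L}) \<in> c ` {..<L}" using L by (intro Min_in) (auto simp: lessThan_empty_iff)
    then obtain i where "i < L" "c i = Min (c ` {..<L})" by auto
    then show thesis by (intro that) auto
  qed
  define prv where "prv = (if i = 0 then L - 1 else i - 1)"
  define nxt where "nxt = (if i = L - 1 then 0 else Suc i)"
  have lt: "prv < L" "nxt < L" and ne': "prv \<noteq> nxt" using L i(1) by (auto simp: prv_def nxt_def)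
  have "fst (p ! i) = c prv" using first step[of "i - 1"] i(1) by (auto simp: prv_def)
  then have "(c prv, c i) \<in> parcs G" using arc[OF i(1)] by simp
  then have "c prv = f (c i)" using arcs i(2)[OF lt(1)] by (meson leD)
  moreover have "fst (p ! nxt) = c i" using first step[of i] i(1) by (auto simp: nxt_def)
  then have "(c i, c nxt) \<in> parcs G" using arc[OF lt(2)] by simp
  then have "c nxt = f (c i)" using arcs i(2)[OF lt(2)] by (meson leD)
  ultimately show False using c_inj[OF _ lt] ne' by simp
qed

context broom
begin

definition graph :: "nat pair_pre_digraph" where
  "graph = \<lparr>pverts = V, parcs = {(i, parent i) |i. i \<in> {1..b}} \<union> {(parent i, i) |i. i \<in> {1..b}}\<rparr>"

lemma pverts_graph [simp]: "pverts graph = V"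
  by (simp add: graph_def)

lemma parcs_graph: "(i, j) \<in> parcs graph \<longleftrightarrow> (j = parent i \<and> i \<in> {1..b}) \<or> (i = parent j \<and> j \<in> {1..b})"
  by (auto simp: graph_def)

lemma parent_V: "i \<in> {1..b} \<Longrightarrow> i \<in> V \<and> parent i \<in> V"
  using parent_le[of i] parent_gt[of i] by auto

lemma pair_graph_graph: "pair_graph graph"
proof
  show "finite (pverts graph)" by simp
  have "parcs graph \<subseteq> V \<times> V" using parent_V by (auto simp: graph_def)
  then show "finite (parcs graph)" by (rule finite_subset) auto
  show "fst e \<in> pverts graph" if "e \<in> parcs graph" for e
    using that parent_V by (cases e) (auto simp: parcs_graph)
  show "snd e \<in> pverts graph" if "e \<in> parcs graph" for e
    using that parent_V by (cases e) (auto simp: parcs_graph)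
  show "fst e \<noteq> snd e" if "e \<in> parcs graph" for e
  proof -
    have "parent i \<noteq> i" "i \<noteq> parent i" for i using parent_gt[of i] by simp_all
    then show ?thesis using that by (cases e) (auto simp: parcs_graph)
  qed
  show "symmetric (with_proj graph)"
    by (auto simp: symmetric_def sym_def parcs_graph)
qed

lemma connected_graph: "Digraph_Component.connected (with_proj graph)"
proof -
  interpret G: pair_graph graph by (rule pair_graph_graph)
  have "mk_symmetric (with_proj graph) = graph"
    unfolding mk_symmetric_def by (auto simp: graph_def)
  moreover have root: "i \<rightarrow>\<^sup>*\<^bsub>graph\<^esub> Suc b \<and> Suc b \<rightarrow>\<^sup>*\<^bsub>graph\<^esub> i" if "i \<in> V" for i
    using that
  proof (induction "Suc b - i" arbitrary: i rule: less_induct)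
    case less
    show ?case
    proof (cases "i = Suc b")
      case True
      then show ?thesis using less.prems G.reachable_refl by auto
    next
      case False
      then have i: "i \<in> {1..b}" using less.prems by auto
      have "parent i \<rightarrow>\<^sup>*\<^bsub>graph\<^esub> Suc b \<and> Suc b \<rightarrow>\<^sup>*\<^bsub>graph\<^esub> parent i"
        using parent_V[OF i] parent_gt[of i] i by (intro less.hyps) auto
      moreover have "i \<rightarrow>\<^sup>*\<^bsub>graph\<^esub> parent i" "parent i \<rightarrow>\<^sup>*\<^bsub>graph\<^esub> i"
        using i by (auto intro!: G.reachable_adjI simp: parcs_graph)
      ultimately show ?thesis using G.reachable_trans by blast
    qed
  qed
  then have "u \<rightarrow>\<^sup>*\<^bsub>graph\<^esub> v" if "u \<in> V" "v \<in> V" for u v using that G.reachable_trans by blast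
  ultimately show ?thesis unfolding connected_def strongly_connected_def by simp
qed

lemma is_tree_graph: "is_tree graph"
  unfolding is_tree_def
proof (intro conjI pair_graph_graph connected_graph notI)
  assume "\<exists>p. pre_digraph.cycle (with_proj graph) p \<and> 3 \<le> length p"
  then obtain p where "pre_digraph.cycle (with_proj graph) p" "3 \<le> length p" by blast
  moreover have "(y = parent x \<and> x < y) \<or> (x = parent y \<and> y < x)" if "(x, y) \<in> parcs graph" for x y
    using that parent_gt by (auto simp: parcs_graph)
  ultimately show False using no_cycle_from_parents[of graph parent p] by blast
qed

lemma edge_ideal_graph: "edge_ideal graph = (J 1 :: 'k::field mpoly set)"
proof -
  have "{Var i * Var j :: 'k mpoly |i j. (i, j) \<in> parcs graph} = (\<lambda>e. single e 1) ` E"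
  proof (intro equalityI subsetI)
    fix p :: "'k mpoly" assume "p \<in> {Var i * Var j |i j. (i, j) \<in> parcs graph}"
    then obtain i j where p: "p = Var i * Var j" and ij: "(i, j) \<in> parcs graph" by blast
    obtain l where l: "l \<in> {1..b}" "xv i + xv j = ed l"
      using ij unfolding parcs_graph ed_def by (metis add.commute)
    have "p = single (ed l) 1" unfolding p Var_def l(2)[symmetric] by (simp add: mult_single)
    then show "p \<in> (\<lambda>e. single e 1) ` E" using l(1) by blast
  next
    fix p :: "'k mpoly" assume "p \<in> (\<lambda>e. single e 1) ` E"
    then obtain i where i: "i \<in> {1..b}" "p = single (ed i) 1" by auto
    then have "p = Var i * Var (parent i)" by (simp add: Var_def mult_single ed_def)
    moreover have "(i, parent i) \<in> parcs graph" using i by (simp add: parcs_graph)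
    ultimately show "p \<in> {Var i * Var j |i j. (i, j) \<in> parcs graph}" by blast
  qed
  then show ?thesis unfolding edge_ideal_def pverts_graph by (simp only: Idl_monomials[OF E_exps])
qed

end

text \<open>With \<open>h = b - a + 1\<close> the path from \<open>h\<close> to \<open>b\<close> has \<open>a\<close> vertices; \<open>a < b\<close> guarantees that there is at least
  one leaf below \<open>h\<close>.\<close>

theorem corollary2p2:
  fixes a b :: nat
  assumes "1 \<le> a" and "a < b"
  shows "\<exists>(n::nat) (G :: nat pair_pre_digraph).
    pverts G = {1..n} \<and> is_tree G \<and>
    (let S = (mpoly_ring {1..n} :: ('k::field) mpoly ring);
         \<mm> = graded_max_ideal {1..n};
         I = edge_ideal G
     in dstab S \<mm> I = a \<and> analytic_spread S \<mm> I = enat b)"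
proof -
  interpret broom "b - a + 1" b
    using assms by unfold_locales auto
  have "b - (b - a + 1) + 1 = a" using assms by auto
  then have "dstab S mm (edge_ideal graph :: 'k mpoly set) = a"
    using dstab_J[where 'k = 'k] by (simp only: edge_ideal_graph)
  moreover have "analytic_spread S mm (edge_ideal graph :: 'k mpoly set) = enat b"
    unfolding edge_ideal_graph by (rule analytic_spread_J)
  ultimately show ?thesis
    unfolding Let_def using is_tree_graph pverts_graph by blast
qed

end
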